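(* Let $(H,N)$ be a Koszul-Vinberg-Nijenhuis structure on a left-symmetric algebroid $(A,\cdot_A,a_A)$. For $k\in\mathbb N=\{0,1,2,\dots\}$ let $H_{N^k}\in \mathrm{Sym}^2(A)$ be defined by $(H_{N^k})^\sharp=N^k\circ H^\sharp$. Then for all $k\in\mathbb N$, $H_{N^k}$ is a Koszul-Vinberg structure on $A$. Furthermore, for all $k,l\in\mathbb N$, $H_{N^k}$ and $H_{N^l}$ are compatible, i.e. $[\![ H_{N^k},H_{N^l}]\!]_A=0$.
   Context: Left-symmetric algebroids. A left-symmetric algebroid $(A,\cdot_A,a_A)$ is a smooth real vector bundle $A\to M$ with an $\mathbb R$-bilinear operation $\cdot_A$ on $\Gamma(A)$ such that $x\cdot_A(y\cdot_A z)-(x\cdot_A y)\cdot_A z$ is symmetric in $x,y$, and a bundle map $a_A:A\to TM$ such that $x\cdot_A(fy)=f(x\cdot_A y)+a_A(x)(f)\,y$ and $(fx)\cdot_A y=f(x\cdot_A y)$ for $x,y\in\Gamma(A)$, $f\in C^\infty(M)$. Put $[x,y]_A=x\cdot_A y-y\cdot_A x$; $(A,[-,-]_A,a_A)$ is a Lie algebroid. Nijenhuis operators. A bundle map $N:A\to A$ (over the identity) is a Nijenhuis operator on $A$ if $N(x)\cdot_A N(y)=N\big(x\cdot_A N(y)+N(x)\cdot_A y-N(x\cdot_A y)\big)$ for all $x,y\in\Gamma(A)$. Then $x\cdot_N y=N(x)\cdot_A y+x\cdot_A N(y)-N(x\cdot_A y)$ and $a_N=a_A\circ N$ make $(A,\cdot_N,a_N)$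 a left-symmetric algebroid; $[x,y]_N=x\cdot_N y-y\cdot_N x$. $N^*:A^*\to A^*$ is the dual map. Koszul-Vinberg structures. $\mathrm{Sym}^2(A)$ is the set of symmetric sections $H$ of $A\otimes A$; $H^\sharp:A^*\to A$ is $\langle H^\sharp(\alpha),\beta\rangle=H(\alpha,\beta)$. For $H_1,H_2\in \mathrm{Sym}^2(A)$ and $\alpha_i\in\Gamma(A^* )$, $$\begin{aligned}[\![ H_1,H_2]\!]_A(\alpha_1,\alpha_2,\alpha_3)=\tfrac12\sum_{(i,j)\in\{(1,2),(2,1)\}}\Big(&a_A(H_i^\sharp(\alpha_1))\langle H_j^\sharp(\alpha_2),\alpha_3\rangle-a_A(H_i^\sharp(\alpha_2))\langle H_j^\sharp(\alpha_1),\alpha_3\rangle\\&+\langle\alpha_1,H_i^\sharp(\alpha_2)\cdot_A H_j^\sharp(\alpha_3)\rangle-\langle\alpha_2,H_i^\sharp(\alpha_1)\cdot_A H_j^\sharp(\alpha_3)\rangle-\langle\alpha_3,[H_i^\sharp(\alpha_1),H_j^\sharp(\alpha_2)]_A\rangle\Big).\end{aligned}$$ $H$ is a Koszul-Vinberg structure if $[\![ H,H]\!]_A=0$; two Koszul-Vinberg structures $H_1,H_2$ are compatible if $[\![ H_1,H_2]\!]_A=0$. Products on $\Gamma(A^* )$. For $x,y\in\Gamma(A)$, $\alpha,\beta\in\Gamma(A^* )$, $f\in C^\infty(M)$: $\langle\mathcal L_x\alpha,y\rangle=a_A(x)\langle\alpha,y\rangle-\langle\alpha,[x,y]_A\rangle$,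 $\langle R_x\alpha,y\rangle=-\langle\alpha,y\cdot_A x\rangle$, $\langle d_Af,x\rangle=a_A(x)(f)$. Set $\alpha\cdot^{H^\sharp}\beta=\mathcal L_{H^\sharp(\alpha)}\beta-R_{H^\sharp(\beta)}\alpha-d_A(H(\alpha,\beta))$. Let $\mathcal L^N,R^N,d_A^N$ be given by the same formulas with $(\cdot_A,[-,-]_A,a_A)$ replaced by $(\cdot_N,[-,-]_N,a_N)$, and set $\alpha\star^{H^\sharp}\beta=\mathcal L^N_{H^\sharp(\alpha)}\beta-R^N_{H^\sharp(\beta)}\alpha-d^N_A(H(\alpha,\beta))$ and $\alpha\cdot^{H^\sharp}_{N^*}\beta=N^*(\alpha)\cdot^{H^\sharp}\beta+\alpha\cdot^{H^\sharp}N^*(\beta)-N^*(\alpha\cdot^{H^\sharp}\beta)$. Koszul-Vinberg-Nijenhuis (KVN) structure: a pair $(H,N)$ with $H$ a Koszul-Vinberg structure and $N$ a Nijenhuis operator on $A$ such that $N\circ H^\sharp=H^\sharp\circ N^*$ and $\alpha\star^{H^\sharp}\beta=\alpha\cdot^{H^\sharp}_{N^*}\beta$ for all $\alpha,\beta\in\Gamma(A^* )$. *)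

theory Defs
  imports "HOL-Analysis.Analysis"
begin

section \<open>Smooth maps between finite-dimensional spaces\<close>

text \<open>
  Model spaces are arbitrary finite-dimensional real normed spaces rather than Euclidean spaces,
  because the class of Euclidean spaces excludes dimension 0 (and hence, for example, left-symmetric
  algebras seen as algebroids over a point).
\<close>

definition finite_dim :: "'a::real_vector itself \<Rightarrow> bool" where
  "finite_dim _ \<longleftrightarrow> (\<exists>B::'a set. finite B \<and> span B = UNIV)"

primrec Ck_on ::
  "nat \<Rightarrow> 'a::real_normed_vector set \<Rightarrow> ('a \<Rightarrow> 'b::real_normed_vector) \<Rightarrow> bool" where
  "Ck_on 0 = (\<lambda>S f. continuous_on S f)"
| "Ck_on (Suc k) = (\<lambda>S f. (\<forall>x\<in>S. f differentiable (at x)) \<and>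
     (\<forall>v. Ck_on k S (\<lambda>x. frechet_derivative f (at x) v)))"

text \<open>Only used for open \<open>S\<close>.\<close>

definition smooth_on ::
  "'a::real_normed_vector set \<Rightarrow> ('a \<Rightarrow> 'b::real_normed_vector) \<Rightarrow> bool" where
  "smooth_on S f \<longleftrightarrow> (\<forall>k. Ck_on k S f)"


section \<open>Manifolds\<close>

text \<open>
  The manifold is the whole of a Hausdorff, second countable type. An atlas is not required to be
  maximal; no notion below changes when it is enlarged to the maximal one.
\<close>

type_synonym ('m, 'e) chart = "'m set \<times> ('m \<Rightarrow> 'e)"

definition is_chart :: "('m::topological_space, 'e::real_normed_vector) chart \<Rightarrow> bool" where
  "is_chart = (\<lambda>(U, c). open U \<and> open (c ` U) \<and> homeomorphism U (c ` U) c (inv_into U c))"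

definition smooth_manifold ::
  "('m::{t2_space,second_countable_topology}, 'e::real_normed_vector) chart set \<Rightarrow> bool" where
  "smooth_manifold \<A> \<longleftrightarrow>
     finite_dim TYPE('e) \<and>
     (\<forall>\<kappa>\<in>\<A>. is_chart \<kappa>) \<and> (\<Union>\<kappa>\<in>\<A>. fst \<kappa>) = UNIV \<and>
     (\<forall>(U, c)\<in>\<A>. \<forall>(V, d)\<in>\<A>. smooth_on (c ` (U \<inter> V)) (d \<circ> inv_into U c))"

definition smooth_map_on ::
  "('m::topological_space, 'e::real_normed_vector) chart set \<Rightarrow> 'm set
     \<Rightarrow> ('m \<Rightarrow> 'b::real_normed_vector) \<Rightarrow> bool" where
  "smooth_map_on \<A> W f \<longleftrightarrow> (\<forall>(U, c)\<in>\<A>. smooth_on (c ` (U \<inter> W)) (f \<circ> inv_into U c))"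

text \<open>
  A tangent vector at \<open>p\<close> is the family of its components in all charts around \<open>p\<close>, related by the
  derivatives of the transition maps (and 0 at every other index).
\<close>

definition tangent_space ::
  "('m::topological_space, 'e::real_normed_vector) chart set \<Rightarrow> 'm
     \<Rightarrow> (('m, 'e) chart \<Rightarrow> 'e) set" where
  "tangent_space \<A> p =
     {t. (\<forall>(U, c)\<in>\<A>. \<forall>(V, d)\<in>\<A>. p \<in> U \<longrightarrow> p \<in> V \<longrightarrow>
            t (V, d) = frechet_derivative (d \<circ> inv_into U c) (at (c p)) (t (U, c))) \<and>
         (\<forall>\<kappa>. \<kappa> \<notin> \<A> \<or> p \<notin> fst \<kappa> \<longrightarrow> t \<kappa> = 0)}"

text \<open>The derivative of \<open>f\<close> along \<open>t\<close>; by the chain rule the choice of the chart is immaterial.\<close>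

definition tangent_deriv ::
  "('m::topological_space, 'e::real_normed_vector) chart set \<Rightarrow> 'm
     \<Rightarrow> (('m, 'e) chart \<Rightarrow> 'e) \<Rightarrow> ('m \<Rightarrow> real) \<Rightarrow> real" where
  "tangent_deriv \<A> p t f =
     (let \<kappa> = (SOME \<kappa>. \<kappa> \<in> \<A> \<and> p \<in> fst \<kappa>)
      in frechet_derivative (f \<circ> inv_into (fst \<kappa>) (snd \<kappa>)) (at (snd \<kappa> p)) (t \<kappa>))"


section \<open>Vector bundles\<close>

text \<open>
  The fibres are subspaces of one real vector space \<open>'v\<close>, which carries no topology and may have
  any dimension; this only serves to give them a common type (for an arbitrary bundle one can take
  \<open>'v\<close> to be the direct sum of all fibres). The smooth structure comes from the local
  trivialisations \<open>(U, \<phi>)\<close>, where \<open>\<phi> p\<close> maps the fibre over \<open>p \<in> U\<close> isomorphically to \<open>'f\<close>.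
\<close>

record ('m, 'e, 'v, 'f) vbundle =
  atlas :: "('m, 'e) chart set"
  fibre :: "'m \<Rightarrow> 'v set"
  trivs :: "('m set \<times> ('m \<Rightarrow> 'v \<Rightarrow> 'f)) set"

definition lin_on :: "'a::real_vector set \<Rightarrow> ('a \<Rightarrow> 'b::real_vector) \<Rightarrow> bool" where
  "lin_on V f \<longleftrightarrow> (\<forall>x\<in>V. \<forall>y\<in>V. f (x + y) = f x + f y) \<and>
     (\<forall>c. \<forall>x\<in>V. f (c *\<^sub>R x) = c *\<^sub>R f x)"

text \<open>The local section of \<open>A\<close> that is constantly \<open>w\<close> in the trivialisation \<open>\<phi>\<close>.\<close>

definition const_sec ::
  "('m, 'e, 'v, 'f, 'z) vbundle_scheme \<Rightarrow> ('m \<Rightarrow> 'v \<Rightarrow> 'f) \<Rightarrow> 'f \<Rightarrow> 'm \<Rightarrow> 'v" where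
  "const_sec A \<phi> w p = inv_into (fibre A p) (\<phi> p) w"

definition vector_bundle ::
  "('m::{t2_space,second_countable_topology}, 'e::real_normed_vector, 'v::real_vector,
    'f::real_normed_vector, 'z) vbundle_scheme \<Rightarrow> bool" where
  "vector_bundle A \<longleftrightarrow>
     smooth_manifold (atlas A) \<and> finite_dim TYPE('f) \<and>
     (\<forall>p. subspace (fibre A p)) \<and>
     (\<forall>(U, \<phi>)\<in>trivs A. open U \<and>
        (\<forall>p\<in>U. lin_on (fibre A p) (\<phi> p) \<and> bij_betw (\<phi> p) (fibre A p) UNIV)) \<and>
     (\<Union>\<tau>\<in>trivs A. fst \<tau>) = UNIV \<and>
     (\<forall>(U, \<phi>)\<in>trivs A. \<forall>(V, \<psi>)\<in>trivs A. \<forall>w.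
        smooth_map_on (atlas A) (U \<inter> V) (\<lambda>p. \<psi> p (const_sec A \<phi> w p)))"

definition smooth_funs ::
  "('m::topological_space, 'e::real_normed_vector, 'v, 'f, 'z) vbundle_scheme
     \<Rightarrow> ('m \<Rightarrow> real) set" where
  "smooth_funs A = {f. smooth_map_on (atlas A) UNIV f}"

definition sections ::
  "('m::topological_space, 'e::real_normed_vector, 'v::real_vector, 'f::real_normed_vector, 'z)
     vbundle_scheme \<Rightarrow> ('m \<Rightarrow> 'v) set" where
  "sections A = {x. (\<forall>p. x p \<in> fibre A p) \<and>
     (\<forall>(U, \<phi>)\<in>trivs A. smooth_map_on (atlas A) U (\<lambda>p. \<phi> p (x p)))}"

text \<open>
  Fibres of \<open>A\<^sup>*\<close>. Covectors are extended by 0 off the fibre, so that equality of covectors is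
  equality of functions.
\<close>

definition dual_fibre ::
  "('m, 'e, 'v::real_vector, 'f, 'z) vbundle_scheme \<Rightarrow> 'm \<Rightarrow> ('v \<Rightarrow> real) set" where
  "dual_fibre A p = {\<alpha>. lin_on (fibre A p) \<alpha> \<and> (\<forall>v. v \<notin> fibre A p \<longrightarrow> \<alpha> v = 0)}"

definition dual_sections ::
  "('m::topological_space, 'e::real_normed_vector, 'v::real_vector, 'f::real_normed_vector, 'z)
     vbundle_scheme \<Rightarrow> ('m \<Rightarrow> 'v \<Rightarrow> real) set" where
  "dual_sections A = {\<alpha>. (\<forall>p. \<alpha> p \<in> dual_fibre A p) \<and>
     (\<forall>(U, \<phi>)\<in>trivs A. \<forall>w. smooth_map_on (atlas A) U (\<lambda>p. \<alpha> p (const_sec A \<phi> w p)))}"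

definition pair :: "('m \<Rightarrow> 'v \<Rightarrow> real) \<Rightarrow> ('m \<Rightarrow> 'v) \<Rightarrow> 'm \<Rightarrow> real" where
  "pair \<alpha> x = (\<lambda>p. \<alpha> p (x p))"

text \<open>The section \<open>\<gamma>\<close> of \<open>A\<^sup>*\<close> determined by \<open>\<langle>\<gamma>, y\<rangle> = F y\<close> for all sections \<open>y\<close> of \<open>A\<close>.\<close>

definition dual_sec_of ::
  "('m::topological_space, 'e::real_normed_vector, 'v::real_vector, 'f::real_normed_vector, 'z)
     vbundle_scheme \<Rightarrow> (('m \<Rightarrow> 'v) \<Rightarrow> 'm \<Rightarrow> real) \<Rightarrow> 'm \<Rightarrow> 'v \<Rightarrow> real" where
  "dual_sec_of A F = (THE \<gamma>. \<gamma> \<in> dual_sections A \<and> (\<forall>y\<in>sections A. pair \<gamma> y = F y))"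

text \<open>
  Bundle endomorphisms over the identity; their values off the fibres are irrelevant.
\<close>

definition bundle_endo ::
  "('m::topological_space, 'e::real_normed_vector, 'v::real_vector, 'f::real_normed_vector, 'z)
     vbundle_scheme \<Rightarrow> ('m \<Rightarrow> 'v \<Rightarrow> 'v) \<Rightarrow> bool" where
  "bundle_endo A N \<longleftrightarrow>
     (\<forall>p. lin_on (fibre A p) (N p) \<and> N p ` fibre A p \<subseteq> fibre A p) \<and>
     (\<forall>(U, \<phi>)\<in>trivs A. \<forall>(V, \<psi>)\<in>trivs A. \<forall>w.
        smooth_map_on (atlas A) (U \<inter> V) (\<lambda>p. \<psi> p (N p (const_sec A \<phi> w p))))"

definition app :: "('m \<Rightarrow> 'a \<Rightarrow> 'b) \<Rightarrow> ('m \<Rightarrow> 'a) \<Rightarrow> 'm \<Rightarrow> 'b" where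
  "app N x = (\<lambda>p. N p (x p))"

definition dual_map ::
  "('m, 'e, 'v::real_vector, 'f, 'z) vbundle_scheme \<Rightarrow> ('m \<Rightarrow> 'v \<Rightarrow> 'v)
     \<Rightarrow> 'm \<Rightarrow> ('v \<Rightarrow> real) \<Rightarrow> 'v \<Rightarrow> real" where
  "dual_map A N p \<alpha> = (\<lambda>v. if v \<in> fibre A p then \<alpha> (N p v) else 0)"


section \<open>Left-symmetric algebroids\<close>

record ('m, 'e, 'v, 'f) lsa = "('m, 'e, 'v, 'f) vbundle" +
  mul :: "('m \<Rightarrow> 'v) \<Rightarrow> ('m \<Rightarrow> 'v) \<Rightarrow> 'm \<Rightarrow> 'v"
  anchor :: "'m \<Rightarrow> 'v \<Rightarrow> ('m, 'e) chart \<Rightarrow> 'e"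

text \<open>Smooth bundle maps from \<open>A\<close> to the tangent bundle.\<close>

definition anchor_map ::
  "('m::topological_space, 'e::real_normed_vector, 'v::real_vector, 'f::real_normed_vector, 'z)
     lsa_scheme \<Rightarrow> bool" where
  "anchor_map A \<longleftrightarrow>
     (\<forall>p. \<forall>v\<in>fibre A p. anchor A p v \<in> tangent_space (atlas A) p) \<and>
     (\<forall>p \<kappa>. lin_on (fibre A p) (\<lambda>v. anchor A p v \<kappa>)) \<and>
     (\<forall>(U, \<phi>)\<in>trivs A. \<forall>(V, c)\<in>atlas A. \<forall>w.
        smooth_map_on (atlas A) (U \<inter> V) (\<lambda>p. anchor A p (const_sec A \<phi> w p) (V, c)))"

text \<open>The function \<open>a\<^sub>A(x)(f)\<close>.\<close>

definition rho ::
  "('m::topological_space, 'e::real_normed_vector, 'v, 'f, 'z) lsa_scheme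
     \<Rightarrow> ('m \<Rightarrow> 'v) \<Rightarrow> ('m \<Rightarrow> real) \<Rightarrow> 'm \<Rightarrow> real" where
  "rho A x f = (\<lambda>p. tangent_deriv (atlas A) p (anchor A p (x p)) f)"

definition left_symmetric_algebroid ::
  "('m::{t2_space,second_countable_topology}, 'e::real_normed_vector, 'v::real_vector,
    'f::real_normed_vector, 'z) lsa_scheme \<Rightarrow> bool" where
  "left_symmetric_algebroid A \<longleftrightarrow>
     vector_bundle A \<and> anchor_map A \<and>
     (\<forall>x\<in>sections A. \<forall>y\<in>sections A. mul A x y \<in> sections A) \<and>
     (\<forall>x\<in>sections A. \<forall>y\<in>sections A. \<forall>z\<in>sections A.
        mul A (\<lambda>p. x p + y p) z = (\<lambda>p. mul A x z p + mul A y z p) \<and>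
        mul A x (\<lambda>p. y p + z p) = (\<lambda>p. mul A x y p + mul A x z p)) \<and>
     (\<forall>c::real. \<forall>x\<in>sections A. \<forall>y\<in>sections A.
        mul A (\<lambda>p. c *\<^sub>R x p) y = (\<lambda>p. c *\<^sub>R mul A x y p) \<and>
        mul A x (\<lambda>p. c *\<^sub>R y p) = (\<lambda>p. c *\<^sub>R mul A x y p)) \<and>
     (\<forall>x\<in>sections A. \<forall>y\<in>sections A. \<forall>z\<in>sections A. \<forall>p.
        mul A x (mul A y z) p - mul A (mul A x y) z p =
        mul A y (mul A x z) p - mul A (mul A y x) z p) \<and>
     (\<forall>f\<in>smooth_funs A. \<forall>x\<in>sections A. \<forall>y\<in>sections A.
        mul A x (\<lambda>p. f p *\<^sub>R y p) = (\<lambda>p. f p *\<^sub>R mul A x y p + rho A x f p *\<^sub>R y p) \<and>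
        mul A (\<lambda>p. f p *\<^sub>R x p) y = (\<lambda>p. f p *\<^sub>R mul A x y p))"

definition bracket ::
  "('m, 'e, 'v::real_vector, 'f, 'z) lsa_scheme \<Rightarrow> ('m \<Rightarrow> 'v) \<Rightarrow> ('m \<Rightarrow> 'v) \<Rightarrow> 'm \<Rightarrow> 'v" where
  "bracket A x y = (\<lambda>p. mul A x y p - mul A y x p)"

definition nijenhuis ::
  "('m::topological_space, 'e::real_normed_vector, 'v::real_vector, 'f::real_normed_vector, 'z)
     lsa_scheme \<Rightarrow> ('m \<Rightarrow> 'v \<Rightarrow> 'v) \<Rightarrow> bool" where
  "nijenhuis A N \<longleftrightarrow> bundle_endo A N \<and>
     (\<forall>x\<in>sections A. \<forall>y\<in>sections A.
        mul A (app N x) (app N y) =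
        app N (\<lambda>p. mul A x (app N y) p + mul A (app N x) y p - app N (mul A x y) p))"

text \<open>The algebroid \<open>(A, \<cdot>\<^sub>N, a\<^sub>N)\<close>.\<close>

definition deformed ::
  "('m, 'e, 'v::real_vector, 'f, 'z) lsa_scheme \<Rightarrow> ('m \<Rightarrow> 'v \<Rightarrow> 'v)
     \<Rightarrow> ('m, 'e, 'v, 'f, 'z) lsa_scheme" where
  "deformed A N = A\<lparr>
     mul := (\<lambda>x y p. mul A (app N x) y p + mul A x (app N y) p - app N (mul A x y) p),
     anchor := (\<lambda>p v. anchor A p (N p v))\<rparr>"


section \<open>Koszul-Vinberg structures\<close>

text \<open>The covector over \<open>p\<close> with components \<open>u\<close> in the trivialisation \<open>\<phi>\<close>.\<close>

definition const_cosec ::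
  "('m, 'e, 'v, 'f, 'z) vbundle_scheme \<Rightarrow> ('m \<Rightarrow> 'v \<Rightarrow> 'f) \<Rightarrow> ('f \<Rightarrow> real)
     \<Rightarrow> 'm \<Rightarrow> 'v \<Rightarrow> real" where
  "const_cosec A \<phi> u p = (\<lambda>v. if v \<in> fibre A p then u (\<phi> p v) else 0)"

text \<open>
  Elements of \<open>A \<otimes> A\<close> over \<open>p\<close> are bilinear forms on \<open>A\<^sup>*\<close> over \<open>p\<close>, extended by 0 to
  arguments that are not covectors at \<open>p\<close>.
\<close>

definition Sym2 ::
  "('m::topological_space, 'e::real_normed_vector, 'v::real_vector, 'f::real_normed_vector, 'z)
     vbundle_scheme \<Rightarrow> ('m \<Rightarrow> ('v \<Rightarrow> real) \<Rightarrow> ('v \<Rightarrow> real) \<Rightarrow> real) set" where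
  "Sym2 A = {H.
     (\<forall>p. \<forall>\<alpha>\<in>dual_fibre A p. \<forall>\<beta>\<in>dual_fibre A p. H p \<alpha> \<beta> = H p \<beta> \<alpha>) \<and>
     (\<forall>p. \<forall>\<alpha>\<in>dual_fibre A p. \<forall>\<beta>\<in>dual_fibre A p. \<forall>\<gamma>\<in>dual_fibre A p. \<forall>c.
        H p (\<lambda>v. \<alpha> v + \<beta> v) \<gamma> = H p \<alpha> \<gamma> + H p \<beta> \<gamma> \<and>
        H p (\<lambda>v. c * \<alpha> v) \<gamma> = c * H p \<alpha> \<gamma>) \<and>
     (\<forall>p \<alpha> \<beta>. \<alpha> \<notin> dual_fibre A p \<or> \<beta> \<notin> dual_fibre A p \<longrightarrow> H p \<alpha> \<beta> = 0) \<and>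
     (\<forall>(U, \<phi>)\<in>trivs A. \<forall>u w. linear u \<longrightarrow> linear w \<longrightarrow>
        smooth_map_on (atlas A) U (\<lambda>p. H p (const_cosec A \<phi> u p) (const_cosec A \<phi> w p)))}"

definition sharp ::
  "('m, 'e, 'v::real_vector, 'f, 'z) vbundle_scheme
     \<Rightarrow> ('m \<Rightarrow> ('v \<Rightarrow> real) \<Rightarrow> ('v \<Rightarrow> real) \<Rightarrow> real) \<Rightarrow> 'm \<Rightarrow> ('v \<Rightarrow> real) \<Rightarrow> 'v" where
  "sharp A H p \<alpha> = (THE v. v \<in> fibre A p \<and> (\<forall>\<beta>\<in>dual_fibre A p. \<beta> v = H p \<alpha> \<beta>))"

definition KV_summand ::
  "('m::topological_space, 'e::real_normed_vector, 'v::real_vector, 'f, 'z) lsa_scheme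
     \<Rightarrow> ('m \<Rightarrow> ('v \<Rightarrow> real) \<Rightarrow> ('v \<Rightarrow> real) \<Rightarrow> real)
     \<Rightarrow> ('m \<Rightarrow> ('v \<Rightarrow> real) \<Rightarrow> ('v \<Rightarrow> real) \<Rightarrow> real)
     \<Rightarrow> ('m \<Rightarrow> 'v \<Rightarrow> real) \<Rightarrow> ('m \<Rightarrow> 'v \<Rightarrow> real) \<Rightarrow> ('m \<Rightarrow> 'v \<Rightarrow> real) \<Rightarrow> 'm \<Rightarrow> real" where
  "KV_summand A Hi Hj \<alpha>1 \<alpha>2 \<alpha>3 = (\<lambda>p.
     rho A (app (sharp A Hi) \<alpha>1) (pair \<alpha>3 (app (sharp A Hj) \<alpha>2)) p
   - rho A (app (sharp A Hi) \<alpha>2) (pair \<alpha>3 (app (sharp A Hj) \<alpha>1)) p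
   + pair \<alpha>1 (mul A (app (sharp A Hi) \<alpha>2) (app (sharp A Hj) \<alpha>3)) p
   - pair \<alpha>2 (mul A (app (sharp A Hi) \<alpha>1) (app (sharp A Hj) \<alpha>3)) p
   - pair \<alpha>3 (bracket A (app (sharp A Hi) \<alpha>1) (app (sharp A Hj) \<alpha>2)) p)"

definition KV_bracket ::
  "('m::topological_space, 'e::real_normed_vector, 'v::real_vector, 'f, 'z) lsa_scheme
     \<Rightarrow> ('m \<Rightarrow> ('v \<Rightarrow> real) \<Rightarrow> ('v \<Rightarrow> real) \<Rightarrow> real)
     \<Rightarrow> ('m \<Rightarrow> ('v \<Rightarrow> real) \<Rightarrow> ('v \<Rightarrow> real) \<Rightarrow> real)
     \<Rightarrow> ('m \<Rightarrow> 'v \<Rightarrow> real) \<Rightarrow> ('m \<Rightarrow> 'v \<Rightarrow> real) \<Rightarrow> ('m \<Rightarrow> 'v \<Rightarrow> real) \<Rightarrow> 'm \<Rightarrow> real" where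
  "KV_bracket A H1 H2 \<alpha>1 \<alpha>2 \<alpha>3 = (\<lambda>p.
     (1/2) * (KV_summand A H1 H2 \<alpha>1 \<alpha>2 \<alpha>3 p + KV_summand A H2 H1 \<alpha>1 \<alpha>2 \<alpha>3 p))"

definition KV_bracket_zero ::
  "('m::topological_space, 'e::real_normed_vector, 'v::real_vector, 'f::real_normed_vector, 'z)
     lsa_scheme \<Rightarrow> ('m \<Rightarrow> ('v \<Rightarrow> real) \<Rightarrow> ('v \<Rightarrow> real) \<Rightarrow> real)
     \<Rightarrow> ('m \<Rightarrow> ('v \<Rightarrow> real) \<Rightarrow> ('v \<Rightarrow> real) \<Rightarrow> real) \<Rightarrow> bool" where
  "KV_bracket_zero A H1 H2 \<longleftrightarrow>
     (\<forall>\<alpha>1\<in>dual_sections A. \<forall>\<alpha>2\<in>dual_sections A. \<forall>\<alpha>3\<in>dual_sections A.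
        KV_bracket A H1 H2 \<alpha>1 \<alpha>2 \<alpha>3 = (\<lambda>p. 0))"

definition koszul_vinberg ::
  "('m::topological_space, 'e::real_normed_vector, 'v::real_vector, 'f::real_normed_vector, 'z)
     lsa_scheme \<Rightarrow> ('m \<Rightarrow> ('v \<Rightarrow> real) \<Rightarrow> ('v \<Rightarrow> real) \<Rightarrow> real) \<Rightarrow> bool" where
  "koszul_vinberg A H \<longleftrightarrow> H \<in> Sym2 A \<and> KV_bracket_zero A H H"

definition KV_compatible ::
  "('m::topological_space, 'e::real_normed_vector, 'v::real_vector, 'f::real_normed_vector, 'z)
     lsa_scheme \<Rightarrow> ('m \<Rightarrow> ('v \<Rightarrow> real) \<Rightarrow> ('v \<Rightarrow> real) \<Rightarrow> real)
     \<Rightarrow> ('m \<Rightarrow> ('v \<Rightarrow> real) \<Rightarrow> ('v \<Rightarrow> real) \<Rightarrow> real) \<Rightarrow> bool" where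
  "KV_compatible A H1 H2 \<longleftrightarrow>
     koszul_vinberg A H1 \<and> koszul_vinberg A H2 \<and> KV_bracket_zero A H1 H2"


section \<open>Koszul-Vinberg-Nijenhuis structures\<close>

definition lie_der ::
  "('m::topological_space, 'e::real_normed_vector, 'v::real_vector, 'f::real_normed_vector, 'z)
     lsa_scheme \<Rightarrow> ('m \<Rightarrow> 'v) \<Rightarrow> ('m \<Rightarrow> 'v \<Rightarrow> real) \<Rightarrow> 'm \<Rightarrow> 'v \<Rightarrow> real" where
  "lie_der A x \<alpha> = dual_sec_of A (\<lambda>y p. rho A x (pair \<alpha> y) p - pair \<alpha> (bracket A x y) p)"

definition right_der ::
  "('m::topological_space, 'e::real_normed_vector, 'v::real_vector, 'f::real_normed_vector, 'z)
     lsa_scheme \<Rightarrow> ('m \<Rightarrow> 'v) \<Rightarrow> ('m \<Rightarrow> 'v \<Rightarrow> real) \<Rightarrow> 'm \<Rightarrow> 'v \<Rightarrow> real" where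
  "right_der A x \<alpha> = dual_sec_of A (\<lambda>y p. - pair \<alpha> (mul A y x) p)"

definition ext_d ::
  "('m::topological_space, 'e::real_normed_vector, 'v::real_vector, 'f::real_normed_vector, 'z)
     lsa_scheme \<Rightarrow> ('m \<Rightarrow> real) \<Rightarrow> 'm \<Rightarrow> 'v \<Rightarrow> real" where
  "ext_d A f = dual_sec_of A (\<lambda>x. rho A x f)"

definition dual_mul ::
  "('m::topological_space, 'e::real_normed_vector, 'v::real_vector, 'f::real_normed_vector, 'z)
     lsa_scheme \<Rightarrow> ('m \<Rightarrow> ('v \<Rightarrow> real) \<Rightarrow> ('v \<Rightarrow> real) \<Rightarrow> real)
     \<Rightarrow> ('m \<Rightarrow> 'v \<Rightarrow> real) \<Rightarrow> ('m \<Rightarrow> 'v \<Rightarrow> real) \<Rightarrow> 'm \<Rightarrow> 'v \<Rightarrow> real" where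
  "dual_mul A H \<alpha> \<beta> = (\<lambda>p v.
     lie_der A (app (sharp A H) \<alpha>) \<beta> p v
   - right_der A (app (sharp A H) \<beta>) \<alpha> p v
   - ext_d A (\<lambda>q. H q (\<alpha> q) (\<beta> q)) p v)"

text \<open>
  The product \<open>\<star>\<close>: as \<open>sharp\<close> depends only on the bundle, passing to the deformed algebroid
  replaces exactly the product, the bracket and the anchor.
\<close>

definition star_mul ::
  "('m::topological_space, 'e::real_normed_vector, 'v::real_vector, 'f::real_normed_vector, 'z)
     lsa_scheme \<Rightarrow> ('m \<Rightarrow> 'v \<Rightarrow> 'v) \<Rightarrow> ('m \<Rightarrow> ('v \<Rightarrow> real) \<Rightarrow> ('v \<Rightarrow> real) \<Rightarrow> real)
     \<Rightarrow> ('m \<Rightarrow> 'v \<Rightarrow> real) \<Rightarrow> ('m \<Rightarrow> 'v \<Rightarrow> real) \<Rightarrow> 'm \<Rightarrow> 'v \<Rightarrow> real" where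
  "star_mul A N H = dual_mul (deformed A N) H"

definition dual_mul_deformed ::
  "('m::topological_space, 'e::real_normed_vector, 'v::real_vector, 'f::real_normed_vector, 'z)
     lsa_scheme \<Rightarrow> ('m \<Rightarrow> 'v \<Rightarrow> 'v) \<Rightarrow> ('m \<Rightarrow> ('v \<Rightarrow> real) \<Rightarrow> ('v \<Rightarrow> real) \<Rightarrow> real)
     \<Rightarrow> ('m \<Rightarrow> 'v \<Rightarrow> real) \<Rightarrow> ('m \<Rightarrow> 'v \<Rightarrow> real) \<Rightarrow> 'm \<Rightarrow> 'v \<Rightarrow> real" where
  "dual_mul_deformed A N H \<alpha> \<beta> = (\<lambda>p v.
     dual_mul A H (app (dual_map A N) \<alpha>) \<beta> p v
   + dual_mul A H \<alpha> (app (dual_map A N) \<beta>) p v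
   - app (dual_map A N) (dual_mul A H \<alpha> \<beta>) p v)"

definition KVN_structure ::
  "('m::topological_space, 'e::real_normed_vector, 'v::real_vector, 'f::real_normed_vector, 'z)
     lsa_scheme \<Rightarrow> ('m \<Rightarrow> ('v \<Rightarrow> real) \<Rightarrow> ('v \<Rightarrow> real) \<Rightarrow> real)
     \<Rightarrow> ('m \<Rightarrow> 'v \<Rightarrow> 'v) \<Rightarrow> bool" where
  "KVN_structure A H N \<longleftrightarrow> koszul_vinberg A H \<and> nijenhuis A N \<and>
     (\<forall>p. \<forall>\<alpha>\<in>dual_fibre A p. N p (sharp A H p \<alpha>) = sharp A H p (dual_map A N p \<alpha>)) \<and>
     (\<forall>\<alpha>\<in>dual_sections A. \<forall>\<beta>\<in>dual_sections A.
        star_mul A N H \<alpha> \<beta> = dual_mul_deformed A N H \<alpha> \<beta>)"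

text \<open>The bilinear form with sharp map \<open>N\<^sup>k \<circ> H\<^sup>\<sharp>\<close>.\<close>

definition H_pow ::
  "('m, 'e, 'v::real_vector, 'f, 'z) vbundle_scheme
     \<Rightarrow> ('m \<Rightarrow> ('v \<Rightarrow> real) \<Rightarrow> ('v \<Rightarrow> real) \<Rightarrow> real) \<Rightarrow> ('m \<Rightarrow> 'v \<Rightarrow> 'v) \<Rightarrow> nat
     \<Rightarrow> 'm \<Rightarrow> ('v \<Rightarrow> real) \<Rightarrow> ('v \<Rightarrow> real) \<Rightarrow> real" where
  "H_pow A H N k p \<alpha> \<beta> =
     (if \<alpha> \<in> dual_fibre A p \<and> \<beta> \<in> dual_fibre A p
      then \<beta> ((N p ^^ k) (sharp A H p \<alpha>)) else 0)"

end

theory Submission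
  imports Defs
begin

text \<open>
  Write \<open>\<pi> = H\<^sup>\<sharp>\<close> and, for sections \<open>b\<close> of \<open>A\<close>, put \<open>D\<^sub>l\<^sub>,\<^sub>b(x) = x \<cdot> N\<^sup>l b - N\<^sup>l (x \<cdot> b)\<close>.
  The Nijenhuis identity says that \<open>D\<^sub>1\<^sub>,\<^sub>b\<close> commutes with \<open>N\<close>. Pairing the compatibility of the two
  products on \<open>A\<^sup>*\<close> with sections \<open>\<pi> \<gamma>\<close> and using the Koszul-Vinberg equation twice gives that
  \<open>\<langle>\<gamma>, D\<^sub>1\<^sub>,\<^sub>b (\<pi> \<alpha>)\<rangle>\<close> is symmetric in \<open>\<alpha>\<close> and \<open>\<gamma>\<close> for \<open>b = \<pi> \<beta>\<close>. Because
  \<open>D\<^sub>l\<^sub>+\<^sub>1\<^sub>,\<^sub>b = D\<^sub>1\<^sub>,\<^sub>c + N D\<^sub>l\<^sub>,\<^sub>b\<close> with \<open>c = N\<^sup>l b\<close>, both properties pass to all \<open>l\<close>, and the bracket of \<open>N\<^sup>k \<circ> \<pi>\<close> and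
  \<open>N\<^sup>l \<circ> \<pi>\<close> differs from a combination of Koszul-Vinberg equations for \<open>H\<close> by the antisymmetric
  parts of \<open>\<langle>\<gamma>, D\<^sub>l\<^sub>,\<^sub>b (N\<^sup>k \<pi> \<alpha>)\<rangle>\<close> and \<open>\<langle>\<gamma>, D\<^sub>k\<^sub>,\<^sub>b (N\<^sup>l \<pi> \<alpha>)\<rangle>\<close>.

  The products on \<open>A\<^sup>*\<close> are sections defined by description, so extracting their pairings needs
  that a smooth \<open>C\<^sup>\<infinity>\<close>-linear functional on sections comes from a unique dual section; this rests on
  smooth bump functions.
\<close>

section \<open>Finite-dimensional normed spaces\<close>

text \<open>A point off a closed set has a ball around it that misses the set, and dividing by
  \<open>t\<close> reduces the general case to the distance from \<open>b\<close> to a point of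
  \<open>S\<close>. The estimate makes the coefficient of \<open>b\<close> depend continuously on
  the vector; completeness of finite spans and boundedness of coordinates both rest on it.\<close>

lemma norm_add_scaleR_ge_closed_subspace:
  fixes b :: "'a::real_normed_vector"
  assumes "closed S" "subspace S" "b \<notin> S"
  obtains d where "d > 0" "\<And>x t. x \<in> S \<Longrightarrow> \<bar>t\<bar> * d \<le> norm (x + t *\<^sub>R b)"
proof -
  obtain d where d: "d > 0" "ball b d \<subseteq> - S"
    using assms(1,3) openE[of "- S" b] by auto
  then have "d \<le> dist b y" if "y \<in> S" for y
    using that by (meson ComplD linorder_not_less mem_ball subsetD)
  note d = d(1) this
  have "\<bar>t\<bar> * d \<le> norm (x + t *\<^sub>R b)" if x: "x \<in> S" for x t
  proof (cases "t = 0")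
    case False
    have "- (inverse t *\<^sub>R x) \<in> S"
      using assms(2) x by (simp add: subspace_neg subspace_scale)
    then have "d \<le> norm (b + inverse t *\<^sub>R x)"
      using d(2) by (fastforce simp: dist_norm)
    then have "\<bar>t\<bar> * d \<le> norm (t *\<^sub>R (b + inverse t *\<^sub>R x))"
      by (simp add: mult_left_mono)
    then show ?thesis
      using False by (simp add: scaleR_add_right add.commute)
  qed auto
  with d(1) that show ?thesis by blast
qed

lemma Cauchy_diff:
  fixes f g :: "nat \<Rightarrow> 'a::real_normed_vector"
  assumes "Cauchy f" "Cauchy g"
  shows "Cauchy (\<lambda>n. f n - g n)"
proof (rule metric_CauchyI)
  fix e :: real assume "e > 0"
  then have e2: "e / 2 > 0" by simp
  obtain M where M: "\<And>m n. m \<ge> M \<Longrightarrow> n \<ge> M \<Longrightarrow> dist (f m) (f n) < e / 2"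
    using metric_CauchyD[OF assms(1) e2] by blast
  obtain M' where M': "\<And>m n. m \<ge> M' \<Longrightarrow> n \<ge> M' \<Longrightarrow> dist (g m) (g n) < e / 2"
    using metric_CauchyD[OF assms(2) e2] by blast
  have "dist (f m - g m) (f n - g n) < e" if "m \<ge> max M M'" "n \<ge> max M M'" for m n
    using dist_triangle_add[of "f m" "- g m" "f n" "- g n"] M[of m n] M'[of m n] that
    by (simp add: dist_minus)
  then show "\<exists>M. \<forall>m\<ge>M. \<forall>n\<ge>M. dist (f m - g m) (f n - g n) < e" by blast
qed

text \<open>When a new vector \<open>b\<close> is added, its coefficients \<open>k n\<close> along a
  Cauchy sequence are themselves Cauchy by the distance estimate. They converge in the reals, and
  the remainder is a Cauchy sequence in the smaller span.\<close>

lemma complete_span: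
  fixes B :: "'a::real_normed_vector set"
  assumes "finite B"
  shows "complete (span B)"
  using assms
proof induction
  case empty
  show ?case by (auto intro: compact_imp_complete)
next
  case (insert b B)
  show ?case
  proof (cases "b \<in> span B")
    case True
    then show ?thesis using insert by (simp add: span_redundant)
  next
    case False
    have cl: "closed (span B)" using insert.IH by (rule complete_imp_closed)
    obtain d where d: "d > 0" "\<And>x t. x \<in> span B \<Longrightarrow> \<bar>t\<bar> * d \<le> norm (x + t *\<^sub>R b)"
      using norm_add_scaleR_ge_closed_subspace[OF cl _ False] by auto
    show ?thesis
      unfolding complete_def
    proof (intro allI impI, elim conjE)
      fix f :: "nat \<Rightarrow> 'a"
      assume f: "\<forall>n. f n \<in> span (insert b B)" and "Cauchy f"
      then obtain k where k: "\<And>n. f n - k n *\<^sub>R b \<in> span B"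
        unfolding span_insert by simp metis
      have "Cauchy k"
      proof (rule metric_CauchyI)
        fix e :: real assume "e > 0"
        then have "e * d > 0" using d(1) by simp
        then obtain M where M: "\<And>m n. m \<ge> M \<Longrightarrow> n \<ge> M \<Longrightarrow> dist (f m) (f n) < e * d"
          using metric_CauchyD[OF \<open>Cauchy f\<close>] by metis
        have "dist (k m) (k n) < e" if "m \<ge> M" "n \<ge> M" for m n
        proof -
          have "(f m - k m *\<^sub>R b) - (f n - k n *\<^sub>R b) \<in> span B"
            by (rule span_diff[OF k k])
          from d(2)[OF this, of "k m - k n"]
          have "dist (k m) (k n) * d \<le> dist (f m) (f n)"
            by (simp add: dist_norm algebra_simps)
          also have "\<dots> < e * d" using M that by auto
          finally show ?thesis using d(1) by simp
        qed
        then show "\<exists>M. \<forall>m\<ge>M. \<forall>n\<ge>M. dist (k m) (k n) < e" by blast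
      qed
      then have "convergent k" by (rule real_Cauchy_convergent)
      then obtain k0 where k0: "k \<longlonglongrightarrow> k0" unfolding convergent_def ..
      then have "Cauchy (\<lambda>n. k n *\<^sub>R b)"
        by (intro LIMSEQ_imp_Cauchy[of _ "k0 *\<^sub>R b"] tendsto_intros)
      with \<open>Cauchy f\<close> have "Cauchy (\<lambda>n. f n - k n *\<^sub>R b)"
        by (rule Cauchy_diff)
      from completeE[OF insert.IH _ this] k
      obtain l where l: "l \<in> span B" "(\<lambda>n. f n - k n *\<^sub>R b) \<longlonglongrightarrow> l"
        by auto
      have "(\<lambda>n. (f n - k n *\<^sub>R b) + k n *\<^sub>R b) \<longlonglongrightarrow> l + k0 *\<^sub>R b"
        using l k0 by (intro tendsto_intros)
      moreover have "l + k0 *\<^sub>R b \<in> span (insert b B)"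
        using l(1) by (auto simp: span_insert intro!: exI[of _ k0])
      ultimately show "\<exists>l\<in>span (insert b B). f \<longlonglongrightarrow> l" by auto
    qed
  qed
qed

section \<open>Coordinates with respect to a fixed basis\<close>

definition fbasis :: "'a::real_vector set" where
  "fbasis = (SOME B. independent B \<and> span B = UNIV)"

definition coord :: "'a::real_vector \<Rightarrow> 'a \<Rightarrow> real" where
  "coord b x = representation fbasis x b"

text \<open>A basis exists in every real vector space, so the choice is meaningful without a bound
  on the dimension; finite-dimensionality enters only when sums over the basis are formed.\<close>

lemma fbasis: "independent (fbasis :: 'a::real_vector set)" "span (fbasis :: 'a set) = UNIV"
proof -
  obtain B :: "'a set" where "independent B" "UNIV \<subseteq> span B"
    using maximal_independent_subset[of "UNIV :: 'a set"] by metis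
  then have "\<exists>B :: 'a set. independent B \<and> span B = UNIV" by blast
  from someI_ex[OF this] show "independent (fbasis :: 'a set)" "span (fbasis :: 'a set) = UNIV"
    unfolding fbasis_def by auto
qed

lemma finite_fbasis:
  assumes "finite_dim TYPE('a::real_vector)"
  shows "finite (fbasis :: 'a set)"
proof -
  obtain B :: "'a set" where "finite B" "span B = UNIV"
    using assms unfolding finite_dim_def by auto
  then show ?thesis
    using independent_span_bound[of B fbasis] fbasis by auto
qed

lemma linear_coord: "linear (coord b)"
  unfolding coord_def using linear_representation[OF fbasis] by (simp add: linear_def real_scaleR_def[abs_def])

lemma sum_coord:
  assumes "finite_dim TYPE('a::real_vector)"
  shows "(\<Sum>b\<in>fbasis. coord b x *\<^sub>R b) = (x::'a)"
  unfolding coord_def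
  by (rule real_vector.sum_representation_eq) (use fbasis finite_fbasis[OF assms] in auto)

lemma linear_eq_sum_coord:
  assumes "finite_dim TYPE('a::real_vector)" "linear f"
  shows "f (x::'a) = (\<Sum>b\<in>fbasis. coord b x *\<^sub>R f b)"
proof -
  have "f x = f (\<Sum>b\<in>fbasis. coord b x *\<^sub>R b)" using sum_coord[OF assms(1)] by simp
  also have "\<dots> = (\<Sum>b\<in>fbasis. coord b x *\<^sub>R f b)"
    using assms(2) by (simp add: linear_sum linear_scale)
  finally show ?thesis .
qed

text \<open>The span of the other basis vectors is complete, hence closed, and does not contain
  \<open>b\<close>. The distance estimate then bounds the coordinate by the norm of \<open>x\<close>
  divided by \<open>d\<close>.\<close>

lemma bounded_linear_coord:
  fixes b :: "'a::real_normed_vector"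
  assumes "finite_dim TYPE('a)" "b \<in> fbasis"
  shows "bounded_linear (coord b)"
proof -
  note fin = finite_fbasis[OF assms(1)]
  have "complete (span (fbasis - {b}))" using fin by (intro complete_span) auto
  then have "closed (span (fbasis - {b}))" by (rule complete_imp_closed)
  moreover have "b \<notin> span (fbasis - {b})" using fbasis(1) assms(2) by (auto simp: dependent_def)
  ultimately obtain d where d: "d > 0"
    "\<And>x t. x \<in> span (fbasis - {b}) \<Longrightarrow> \<bar>t\<bar> * d \<le> norm (x + t *\<^sub>R b)"
    using norm_add_scaleR_ge_closed_subspace by (metis subspace_span)
  have "norm (coord b x) \<le> norm x * inverse d" for x
  proof -
    have "x = (\<Sum>c\<in>fbasis - {b}. coord c x *\<^sub>R c) + coord b x *\<^sub>R b"
      using sum.remove[OF fin assms(2), of "\<lambda>c. coord c x *\<^sub>R c"] sum_coord[OF assms(1), of x]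
      by (simp add: add.commute)
    moreover have "(\<Sum>c\<in>fbasis - {b}. coord c x *\<^sub>R c) \<in> span (fbasis - {b})"
      by (intro span_sum span_scale span_base)
    ultimately have "\<bar>coord b x\<bar> * d \<le> norm x" using d(2) by metis
    then show ?thesis using d(1) by (simp add: field_simps)
  qed
  with linear_coord[of b] show ?thesis
    by (intro bounded_linear_intro[of _ "inverse d"]) (auto simp: linear_add linear_scale)
qed

lemma bounded_linear_of_finite_dim:
  fixes f :: "'a::real_normed_vector \<Rightarrow> 'b::real_normed_vector"
  assumes "finite_dim TYPE('a)" "linear f"
  shows "bounded_linear f"
proof -
  have "bounded_linear (\<lambda>x. \<Sum>b\<in>fbasis. coord b x *\<^sub>R f b)"
    using bounded_linear_coord[OF assms(1)]
    by (intro bounded_linear_sum bounded_linear_scaleR_const) auto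
  moreover have "f = (\<lambda>x. \<Sum>b\<in>fbasis. coord b x *\<^sub>R f b)"
    using linear_eq_sum_coord[OF assms] by blast
  ultimately show ?thesis by simp
qed

text \<open>The box is a Minkowski sum of segments, one for each vector of \<open>B\<close>. Such
  boxes serve as compact supports of bump functions on the model space.\<close>

lemma compact_box_span:
  fixes B :: "'a::real_normed_vector set"
  assumes "finite B"
  shows "compact {x. \<exists>t. x = (\<Sum>b\<in>B. t b *\<^sub>R b) \<and> (\<forall>b\<in>B. \<bar>t b\<bar> \<le> r)}"
  using assms
proof induction
  case empty
  have "{x. \<exists>t::'a \<Rightarrow> real. x = (\<Sum>b\<in>{}. t b *\<^sub>R b) \<and> (\<forall>b\<in>{}. \<bar>t b\<bar> \<le> r)} = {0}" by auto
  then show ?case by (metis compact_sing)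
next
  case (insert c B)
  let ?K = "\<lambda>B. {x. \<exists>t. x = (\<Sum>b\<in>B. t b *\<^sub>R b) \<and> (\<forall>b\<in>B. \<bar>t b\<bar> \<le> r)}"
  have "compact ((\<lambda>s. s *\<^sub>R c) ` {-r..r})"
    by (intro compact_continuous_image continuous_intros compact_Icc)
  then have "compact {x + y |x y. x \<in> (\<lambda>s. s *\<^sub>R c) ` {-r..r} \<and> y \<in> ?K B}"
    using insert.IH by (rule compact_sums)
  also have "{x + y |x y. x \<in> (\<lambda>s. s *\<^sub>R c) ` {-r..r} \<and> y \<in> ?K B} = ?K (insert c B)"
    (is "?L = _")
  proof (intro set_eqI iffI)
    fix z assume "z \<in> ?L"
    then obtain s t where st: "z = s *\<^sub>R c + (\<Sum>b\<in>B. t b *\<^sub>R b)" "\<bar>s\<bar> \<le> r" "\<forall>b\<in>B. \<bar>t b\<bar> \<le> r"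
      by (auto simp: abs_le_iff)
    have "(\<Sum>b\<in>B. t b *\<^sub>R b) = (\<Sum>b\<in>B. (t(c := s)) b *\<^sub>R b)"
      using insert.hyps by (intro sum.cong) auto
    then show "z \<in> ?K (insert c B)"
      using insert.hyps st by (auto intro!: exI[of _ "t(c := s)"])
  next
    fix z assume "z \<in> ?K (insert c B)"
    then obtain t where t: "z = t c *\<^sub>R c + (\<Sum>b\<in>B. t b *\<^sub>R b)" "\<forall>b\<in>insert c B. \<bar>t b\<bar> \<le> r"
      using insert.hyps by auto
    then have "t c *\<^sub>R c \<in> (\<lambda>s. s *\<^sub>R c) ` {-r..r}" by (auto simp: abs_le_iff)
    moreover have "(\<Sum>b\<in>B. t b *\<^sub>R b) \<in> ?K B" using t(2) by blast
    ultimately show "z \<in> ?L" using t(1) by blast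
  qed
  finally show ?case .
qed


section \<open>Calculus of smooth maps\<close>

lemma Ck_on_cong:
  assumes "open S" "\<And>x. x \<in> S \<Longrightarrow> f x = g x" "Ck_on k S f"
  shows "Ck_on k S g"
  using assms(2,3)
proof (induction k arbitrary: f g)
  case 0
  then show ?case using continuous_on_cong[of S S f g] by simp
next
  case (Suc k)
  have f: "(f has_derivative frechet_derivative f (at x)) (at x)" if "x \<in> S" for x
    using Suc.prems(2) that by (simp add: frechet_derivative_works[symmetric])
  have d: "(g has_derivative frechet_derivative f (at x)) (at x)" if "x \<in> S" for x
    by (rule has_derivative_transform_within_open[OF f[OF that] assms(1) that Suc.prems(1)])
  then have e: "frechet_derivative f (at x) = frechet_derivative g (at x)" if "x \<in> S" for x
    using that by (intro frechet_derivative_at)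
  have "Ck_on k S (\<lambda>x. frechet_derivative g (at x) v)" for v
    by (rule Suc.IH[of "\<lambda>x. frechet_derivative f (at x) v"]) (use Suc.prems(2) e in auto)
  then show ?case using d by (auto simp: differentiable_def)
qed

text \<open>\<open>Ck_on\<close> speaks about the chosen derivative
  \<open>frechet_derivative\<close>; as derivatives at a point are unique, any explicit formula for
  the derivative may be used instead.\<close>

lemma Ck_on_SucI:
  assumes "open S" and d: "\<And>x. x \<in> S \<Longrightarrow> (f has_derivative f' x) (at x)"
    and f': "\<And>v. Ck_on k S (\<lambda>x. f' x v)"
  shows "Ck_on (Suc k) S f"
proof -
  have e: "f' x = frechet_derivative f (at x)" if "x \<in> S" for x
    using d[OF that] by (rule frechet_derivative_at)
  have "Ck_on k S (\<lambda>x. frechet_derivative f (at x) v)" for v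
    by (rule Ck_on_cong[OF assms(1) _ f']) (simp add: e)
  then show ?thesis using d by (auto simp: differentiable_def)
qed

lemma Ck_on_SucD:
  assumes "Ck_on (Suc k) S f"
  shows "\<And>x. x \<in> S \<Longrightarrow> (f has_derivative frechet_derivative f (at x)) (at x)"
    and "Ck_on k S (\<lambda>x. frechet_derivative f (at x) v)"
  using assms by (auto simp: frechet_derivative_works[symmetric])

lemma Ck_on_Suc_imp: "Ck_on (Suc k) S f \<Longrightarrow> Ck_on k S f"
proof (induction k arbitrary: f)
  case 0
  then show ?case
    by (auto intro!: continuous_at_imp_continuous_on differentiable_imp_continuous_within)
next
  case (Suc k)
  then show ?case by (metis Ck_on.simps(2))
qed

lemma Ck_on_subset: "Ck_on k S f \<Longrightarrow> T \<subseteq> S \<Longrightarrow> Ck_on k T f"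
  by (induction k arbitrary: f) (auto intro: continuous_on_subset)

lemma Ck_on_local:
  assumes "\<And>x. x \<in> S \<Longrightarrow> \<exists>T. open T \<and> x \<in> T \<and> Ck_on k T f"
  shows "Ck_on k S f"
  using assms
proof (induction k arbitrary: f)
  case 0
  then have "isCont f x" if "x \<in> S" for x
    using that by (metis Ck_on.simps(1) continuous_on_eq_continuous_at)
  then show ?case by (simp add: continuous_at_imp_continuous_on)
next
  case (Suc k)
  show ?case
    unfolding Ck_on.simps
  proof (intro conjI ballI allI)
    show "f differentiable at x" if "x \<in> S" for x
      using Suc.prems[OF that] by auto
    show "Ck_on k S (\<lambda>x. frechet_derivative f (at x) v)" for v
      by (rule Suc.IH) (metis Suc.prems Ck_on_SucD(2))
  qed
qed

section \<open>Closure of \<open>Ck_on\<close> under algebraic operations and composition\<close>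

lemma Ck_on_const: "Ck_on k S (\<lambda>x. c)"
  by (induction k arbitrary: c) auto

lemma Ck_on_add:
  assumes "open S" "Ck_on k S f" "Ck_on k S g"
  shows "Ck_on k S (\<lambda>x. f x + g x)"
  using assms(2,3)
proof (induction k arbitrary: f g)
  case 0
  then show ?case by (auto intro: continuous_intros)
next
  case (Suc k)
  note D = Ck_on_SucD[OF Suc.prems(1)] Ck_on_SucD[OF Suc.prems(2)]
  show ?case
    by (rule Ck_on_SucI[OF assms(1) has_derivative_add[OF D(1,3)]])
      (use Suc.IH D in auto)
qed

lemma Ck_on_bounded_linear:
  assumes "open S" "bounded_linear L" "Ck_on k S f"
  shows "Ck_on k S (\<lambda>x. L (f x))"
  using assms(3)
proof (induction k arbitrary: f)
  case 0
  then show ?case using assms by (auto intro: bounded_linear.continuous_on)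
next
  case (Suc k)
  note D = Ck_on_SucD[OF Suc.prems(1)]
  show ?case
    by (rule Ck_on_SucI[OF assms(1) bounded_linear.has_derivative[OF assms(2) D(1)]])
      (use Suc.IH D in auto)
qed

lemma Ck_on_scaleR:
  assumes "open S" "Ck_on k S f" "Ck_on k S g"
  shows "Ck_on k S (\<lambda>x. f x *\<^sub>R g x)"
  using assms(2,3)
proof (induction k arbitrary: f g)
  case 0
  then show ?case by (auto intro: continuous_intros)
next
  case (Suc k)
  note D = Ck_on_SucD[OF Suc.prems(1)] Ck_on_SucD[OF Suc.prems(2)]
  show ?case
  proof (rule Ck_on_SucI[OF assms(1) has_derivative_scaleR[OF D(1,3)]])
    show "Ck_on k S (\<lambda>x. f x *\<^sub>R frechet_derivative g (at x) v + frechet_derivative f (at x) v *\<^sub>R g x)" for v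
      by (rule Ck_on_add[OF assms(1) Suc.IH[OF Ck_on_Suc_imp[OF Suc.prems(1)] D(4)]
            Suc.IH[OF D(2) Ck_on_Suc_imp[OF Suc.prems(2)]]])
  qed
qed

lemma Ck_on_sum:
  assumes "open S" "\<And>i. i \<in> I \<Longrightarrow> Ck_on k S (f i)"
  shows "Ck_on k S (\<lambda>x. \<Sum>i\<in>I. f i x)"
  using assms(2)
  by (induction I rule: infinite_finite_induct) (auto intro: Ck_on_add Ck_on_const assms(1))

lemma Ck_on_coord_sum:
  fixes f :: "'a::real_normed_vector \<Rightarrow> 'b::real_normed_vector"
  assumes "finite_dim TYPE('b)" "open S" "Ck_on k S f" "\<And>b. b \<in> fbasis \<Longrightarrow> Ck_on k S (g b)"
  shows "Ck_on k S (\<lambda>x. \<Sum>b\<in>fbasis. coord b (f x) *\<^sub>R g b x)"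
proof (rule Ck_on_sum[OF assms(2)])
  fix b :: 'b assume b: "b \<in> fbasis"
  have "Ck_on k S (\<lambda>x. coord b (f x))"
    by (rule Ck_on_bounded_linear[OF assms(2) bounded_linear_coord[OF assms(1) b] assms(3)])
  then show "Ck_on k S (\<lambda>x. coord b (f x) *\<^sub>R g b x)"
    by (rule Ck_on_scaleR[OF assms(2) _ assms(4)[OF b]])
qed

lemma Ck_on_ident: "open S \<Longrightarrow> Ck_on k S (\<lambda>x. x)"
  by (cases k) (auto intro!: Ck_on_SucI[where f' = "\<lambda>_ v. v"] Ck_on_const simp del: Ck_on.simps(2))

lemma Ck_on_inverse:
  fixes f :: "'a::real_normed_vector \<Rightarrow> real"
  assumes "open S" "Ck_on k S f" "\<And>x. x \<in> S \<Longrightarrow> f x \<noteq> 0"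
  shows "Ck_on k S (\<lambda>x. inverse (f x))"
  using assms(2,3)
proof (induction k)
  case 0
  then show ?case by (auto intro: continuous_intros)
next
  case (Suc k)
  note D = Ck_on_SucD[OF Suc.prems(1)]
  have i: "Ck_on k S (\<lambda>x. inverse (f x))" using Suc Ck_on_Suc_imp by blast
  have "Ck_on k S (\<lambda>x. (- 1) *\<^sub>R (inverse (f x) *\<^sub>R (frechet_derivative f (at x) v *\<^sub>R inverse (f x))))" for v
    by (intro Ck_on_scaleR Ck_on_const assms(1) i D)
  moreover have "((\<lambda>x. inverse (f x)) has_derivative
      (\<lambda>v. - (inverse (f x) * frechet_derivative f (at x) v * inverse (f x)))) (at x)" if "x \<in> S" for x
    using Suc.prems(2) that by (intro Deriv.has_derivative_inverse D(1)) auto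
  ultimately show ?case
    by (intro Ck_on_SucI[OF assms(1)]) (auto simp: mult.assoc)
qed

text \<open>In the chain rule the direction in which \<open>g\<close> is differentiated varies with
  the point, whereas \<open>Ck_on\<close> controls derivatives in fixed directions only. Expanding
  the direction in the basis of the middle space turns the derivative into a finite sum of products
  to which the induction hypothesis applies.\<close>

lemma Ck_on_compose:
  fixes f :: "'a::real_normed_vector \<Rightarrow> 'b::real_normed_vector" and g :: "'b \<Rightarrow> 'c::real_normed_vector"
  assumes fd: "finite_dim TYPE('b)" and o: "open S" "open T" and "Ck_on k S f" "Ck_on k T g" "f ` S \<subseteq> T"
  shows "Ck_on k S (\<lambda>x. g (f x))"
  using assms(4-)
proof (induction k arbitrary: f g)
  case 0
  then show ?case by (auto intro: continuous_on_compose2)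
next
  case (Suc k)
  note D = Ck_on_SucD[OF Suc.prems(1)] Ck_on_SucD[OF Suc.prems(2)]
  have im: "f x \<in> T" if "x \<in> S" for x using Suc.prems(3) that by auto
  have d: "((\<lambda>x. g (f x)) has_derivative (\<lambda>v. \<Sum>b\<in>fbasis. coord b (frechet_derivative f (at x) v) *\<^sub>R
       frechet_derivative g (at (f x)) b)) (at x)" if "x \<in> S" for x
  proof -
    have lin: "linear (frechet_derivative g (at (f x)))"
      using D(3)[OF im[OF that]] has_derivative_linear by blast
    have "((\<lambda>x. g (f x)) has_derivative (\<lambda>v. frechet_derivative g (at (f x)) (frechet_derivative f (at x) v))) (at x)"
      using that im by (intro has_derivative_compose[of f _ x UNIV g] D) auto
    then show ?thesis by (simp add: linear_eq_sum_coord[OF fd lin, of "frechet_derivative f (at x) _"])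
  qed
  have "Ck_on k S (\<lambda>x. \<Sum>b\<in>fbasis. coord b (frechet_derivative f (at x) v) *\<^sub>R
       frechet_derivative g (at (f x)) b)" for v
    using Suc.prems Ck_on_Suc_imp D(2,4)
    by (intro Ck_on_coord_sum[OF fd o(1)] Suc.IH) blast+
  with d show ?case by (intro Ck_on_SucI[OF o(1)])
qed

section \<open>The same closure properties for smooth maps\<close>

lemma smooth_on_cong:
  "\<lbrakk>smooth_on S f; open S; \<And>x. x \<in> S \<Longrightarrow> f x = g x\<rbrakk> \<Longrightarrow> smooth_on S g"
  unfolding smooth_on_def using Ck_on_cong by blast

lemma smooth_on_subset: "smooth_on S f \<Longrightarrow> T \<subseteq> S \<Longrightarrow> smooth_on T f"
  unfolding smooth_on_def using Ck_on_subset by blast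

lemma smooth_on_local:
  "(\<And>x. x \<in> S \<Longrightarrow> \<exists>T. open T \<and> x \<in> T \<and> smooth_on T f) \<Longrightarrow> smooth_on S f"
  unfolding smooth_on_def using Ck_on_local by meson

lemma smooth_on_const: "smooth_on S (\<lambda>x. c)"
  unfolding smooth_on_def using Ck_on_const by blast

lemma smooth_on_ident: "open S \<Longrightarrow> smooth_on S (\<lambda>x. x)"
  unfolding smooth_on_def using Ck_on_ident by blast

lemma smooth_on_add:
  "\<lbrakk>open S; smooth_on S f; smooth_on S g\<rbrakk> \<Longrightarrow> smooth_on S (\<lambda>x. f x + g x)"
  unfolding smooth_on_def using Ck_on_add by blast

lemma smooth_on_scaleR:
  "\<lbrakk>open S; smooth_on S f; smooth_on S g\<rbrakk> \<Longrightarrow> smooth_on S (\<lambda>x. f x *\<^sub>R g x)"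
  unfolding smooth_on_def using Ck_on_scaleR by blast

lemma smooth_on_sum:
  "\<lbrakk>open S; \<And>i. i \<in> I \<Longrightarrow> smooth_on S (f i)\<rbrakk> \<Longrightarrow> smooth_on S (\<lambda>x. \<Sum>i\<in>I. f i x)"
  unfolding smooth_on_def by (intro allI Ck_on_sum) auto

lemma smooth_on_coord_sum:
  fixes f :: "'a::real_normed_vector \<Rightarrow> 'b::real_normed_vector"
  shows "\<lbrakk>finite_dim TYPE('b); open S; smooth_on S f; \<And>b. b \<in> fbasis \<Longrightarrow> smooth_on S (g b)\<rbrakk>
    \<Longrightarrow> smooth_on S (\<lambda>x. \<Sum>b\<in>fbasis. coord b (f x) *\<^sub>R g b x)"
  unfolding smooth_on_def by (intro allI Ck_on_coord_sum) auto

lemma smooth_on_bounded_linear: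
  "\<lbrakk>open S; bounded_linear L; smooth_on S f\<rbrakk> \<Longrightarrow> smooth_on S (\<lambda>x. L (f x))"
  unfolding smooth_on_def using Ck_on_bounded_linear by blast

lemma smooth_on_inverse:
  fixes f :: "'a::real_normed_vector \<Rightarrow> real"
  shows "\<lbrakk>open S; smooth_on S f; \<And>x. x \<in> S \<Longrightarrow> f x \<noteq> 0\<rbrakk> \<Longrightarrow> smooth_on S (\<lambda>x. inverse (f x))"
  unfolding smooth_on_def using Ck_on_inverse by blast

lemma smooth_on_compose:
  fixes f :: "'a::real_normed_vector \<Rightarrow> 'b::real_normed_vector"
  shows "\<lbrakk>finite_dim TYPE('b); open S; open T; smooth_on S f; smooth_on T g; f ` S \<subseteq> T\<rbrakk>
    \<Longrightarrow> smooth_on S (\<lambda>x. g (f x))"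
  unfolding smooth_on_def using Ck_on_compose by blast

lemma smooth_on_imp_has_derivative:
  "smooth_on S f \<Longrightarrow> x \<in> S \<Longrightarrow> (f has_derivative frechet_derivative f (at x)) (at x)"
  unfolding smooth_on_def using Ck_on_SucD(1) by blast

lemma smooth_on_imp_continuous_on: "smooth_on S f \<Longrightarrow> continuous_on S f"
  unfolding smooth_on_def using Ck_on.simps(1) by metis

text \<open>The direction \<open>t x\<close> moves with the point, so it is expanded in the basis as
  in the chain rule. This is what makes the derivative of a function along a smooth section
  smooth.\<close>

lemma smooth_on_frechet_derivative_apply:
  fixes f :: "'a::real_normed_vector \<Rightarrow> 'b::real_normed_vector"
  assumes fd: "finite_dim TYPE('a)" and o: "open S" and f: "smooth_on S f" and t: "smooth_on S t"
  shows "smooth_on S (\<lambda>x. frechet_derivative f (at x) (t x))"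
proof -
  have D: "smooth_on S (\<lambda>x. frechet_derivative f (at x) b)" for b
    using f unfolding smooth_on_def by (metis Ck_on_SucD(2))
  have "smooth_on S (\<lambda>x. \<Sum>b\<in>fbasis. coord b (t x) *\<^sub>R frechet_derivative f (at x) b)"
    by (intro smooth_on_coord_sum[OF fd o t] D)
  moreover have "linear (frechet_derivative f (at x))" if "x \<in> S" for x
    using smooth_on_imp_has_derivative[OF f that] has_derivative_linear by blast
  ultimately show ?thesis
    by (elim smooth_on_cong[OF _ o]) (simp add: linear_eq_sum_coord[OF fd, symmetric])
qed

section \<open>Smooth bump functions on the model space\<close>

definition flat :: "nat \<Rightarrow> real \<Rightarrow> real" where
  "flat n t = (if t > 0 then exp (- inverse t) * inverse t ^ n else 0)"

text \<open>The powers of the inverse make the family closed under differentiation, so that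
  smoothness follows by one induction over all \<open>n\<close> simultaneously. Away from 0 this is
  ordinary calculus; at 0 both one-sided difference quotients tend to 0.\<close>

lemma flat_has_derivative:
  "((flat n) has_derivative (\<lambda>v. v * (flat (n + 2) t - n * flat (n + 1) t))) (at t)"
proof -
  consider "t > 0" | "t < 0" | "t = 0" by linarith
  then show ?thesis
  proof cases
    case 1
    have i: "(inverse has_field_derivative - (inverse t * inverse t)) (at t)"
      using 1 DERIV_inverse[of t UNIV] by (simp add: power2_eq_square)
    have p: "((\<lambda>t. inverse t ^ n) has_field_derivative - (real n * inverse t ^ (n + 1))) (at t)"
      using DERIV_power[OF i, of n] by (cases n) (auto simp: mult.assoc)
    have e: "((\<lambda>t. exp (- inverse t)) has_field_derivative exp (- inverse t) * (inverse t * inverse t)) (at t)"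
      using DERIV_fun_exp[OF DERIV_minus[OF i]] by simp
    have "((\<lambda>t. exp (- inverse t) * inverse t ^ n) has_field_derivative
        (flat (n + 2) t - n * flat (n + 1) t)) (at t)"
      using DERIV_mult[OF e p] 1 by (simp add: flat_def algebra_simps)
    then have "((\<lambda>t. exp (- inverse t) * inverse t ^ n) has_derivative
        (\<lambda>v. v * (flat (n + 2) t - n * flat (n + 1) t))) (at t)"
      by (simp add: has_field_derivative_def mult.commute[of _ "_ - _"])
    then show ?thesis
      by (rule has_derivative_transform_within_open[of _ _ _ _ "{0<..}"]) (use 1 in \<open>auto simp: flat_def\<close>)
  next
    case 2
    have "((\<lambda>_. 0) has_derivative (\<lambda>v. v * (flat (n + 2) t - n * flat (n + 1) t))) (at t)"
      using 2 by (auto simp: flat_def)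
    then show ?thesis
      by (rule has_derivative_transform_within_open[of _ _ _ _ "{..<0}"]) (use 2 in \<open>auto simp: flat_def\<close>)
  next
    case 3
    have "(flat n has_field_derivative 0) (at 0)"
      unfolding has_field_derivative_iff
    proof (rule filterlim_split_at)
      have "((\<lambda>y. exp (- inverse y) * inverse y ^ n / y) \<longlongrightarrow> 0) (at_right (0::real))"
      proof -
        \<comment> \<open>With \<open>x\<close> the inverse of \<open>y\<close>, the right-hand
          difference quotient becomes a power of \<open>x\<close> against a decaying exponential at
          infinity.\<close>
        have "((\<lambda>x::real. exp (- x) * x ^ n * x) \<longlongrightarrow> 0) at_top"
          using tendsto_power_div_exp_0[of "Suc n"]
          by (simp add: exp_minus field_simps)
        from filterlim_compose[OF this filterlim_inverse_at_top_right]
        show ?thesis by (simp add: field_simps)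
      qed
      then show "((\<lambda>y. (flat n y - flat n 0) / (y - 0)) \<longlongrightarrow> 0) (at_right 0)"
        by (rule Lim_transform_eventually) (auto simp: flat_def eventually_at_right_less intro!: eventually_at_rightI[of 0 1])
      show "((\<lambda>y. (flat n y - flat n 0) / (y - 0)) \<longlongrightarrow> 0) (at_left 0)"
        by (rule Lim_transform_eventually[OF tendsto_const]) (auto simp: flat_def intro!: eventually_at_leftI[of "-1" 0])
    qed
    then have "(flat n has_derivative (\<lambda>v. 0)) (at 0)"
      unfolding has_field_derivative_def by (rule has_derivative_eq_rhs) auto
    then show ?thesis using 3 by (simp add: flat_def)
  qed
qed

lemma smooth_on_flat: "smooth_on UNIV (flat n)"
proof -
  have "Ck_on k UNIV (flat n)" for k n
  proof (induction k arbitrary: n)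
    case 0
    show ?case
      using flat_has_derivative by (auto intro!: continuous_at_imp_continuous_on has_derivative_continuous)
  next
    case (Suc k)
    have "Ck_on k UNIV (\<lambda>t. v *\<^sub>R (flat (n + 2) t + (- real n) *\<^sub>R flat (n + 1) t))" for v
      by (intro Ck_on_scaleR Ck_on_add Ck_on_const Suc) auto
    then show ?case
      by (intro Ck_on_SucI[OF _ flat_has_derivative]) (simp_all add: algebra_simps)
  qed
  then show ?thesis by (simp add: smooth_on_def)
qed

lemma finite_dim_real: "finite_dim TYPE(real)"
  unfolding finite_dim_def
proof (intro exI[of _ "{1::real}"] conjI set_eqI iffI)
  fix x :: real
  have "x *\<^sub>R 1 \<in> span {1::real}" by (intro span_scale span_base) auto
  then show "x \<in> span {1::real}" by simp
qed auto

text \<open>The norm of the model space need not be smooth, so the sum of squared coordinates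
  replaces the squared distance. Composing \<open>flat 0\<close> with \<open>e\<^sup>2\<close> minus
  this sum gives a function that is positive at \<open>x0\<close> and vanishes off a compact
  coordinate box; dividing by the value at \<open>x0\<close> normalises it.\<close>

lemma smooth_bump:
  fixes x0 :: "'a::real_normed_vector"
  assumes fd: "finite_dim TYPE('a)" and "open S" "x0 \<in> S"
  obtains h :: "'a \<Rightarrow> real" and K where "smooth_on UNIV h" "h x0 = 1" "compact K" "K \<subseteq> S"
    "\<And>x. x \<notin> K \<Longrightarrow> h x = 0"
proof -
  obtain r where r: "r > 0" "ball x0 r \<subseteq> S" using assms openE by blast
  define M where "M = (\<Sum>b\<in>(fbasis::'a set). norm b)"
  have "M \<ge> 0" unfolding M_def by (simp add: sum_nonneg)
  \<comment> \<open>A vector whose coordinates are bounded by \<open>e\<close> has norm at most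
    \<open>e * M\<close>, so the box stays inside the ball of radius \<open>r\<close>. The summand 1
    keeps the denominator positive in dimension 0.\<close>
  define e where "e = r / (M + 1)"
  have e: "e > 0" using r \<open>M \<ge> 0\<close> by (simp add: e_def)
  have eM: "e * M < r" using r \<open>M \<ge> 0\<close> by (simp add: e_def field_simps)
  define box where "box = {x. \<exists>t. x = (\<Sum>b\<in>(fbasis::'a set). t b *\<^sub>R b) \<and> (\<forall>b\<in>fbasis. \<bar>t b\<bar> \<le> e)}"
  define K where "K = (+) x0 ` box"
  define s where "s = (\<lambda>x::'a. e\<^sup>2 + (- 1) *\<^sub>R (\<Sum>b\<in>fbasis. coord b (x + (- x0)) *\<^sub>R coord b (x + (- x0))))"
  have "compact box" unfolding box_def by (intro compact_box_span finite_fbasis fd)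
  then have "compact K" unfolding K_def by (rule compact_translation)
  moreover have "K \<subseteq> S"
  proof -
    have "norm x < r" if "x \<in> box" for x
    proof -
      have "\<exists>t. x = (\<Sum>b\<in>(fbasis::'a set). t b *\<^sub>R b) \<and> (\<forall>b\<in>(fbasis::'a set). \<bar>t b\<bar> \<le> e)"
        using that unfolding box_def by (rule CollectD)
      then obtain t :: "'a \<Rightarrow> real" where t: "x = (\<Sum>b\<in>(fbasis::'a set). t b *\<^sub>R b)" "\<forall>b\<in>(fbasis::'a set). \<bar>t b\<bar> \<le> e"
        by (elim exE conjE)
      have "norm x \<le> (\<Sum>b\<in>(fbasis::'a set). norm (t b *\<^sub>R b))" unfolding t(1) by (rule norm_sum)
      also have "\<dots> \<le> (\<Sum>b\<in>(fbasis::'a set). e * norm b)"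
        using t(2) by (intro sum_mono) (auto intro: mult_right_mono)
      also have "\<dots> = e * M" by (simp add: M_def sum_distrib_left)
      finally show ?thesis using eM by simp
    qed
    then show ?thesis using r(2) by (auto simp: K_def dist_norm)
  qed
  moreover have s: "smooth_on UNIV s"
    unfolding s_def
    by (intro smooth_on_add smooth_on_scaleR smooth_on_const smooth_on_sum smooth_on_ident
        smooth_on_bounded_linear[OF _ bounded_linear_coord] fd open_UNIV) auto
  have fs: "smooth_on UNIV (\<lambda>x. flat 0 (s x))"
    by (rule smooth_on_compose[OF finite_dim_real _ _ s smooth_on_flat]) auto
  have "s x0 = e\<^sup>2" by (simp add: s_def linear_0[OF linear_coord])
  then have pos: "flat 0 (s x0) > 0" using e by (simp add: flat_def)
  have "smooth_on UNIV (\<lambda>x. inverse (flat 0 (s x0)) *\<^sub>R flat 0 (s x))"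
    by (intro smooth_on_scaleR smooth_on_const fs) auto
  moreover have "inverse (flat 0 (s x0)) *\<^sub>R flat 0 (s x0) = 1" using pos by simp
  moreover have "inverse (flat 0 (s x0)) *\<^sub>R flat 0 (s x) = 0" if "x \<notin> K" for x
  proof (rule ccontr)
    assume "\<not> ?thesis"
    then have sx: "s x > 0" by (auto simp: flat_def split: if_splits)
    have "\<bar>coord b (x - x0)\<bar> \<le> e" if "b \<in> fbasis" for b
    proof -
      have "(coord b (x - x0))\<^sup>2 \<le> (\<Sum>b\<in>fbasis. (coord b (x - x0))\<^sup>2)"
        using that finite_fbasis[OF fd] by (intro member_le_sum) auto
      also have "\<dots> < e\<^sup>2" using sx by (simp add: s_def power2_eq_square)
      finally show ?thesis using e abs_le_square_iff[of "coord b (x - x0)" e] by simp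
    qed
    then have "x - x0 \<in> box"
      unfolding box_def using sum_coord[OF fd, of "x - x0"] by (intro CollectI exI[of _ "\<lambda>b. coord b (x - x0)"]) auto
    then show False using \<open>x \<notin> K\<close> by (force simp: K_def)
  qed
  ultimately show ?thesis using that by blast
qed


section \<open>Smooth functions on a manifold\<close>

lemma smooth_map_onI:
  "(\<And>U c. (U, c) \<in> \<A> \<Longrightarrow> smooth_on (c ` (U \<inter> W)) (f \<circ> inv_into U c)) \<Longrightarrow> smooth_map_on \<A> W f"
  by (auto simp: smooth_map_on_def)

lemma smooth_map_onD:
  "smooth_map_on \<A> W f \<Longrightarrow> (U, c) \<in> \<A> \<Longrightarrow> smooth_on (c ` (U \<inter> W)) (f \<circ> inv_into U c)"
  by (auto simp: smooth_map_on_def)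

lemma smooth_map_on_subset:
  assumes "smooth_map_on \<A> W f" "V \<subseteq> W"
  shows "smooth_map_on \<A> V f"
  by (rule smooth_map_onI, rule smooth_on_subset, erule smooth_map_onD[OF assms(1)])
    (use assms(2) in auto)

lemma smooth_map_on_const: "smooth_map_on \<A> W (\<lambda>p. k)"
  by (auto simp: smooth_map_on_def o_def intro: smooth_on_const)

locale manifold =
  fixes \<A> :: "('m::{t2_space,second_countable_topology}, 'e::real_normed_vector) chart set"
  assumes smooth_manifold: "smooth_manifold \<A>"
begin

lemma finite_dim_model: "finite_dim TYPE('e)"
  using smooth_manifold by (simp add: smooth_manifold_def)

lemma chart_exists: obtains U c where "(U, c) \<in> \<A>" "p \<in> U"
proof -
  have "p \<in> (\<Union>\<kappa>\<in>\<A>. fst \<kappa>)" using smooth_manifold by (simp add: smooth_manifold_def)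
  then show ?thesis using that by force
qed

lemma
  assumes "(U, c) \<in> \<A>"
  shows chart_open: "open U"
    and chart_open_image: "open (c ` U)"
    and chart_inverse: "p \<in> U \<Longrightarrow> inv_into U c (c p) = p"
    and chart_continuous: "continuous_on U c"
    and chart_continuous_inverse: "continuous_on (c ` U) (inv_into U c)"
proof -
  have "is_chart (U, c)" using assms smooth_manifold by (auto simp: smooth_manifold_def)
  then show "open U" "open (c ` U)" "p \<in> U \<Longrightarrow> inv_into U c (c p) = p"
    "continuous_on U c" "continuous_on (c ` U) (inv_into U c)"
    by (auto simp: is_chart_def homeomorphism_def)
qed

lemma transition_smooth:
  "(U, c) \<in> \<A> \<Longrightarrow> (V, d) \<in> \<A> \<Longrightarrow> smooth_on (c ` (U \<inter> V)) (d \<circ> inv_into U c)"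
  using smooth_manifold by (fastforce simp: smooth_manifold_def)

lemma chart_open_image_Int:
  assumes "(U, c) \<in> \<A>" "open W"
  shows "open (c ` (U \<inter> W))"
proof -
  have "c ` (U \<inter> W) = c ` U \<inter> inv_into U c -` W"
    using chart_inverse[OF assms(1)] by auto
  then show ?thesis
    using continuous_open_preimage[OF chart_continuous_inverse chart_open_image] assms by simp
qed

lemma smooth_map_on_cong:
  assumes "smooth_map_on \<A> W f" "open W" "\<And>p. p \<in> W \<Longrightarrow> f p = g p"
  shows "smooth_map_on \<A> W g"
proof (rule smooth_map_onI)
  fix U c assume c: "(U, c) \<in> \<A>"
  show "smooth_on (c ` (U \<inter> W)) (g \<circ> inv_into U c)"
    by (rule smooth_on_cong[OF smooth_map_onD[OF assms(1) c] chart_open_image_Int[OF c assms(2)]])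
      (use assms(3) chart_inverse[OF c] in auto)
qed

lemma smooth_map_on_local:
  assumes "\<And>p. p \<in> W \<Longrightarrow> \<exists>V. open V \<and> p \<in> V \<and> smooth_map_on \<A> V f"
  shows "smooth_map_on \<A> W f"
proof (rule smooth_map_onI, rule smooth_on_local)
  fix U c x assume c: "(U, c) \<in> \<A>" and "x \<in> c ` (U \<inter> W)"
  then obtain p where p: "x = c p" "p \<in> U" "p \<in> W" by auto
  then obtain V where "open V" "p \<in> V" "smooth_map_on \<A> V f" using assms by blast
  then show "\<exists>T. open T \<and> x \<in> T \<and> smooth_on T (f \<circ> inv_into U c)"
    using chart_open_image_Int[OF c] smooth_map_onD[OF _ c] p by blast
qed

lemma smooth_map_on_add:
  assumes "open W" "smooth_map_on \<A> W f" "smooth_map_on \<A> W g"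
  shows "smooth_map_on \<A> W (\<lambda>p. f p + g p)"
proof (rule smooth_map_onI)
  fix U c assume c: "(U, c) \<in> \<A>"
  show "smooth_on (c ` (U \<inter> W)) ((\<lambda>p. f p + g p) \<circ> inv_into U c)"
    using smooth_on_add[OF chart_open_image_Int[OF c assms(1)] smooth_map_onD[OF assms(2) c] smooth_map_onD[OF assms(3) c]]
    by (simp add: o_def)
qed

lemma smooth_map_on_scaleR:
  assumes "open W" "smooth_map_on \<A> W f" "smooth_map_on \<A> W g"
  shows "smooth_map_on \<A> W (\<lambda>p. f p *\<^sub>R g p)"
proof (rule smooth_map_onI)
  fix U c assume c: "(U, c) \<in> \<A>"
  show "smooth_on (c ` (U \<inter> W)) ((\<lambda>p. f p *\<^sub>R g p) \<circ> inv_into U c)"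
    using smooth_on_scaleR[OF chart_open_image_Int[OF c assms(1)] smooth_map_onD[OF assms(2) c] smooth_map_onD[OF assms(3) c]]
    by (simp add: o_def)
qed

lemma smooth_map_on_minus:
  assumes "open W" "smooth_map_on \<A> W f"
  shows "smooth_map_on \<A> W (\<lambda>p. - f p)"
  using smooth_map_on_scaleR[OF assms(1) smooth_map_on_const assms(2), of "- 1"] by simp

lemma smooth_map_on_diff:
  assumes "open W" "smooth_map_on \<A> W f" "smooth_map_on \<A> W g"
  shows "smooth_map_on \<A> W (\<lambda>p. f p - g p)"
  using smooth_map_on_add[OF assms(1,2) smooth_map_on_minus[OF assms(1,3)]] by simp

lemma smooth_map_on_sum:
  assumes "open W" "\<And>i. i \<in> I \<Longrightarrow> smooth_map_on \<A> W (f i)"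
  shows "smooth_map_on \<A> W (\<lambda>p. \<Sum>i\<in>I. f i p)"
  using assms(2)
  by (induction I rule: infinite_finite_induct) (auto intro: smooth_map_on_add smooth_map_on_const assms(1))

lemma smooth_map_on_inverse:
  fixes f :: "'m \<Rightarrow> real"
  assumes "open W" "smooth_map_on \<A> W f" "\<And>p. p \<in> W \<Longrightarrow> f p \<noteq> 0"
  shows "smooth_map_on \<A> W (\<lambda>p. inverse (f p))"
proof (rule smooth_map_onI)
  fix U c assume c: "(U, c) \<in> \<A>"
  have "(f \<circ> inv_into U c) x \<noteq> 0" if "x \<in> c ` (U \<inter> W)" for x
    using that assms(3) chart_inverse[OF c] by auto
  from smooth_on_inverse[OF chart_open_image_Int[OF c assms(1)] smooth_map_onD[OF assms(2) c] this]
  show "smooth_on (c ` (U \<inter> W)) ((\<lambda>p. inverse (f p)) \<circ> inv_into U c)"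
    by (simp add: o_def)
qed

lemma smooth_map_on_bounded_linear:
  assumes "open W" "bounded_linear L" "smooth_map_on \<A> W f"
  shows "smooth_map_on \<A> W (\<lambda>p. L (f p))"
proof (rule smooth_map_onI)
  fix U c assume c: "(U, c) \<in> \<A>"
  show "smooth_on (c ` (U \<inter> W)) ((\<lambda>p. L (f p)) \<circ> inv_into U c)"
    using smooth_on_bounded_linear[OF chart_open_image_Int[OF c assms(1)] assms(2) smooth_map_onD[OF assms(3) c]]
    by (simp add: o_def)
qed

lemma smooth_map_on_imp_continuous_on:
  assumes "open W" "smooth_map_on \<A> W f"
  shows "continuous_on W f"
proof -
  have "isCont f p" if p: "p \<in> W" for p
  proof -
    obtain U c where c: "(U, c) \<in> \<A>" "p \<in> U" using chart_exists by blast
    have "continuous_on (c ` (U \<inter> W)) (f \<circ> inv_into U c)"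
      by (rule smooth_on_imp_continuous_on[OF smooth_map_onD[OF assms(2) c(1)]])
    then have "continuous_on (U \<inter> W) ((f \<circ> inv_into U c) \<circ> c)"
      by (intro continuous_on_compose[OF continuous_on_subset[OF chart_continuous[OF c(1)]]]) auto
    then have "continuous_on (U \<inter> W) f"
      by (rule continuous_on_eq) (use chart_inverse[OF c(1)] in auto)
    moreover have "open (U \<inter> W)" using chart_open[OF c(1)] assms(1) by blast
    ultimately show ?thesis using p c(2) by (simp add: continuous_on_eq_continuous_at)
  qed
  then show ?thesis by (simp add: continuous_at_imp_continuous_on)
qed

section \<open>Bump functions on the manifold\<close>

definition bump :: "'m set \<Rightarrow> ('m \<Rightarrow> real) \<Rightarrow> bool" where
  "bump W \<eta> \<longleftrightarrow> smooth_map_on \<A> UNIV \<eta> \<and> (\<exists>K. closed K \<and> K \<subseteq> W \<and> (\<forall>q. q \<notin> K \<longrightarrow> \<eta> q = 0))"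

text \<open>A bump function on the image of a chart is pulled back and extended by 0. The chart
  inverse carries its compact support to a compact set, which is closed because the manifold is
  Hausdorff; hence the extension is locally zero, and so smooth, near points outside the
  chart.\<close>

lemma bump_exists:
  assumes "open W" "p \<in> W"
  obtains \<eta> where "bump W \<eta>" "\<eta> p = 1"
proof -
  obtain U c where c: "(U, c) \<in> \<A>" "p \<in> U" using chart_exists by blast
  obtain h K where h: "smooth_on UNIV h" "h (c p) = (1::real)" "compact K" "K \<subseteq> c ` (U \<inter> W)"
    "\<And>x. x \<notin> K \<Longrightarrow> h x = 0"
    using smooth_bump[OF finite_dim_model chart_open_image_Int[OF c(1) assms(1)], of "c p"] assms(2) c(2)
    by blast
  define K' where "K' = inv_into U c ` K"
  define \<eta> where "\<eta> q = (if q \<in> U then h (c q) else 0)" for q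
  have "compact K'"
    unfolding K'_def
    by (rule compact_continuous_image[OF continuous_on_subset[OF chart_continuous_inverse[OF c(1)]] h(3)])
      (use h(4) in auto)
  then have "closed K'" by (rule compact_imp_closed)
  have K': "K' \<subseteq> U \<inter> W"
  proof
    fix q assume "q \<in> K'"
    then obtain x where "x \<in> K" "q = inv_into U c x" unfolding K'_def by blast
    then show "q \<in> U \<inter> W" using h(4) chart_inverse[OF c(1)] by auto
  qed
  have zero: "\<eta> q = 0" if "q \<notin> K'" for q
  proof (cases "q \<in> U")
    case True
    then have "c q \<notin> K" using that chart_inverse[OF c(1) True] unfolding K'_def by force
    then show ?thesis using h(5) by (simp add: \<eta>_def)
  qed (simp add: \<eta>_def)
  have sU: "smooth_map_on \<A> U (\<lambda>q. h (c q))"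
  proof (rule smooth_map_onI)
    fix V d assume d: "(V, d) \<in> \<A>"
    have "smooth_on (d ` (V \<inter> U)) (\<lambda>x. h ((c \<circ> inv_into V d) x))"
      by (rule smooth_on_compose[OF finite_dim_model chart_open_image_Int[OF d chart_open[OF c(1)]] open_UNIV
            transition_smooth[OF d c(1)] h(1)]) auto
    then show "smooth_on (d ` (V \<inter> U)) ((\<lambda>q. h (c q)) \<circ> inv_into V d)" by (simp add: o_def)
  qed
  have "smooth_map_on \<A> UNIV \<eta>"
  proof (rule smooth_map_on_local)
    fix q
    show "\<exists>V. open V \<and> q \<in> V \<and> smooth_map_on \<A> V \<eta>"
    proof (cases "q \<in> U")
      case True
      have "smooth_map_on \<A> U \<eta>"
        by (rule smooth_map_on_cong[OF sU chart_open[OF c(1)]]) (simp add: \<eta>_def)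
      then show ?thesis using True chart_open[OF c(1)] by blast
    next
      case False
      have "smooth_map_on \<A> (- K') \<eta>"
        by (rule smooth_map_on_cong[OF smooth_map_on_const[of _ _ 0]]) (use zero \<open>closed K'\<close> in auto)
      moreover have "q \<in> - K'" using False K' by auto
      ultimately show ?thesis using \<open>closed K'\<close> by blast
    qed
  qed
  moreover have "\<eta> p = 1" using c(2) h(2) by (simp add: \<eta>_def)
  ultimately show ?thesis
    using that[of \<eta>] K' zero \<open>closed K'\<close> unfolding bump_def by blast
qed

text \<open>Off \<open>W\<close> the values of \<open>f\<close> are arbitrary.\<close>

lemma smooth_map_on_bump_scaleR:
  assumes "bump W \<eta>" "open W" "open V" "smooth_map_on \<A> (W \<inter> V) f"
  shows "smooth_map_on \<A> V (\<lambda>p. \<eta> p *\<^sub>R f p)"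
proof (rule smooth_map_on_local)
  fix q assume q: "q \<in> V"
  obtain K where K: "closed K" "K \<subseteq> W" "\<And>q. q \<notin> K \<Longrightarrow> \<eta> q = 0" and \<eta>: "smooth_map_on \<A> UNIV \<eta>"
    using assms(1) unfolding bump_def by blast
  show "\<exists>T. open T \<and> q \<in> T \<and> smooth_map_on \<A> T (\<lambda>p. \<eta> p *\<^sub>R f p)"
  proof (cases "q \<in> K")
    case True
    have "smooth_map_on \<A> (W \<inter> V) (\<lambda>p. \<eta> p *\<^sub>R f p)"
      by (rule smooth_map_on_scaleR[OF _ smooth_map_on_subset[OF \<eta>] assms(4)]) (use assms in auto)
    then show ?thesis using True K(2) q assms(2,3) by blast
  next
    case False
    have "smooth_map_on \<A> (- K) (\<lambda>p. \<eta> p *\<^sub>R f p)"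
      by (rule smooth_map_on_cong[OF smooth_map_on_const[of _ _ 0]]) (use K in auto)
    then show ?thesis using False K(1) by blast
  qed
qed

section \<open>Derivatives of functions along tangent vectors\<close>

lemma tangent_deriv_chart:
  assumes f: "smooth_map_on \<A> UNIV f" and t: "t \<in> tangent_space \<A> p" and d: "(V, d) \<in> \<A>" "p \<in> V"
  shows "tangent_deriv \<A> p t f = frechet_derivative (f \<circ> inv_into V d) (at (d p)) (t (V, d))"
proof -
  define \<kappa> where "\<kappa> = (SOME \<kappa>. \<kappa> \<in> \<A> \<and> p \<in> fst \<kappa>)"
  have "\<exists>\<kappa>. \<kappa> \<in> \<A> \<and> p \<in> fst \<kappa>" using d by force
  then have "\<kappa> \<in> \<A> \<and> p \<in> fst \<kappa>" unfolding \<kappa>_def by (rule someI_ex)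
  then obtain U c where c: "\<kappa> = (U, c)" "(U, c) \<in> \<A>" "p \<in> U" by (cases \<kappa>) auto
  \<comment> \<open>The chart picked by the choice operator is compared with the given chart
    \<open>d\<close> through the transition map \<open>?T\<close>. The components of
    \<open>t\<close> in the two charts are related by the derivative of the same \<open>?T\<close>,
    so the chain rule makes the two derivatives of \<open>f\<close> agree.\<close>
  let ?F = "f \<circ> inv_into U c" and ?T = "c \<circ> inv_into V d"
  have t': "t (U, c) = frechet_derivative ?T (at (d p)) (t (V, d))"
  proof -
    have "\<forall>(U, c)\<in>\<A>. \<forall>(V, d)\<in>\<A>. p \<in> U \<longrightarrow> p \<in> V \<longrightarrow>
        t (V, d) = frechet_derivative (d \<circ> inv_into U c) (at (c p)) (t (U, c))"
      using t unfolding tangent_space_def by (elim CollectE conjE)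
    from bspec[OF this d(1)] have "\<forall>(U, c)\<in>\<A>. p \<in> V \<longrightarrow> p \<in> U \<longrightarrow>
        t (U, c) = frechet_derivative (c \<circ> inv_into V d) (at (d p)) (t (V, d))"
      by simp
    from bspec[OF this c(2)] show ?thesis using c(3) d(2) by simp
  qed
  have o: "open (d ` (V \<inter> U))" by (rule chart_open_image_Int[OF d(1) chart_open[OF c(2)]])
  have Tp: "?T (d p) = c p" using chart_inverse[OF d] by simp
  have T: "(?T has_derivative frechet_derivative ?T (at (d p))) (at (d p))"
    by (rule smooth_on_imp_has_derivative[OF transition_smooth[OF d(1) c(2)]]) (use c d in auto)
  have F: "(?F has_derivative frechet_derivative ?F (at (c p))) (at (c p))"
    by (rule smooth_on_imp_has_derivative[OF smooth_map_onD[OF f c(2)]]) (use c in auto)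
  have "(?F \<circ> ?T has_derivative frechet_derivative ?F (at (c p)) \<circ> frechet_derivative ?T (at (d p))) (at (d p))"
    using diff_chain_at[OF T] F Tp by simp
  then have "(f \<circ> inv_into V d has_derivative
      frechet_derivative ?F (at (c p)) \<circ> frechet_derivative ?T (at (d p))) (at (d p))"
    by (rule has_derivative_transform_within_open[OF _ o])
      (use c d chart_inverse[OF c(2)] chart_inverse[OF d(1)] in auto)
  then have "frechet_derivative (f \<circ> inv_into V d) (at (d p)) (t (V, d)) =
      frechet_derivative ?F (at (c p)) (t (U, c))"
    using t' by (simp add: frechet_derivative_at[symmetric])
  moreover have "tangent_deriv \<A> p t f = frechet_derivative ?F (at (c p)) (t (U, c))"
    using c(1) by (simp add: tangent_deriv_def \<kappa>_def[symmetric])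
  ultimately show ?thesis by simp
qed

lemma smooth_has_derivative_chart:
  assumes "smooth_map_on \<A> UNIV f" "(V, d) \<in> \<A>" "p \<in> V"
  shows "(f \<circ> inv_into V d has_derivative frechet_derivative (f \<circ> inv_into V d) (at (d p))) (at (d p))"
  by (rule smooth_on_imp_has_derivative[OF smooth_map_onD[OF assms(1,2)]]) (use assms in auto)

lemma tangent_deriv_mult:
  assumes f: "smooth_map_on \<A> UNIV f" and g: "smooth_map_on \<A> UNIV g" and t: "t \<in> tangent_space \<A> p"
  shows "tangent_deriv \<A> p t (\<lambda>q. f q * g q) = f p * tangent_deriv \<A> p t g + tangent_deriv \<A> p t f * g p"
proof -
  obtain V d where d: "(V, d) \<in> \<A>" "p \<in> V" using chart_exists by blast
  have fg: "smooth_map_on \<A> UNIV (\<lambda>q. f q * g q)"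
    using smooth_map_on_scaleR[OF _ f g] by simp
  have "((\<lambda>q. f q * g q) \<circ> inv_into V d has_derivative
     (\<lambda>v. (f \<circ> inv_into V d) (d p) * frechet_derivative (g \<circ> inv_into V d) (at (d p)) v +
       frechet_derivative (f \<circ> inv_into V d) (at (d p)) v * (g \<circ> inv_into V d) (d p))) (at (d p))"
    using has_derivative_mult[OF smooth_has_derivative_chart[OF f d] smooth_has_derivative_chart[OF g d]]
    by (simp add: o_def)
  from frechet_derivative_at[OF this, symmetric] show ?thesis
    using chart_inverse[OF d] by (simp add: tangent_deriv_chart[OF _ t d] f g fg)
qed

lemma tangent_deriv_add:
  assumes f: "smooth_map_on \<A> UNIV f" and g: "smooth_map_on \<A> UNIV g" and t: "t \<in> tangent_space \<A> p"
  shows "tangent_deriv \<A> p t (\<lambda>q. f q + g q) = tangent_deriv \<A> p t f + tangent_deriv \<A> p t g"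
proof -
  obtain V d where d: "(V, d) \<in> \<A>" "p \<in> V" using chart_exists by blast
  have fg: "smooth_map_on \<A> UNIV (\<lambda>q. f q + g q)"
    by (rule smooth_map_on_add[OF _ f g]) simp
  have "((\<lambda>q. f q + g q) \<circ> inv_into V d has_derivative
     (\<lambda>v. frechet_derivative (f \<circ> inv_into V d) (at (d p)) v +
       frechet_derivative (g \<circ> inv_into V d) (at (d p)) v)) (at (d p))"
    using has_derivative_add[OF smooth_has_derivative_chart[OF f d] smooth_has_derivative_chart[OF g d]]
    by (simp add: o_def)
  from frechet_derivative_at[OF this, symmetric] show ?thesis
    by (simp add: tangent_deriv_chart[OF _ t d] f g fg)
qed

lemma tangent_deriv_linear:
  assumes f: "smooth_map_on \<A> UNIV f"
    and t: "t \<in> tangent_space \<A> p" "s \<in> tangent_space \<A> p" "r \<in> tangent_space \<A> p"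
    and r: "\<And>\<kappa>. r \<kappa> = k *\<^sub>R t \<kappa> + s \<kappa>"
  shows "tangent_deriv \<A> p r f = k * tangent_deriv \<A> p t f + tangent_deriv \<A> p s f"
proof -
  obtain V d where d: "(V, d) \<in> \<A>" "p \<in> V" using chart_exists by blast
  have "linear (frechet_derivative (f \<circ> inv_into V d) (at (d p)))"
    using smooth_has_derivative_chart[OF f d] has_derivative_linear by blast
  then show ?thesis
    by (simp add: tangent_deriv_chart[OF f _ d] t r linear_add linear_scale)
qed

lemma smooth_tangent_deriv:
  assumes f: "smooth_map_on \<A> UNIV f" and t: "\<And>p. t p \<in> tangent_space \<A> p"
    and st: "\<And>V d. (V, d) \<in> \<A> \<Longrightarrow> smooth_map_on \<A> V (\<lambda>p. t p (V, d))"
  shows "smooth_map_on \<A> UNIV (\<lambda>p. tangent_deriv \<A> p (t p) f)"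
proof (rule smooth_map_onI)
  fix V d assume d: "(V, d) \<in> \<A>"
  have o: "open (d ` (V \<inter> UNIV))" by (rule chart_open_image_Int[OF d open_UNIV])
  have "smooth_on (d ` (V \<inter> UNIV)) ((\<lambda>p. t p (V, d)) \<circ> inv_into V d)"
    using smooth_map_onD[OF st[OF d] d] by simp
  from smooth_on_frechet_derivative_apply[OF finite_dim_model o smooth_map_onD[OF f d] this]
  show "smooth_on (d ` (V \<inter> UNIV)) ((\<lambda>p. tangent_deriv \<A> p (t p) f) \<circ> inv_into V d)"
    by (rule smooth_on_cong[OF _ o])
      (use tangent_deriv_chart[OF f t d] chart_inverse[OF d] in auto)
qed

end


section \<open>Sections of a vector bundle and of its dual\<close>

lemma lin_onD:
  assumes "lin_on V f"
  shows "x \<in> V \<Longrightarrow> y \<in> V \<Longrightarrow> f (x + y) = f x + f y" and "x \<in> V \<Longrightarrow> f (c *\<^sub>R x) = c *\<^sub>R f x"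
  using assms by (auto simp: lin_on_def)

lemma lin_on_0: "lin_on V f \<Longrightarrow> subspace V \<Longrightarrow> f 0 = 0"
  using lin_onD(2)[of V f 0 0] by (simp add: subspace_0)

lemma lin_on_diff:
  assumes "lin_on V f" "subspace V" "x \<in> V" "y \<in> V"
  shows "f (x - y) = f x - f y"
  using lin_onD(1)[OF assms(1), of "x - y" y] assms subspace_diff[OF assms(2)] by simp

lemma lin_on_sum:
  assumes "lin_on V f" "subspace V" "\<And>i. i \<in> I \<Longrightarrow> x i \<in> V"
  shows "f (\<Sum>i\<in>I. c i *\<^sub>R x i) = (\<Sum>i\<in>I. c i *\<^sub>R f (x i))"
  using assms(3)
proof (induction I rule: infinite_finite_induct)
  case (insert i I)
  have "(\<Sum>i\<in>I. c i *\<^sub>R x i) \<in> V"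
    using insert by (intro subspace_sum[OF assms(2)] subspace_scale[OF assms(2)]) auto
  then show ?case
    using insert by (simp add: lin_onD[OF assms(1)] subspace_scale[OF assms(2)])
qed (simp_all add: lin_on_0[OF assms(1,2)])

locale vbundle =
  fixes A :: "('m::{t2_space,second_countable_topology}, 'e::real_normed_vector, 'v::real_vector,
    'f::real_normed_vector, 'z) vbundle_scheme"
  assumes vector_bundle: "vector_bundle A"
begin

sublocale manifold "atlas A"
  using vector_bundle by unfold_locales (simp add: vector_bundle_def)

lemma finite_dim_fibre: "finite_dim TYPE('f)"
  using vector_bundle by (simp add: vector_bundle_def)

lemma subspace_fibre: "subspace (fibre A p)"
  using vector_bundle by (simp add: vector_bundle_def)

lemmas fibre_ops = subspace_add[OF subspace_fibre] subspace_scale[OF subspace_fibre]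
  subspace_0[OF subspace_fibre] subspace_diff[OF subspace_fibre] subspace_neg[OF subspace_fibre]
  subspace_sum[OF subspace_fibre]

lemma triv_exists: obtains U \<phi> where "(U, \<phi>) \<in> trivs A" "p \<in> U"
proof -
  have "p \<in> (\<Union>\<tau>\<in>trivs A. fst \<tau>)" using vector_bundle by (simp add: vector_bundle_def)
  then show ?thesis using that by force
qed

lemma
  assumes "(U, \<phi>) \<in> trivs A"
  shows triv_open: "open U"
    and triv_lin_on: "p \<in> U \<Longrightarrow> lin_on (fibre A p) (\<phi> p)"
    and triv_bij: "p \<in> U \<Longrightarrow> bij_betw (\<phi> p) (fibre A p) UNIV"
  using assms vector_bundle by (auto simp: vector_bundle_def)

lemma const_sec_smooth:
  assumes "(U, \<phi>) \<in> trivs A" "(V, \<psi>) \<in> trivs A"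
  shows "smooth_map_on (atlas A) (U \<inter> V) (\<lambda>p. \<psi> p (const_sec A \<phi> w p))"
proof -
  have "\<forall>(U, \<phi>)\<in>trivs A. \<forall>(V, \<psi>)\<in>trivs A. \<forall>w.
        smooth_map_on (atlas A) (U \<inter> V) (\<lambda>p. \<psi> p (const_sec A \<phi> w p))"
    using vector_bundle unfolding vector_bundle_def by (elim conjE)
  from bspec[OF this assms(1)] have "\<forall>(V, \<psi>)\<in>trivs A. \<forall>w.
        smooth_map_on (atlas A) (U \<inter> V) (\<lambda>p. \<psi> p (const_sec A \<phi> w p))" by simp
  from bspec[OF this assms(2)] show ?thesis by simp
qed

section \<open>Frames and coframes of a local trivialisation\<close>

context
  fixes U \<phi> p
  assumes triv: "(U, \<phi>) \<in> trivs A" and p: "p \<in> U"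
begin

lemma const_sec_in_fibre: "const_sec A \<phi> w p \<in> fibre A p"
  and triv_const_sec: "\<phi> p (const_sec A \<phi> w p) = w"
proof -
  have "w \<in> \<phi> p ` fibre A p" using triv_bij[OF triv p] by (simp add: bij_betw_def)
  then show "const_sec A \<phi> w p \<in> fibre A p" "\<phi> p (const_sec A \<phi> w p) = w"
    unfolding const_sec_def by (auto intro: inv_into_into f_inv_into_f)
qed

lemma triv_eqD: "v \<in> fibre A p \<Longrightarrow> w \<in> fibre A p \<Longrightarrow> \<phi> p v = \<phi> p w \<Longrightarrow> v = w"
  using triv_bij[OF triv p] by (auto simp: bij_betw_def inj_on_def)

lemma const_sec_expansion:
  assumes "v \<in> fibre A p"
  shows "v = (\<Sum>b\<in>fbasis. coord b (\<phi> p v) *\<^sub>R const_sec A \<phi> b p)" (is "_ = ?s")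
proof (rule triv_eqD[OF assms])
  show "?s \<in> fibre A p"
    by (intro fibre_ops const_sec_in_fibre)
  have "\<phi> p ?s = (\<Sum>b\<in>fbasis. coord b (\<phi> p v) *\<^sub>R \<phi> p (const_sec A \<phi> b p))"
    by (rule lin_on_sum[OF triv_lin_on[OF triv p] subspace_fibre]) (rule const_sec_in_fibre)
  then show "\<phi> p v = \<phi> p ?s" by (simp add: triv_const_sec sum_coord[OF finite_dim_fibre])
qed

lemma lin_on_expansion:
  assumes "lin_on (fibre A p) g" "v \<in> fibre A p"
  shows "g v = (\<Sum>b\<in>fbasis. coord b (\<phi> p v) *\<^sub>R g (const_sec A \<phi> b p))"
proof -
  have "g v = g (\<Sum>b\<in>fbasis. coord b (\<phi> p v) *\<^sub>R const_sec A \<phi> b p)"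
    using const_sec_expansion[OF assms(2)] by simp
  also have "\<dots> = (\<Sum>b\<in>fbasis. coord b (\<phi> p v) *\<^sub>R g (const_sec A \<phi> b p))"
    by (rule lin_on_sum[OF assms(1) subspace_fibre]) (rule const_sec_in_fibre)
  finally show ?thesis .
qed

lemma const_cosec_in_dual_fibre: "linear u \<Longrightarrow> const_cosec A \<phi> u p \<in> dual_fibre A p"
  using lin_onD[OF triv_lin_on[OF triv p]]
  by (auto simp: dual_fibre_def const_cosec_def lin_on_def fibre_ops linear_add linear_scale)

lemma dual_fibre_expansion:
  assumes "\<alpha> \<in> dual_fibre A p"
  shows "\<alpha> = (\<lambda>v. \<Sum>b\<in>fbasis. \<alpha> (const_sec A \<phi> b p) * const_cosec A \<phi> (coord b) p v)"
proof
  fix v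
  show "\<alpha> v = (\<Sum>b\<in>fbasis. \<alpha> (const_sec A \<phi> b p) * const_cosec A \<phi> (coord b) p v)"
    using assms lin_on_expansion[of \<alpha> v]
    by (cases "v \<in> fibre A p") (auto simp: dual_fibre_def const_cosec_def mult.commute)
qed

end

text \<open>Smoothness of a fibrewise linear map is only known on the frame of a trivialisation.
  Expanding \<open>x\<close> in this frame writes the value as a finite sum of smooth coefficients
  times known smooth maps. Pairings, endomorphisms, dual maps and the anchor are all handled this
  way.\<close>

lemma smooth_map_on_lin_on_app:
  assumes triv: "(U, \<phi>) \<in> trivs A" and W: "open W" "W \<subseteq> U"
    and g: "\<And>p. p \<in> W \<Longrightarrow> lin_on (fibre A p) (g p)"
    and sg: "\<And>w. smooth_map_on (atlas A) W (\<lambda>p. g p (const_sec A \<phi> w p))"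
    and x: "\<And>p. p \<in> W \<Longrightarrow> x p \<in> fibre A p"
    and sx: "smooth_map_on (atlas A) W (\<lambda>p. \<phi> p (x p))"
  shows "smooth_map_on (atlas A) W (\<lambda>p. g p (x p))"
proof (rule smooth_map_on_cong[OF _ W(1)])
  show "smooth_map_on (atlas A) W (\<lambda>p. \<Sum>b\<in>fbasis. coord b (\<phi> p (x p)) *\<^sub>R g p (const_sec A \<phi> b p))"
    by (rule smooth_map_on_sum[OF W(1)], rule smooth_map_on_scaleR[OF W(1) _ sg],
        rule smooth_map_on_bounded_linear[OF W(1) bounded_linear_coord[OF finite_dim_fibre] sx])
  show "(\<Sum>b\<in>fbasis. coord b (\<phi> p (x p)) *\<^sub>R g p (const_sec A \<phi> b p)) = g p (x p)" if "p \<in> W" for p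
    using lin_on_expansion[OF triv _ g[OF that] x[OF that]] that W(2) by auto
qed

section \<open>The module of sections\<close>

lemma smooth_funsI: "smooth_map_on (atlas A) UNIV f \<Longrightarrow> f \<in> smooth_funs A"
  and smooth_funsD: "f \<in> smooth_funs A \<Longrightarrow> smooth_map_on (atlas A) W f"
  by (auto simp: smooth_funs_def intro: smooth_map_on_subset)

lemma smooth_funs_const: "(\<lambda>p. c) \<in> smooth_funs A"
  by (simp add: smooth_funs_def smooth_map_on_const)

lemma smooth_funs_diff: "f \<in> smooth_funs A \<Longrightarrow> g \<in> smooth_funs A \<Longrightarrow> (\<lambda>p. f p - g p) \<in> smooth_funs A"
  by (simp add: smooth_funs_def smooth_map_on_diff)

lemma smooth_funs_minus: "f \<in> smooth_funs A \<Longrightarrow> (\<lambda>p. - f p) \<in> smooth_funs A"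
  by (simp add: smooth_funs_def smooth_map_on_minus)

lemma sectionsI:
  "(\<And>p. x p \<in> fibre A p) \<Longrightarrow>
    (\<And>U \<phi>. (U, \<phi>) \<in> trivs A \<Longrightarrow> smooth_map_on (atlas A) U (\<lambda>p. \<phi> p (x p))) \<Longrightarrow> x \<in> sections A"
  by (auto simp: sections_def)

lemma
  assumes "x \<in> sections A"
  shows sections_fibre: "x p \<in> fibre A p"
    and sections_smooth: "(U, \<phi>) \<in> trivs A \<Longrightarrow> smooth_map_on (atlas A) U (\<lambda>p. \<phi> p (x p))"
  using assms by (auto simp: sections_def)

lemma sections_add:
  assumes "x \<in> sections A" "y \<in> sections A"
  shows "(\<lambda>p. x p + y p) \<in> sections A"
proof (rule sectionsI)
  fix U \<phi> assume t: "(U, \<phi>) \<in> trivs A"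
  show "smooth_map_on (atlas A) U (\<lambda>p. \<phi> p (x p + y p))"
    by (rule smooth_map_on_cong[OF smooth_map_on_add[OF triv_open[OF t] sections_smooth[OF assms(1) t]
        sections_smooth[OF assms(2) t]] triv_open[OF t]])
      (use lin_onD[OF triv_lin_on[OF t]] assms in \<open>simp add: sections_fibre\<close>)
qed (use assms in \<open>simp add: sections_fibre fibre_ops\<close>)

lemma sections_scale:
  assumes "f \<in> smooth_funs A" "x \<in> sections A"
  shows "(\<lambda>p. f p *\<^sub>R x p) \<in> sections A"
proof (rule sectionsI)
  fix U \<phi> assume t: "(U, \<phi>) \<in> trivs A"
  show "smooth_map_on (atlas A) U (\<lambda>p. \<phi> p (f p *\<^sub>R x p))"
    by (rule smooth_map_on_cong[OF smooth_map_on_scaleR[OF triv_open[OF t] smooth_funsD[OF assms(1)]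
        sections_smooth[OF assms(2) t]] triv_open[OF t]])
      (use lin_onD[OF triv_lin_on[OF t]] assms in \<open>simp add: sections_fibre\<close>)
qed (use assms in \<open>simp add: sections_fibre fibre_ops\<close>)

lemma sections_scale_const: "x \<in> sections A \<Longrightarrow> (\<lambda>p. c *\<^sub>R x p) \<in> sections A"
  by (rule sections_scale[OF smooth_funs_const])

lemma sections_diff: "x \<in> sections A \<Longrightarrow> y \<in> sections A \<Longrightarrow> (\<lambda>p. x p - y p) \<in> sections A"
  using sections_add[OF _ sections_scale_const[of y "- 1"], of x] by simp

text \<open>Local frame vectors become global sections after multiplication by a bump function
  supported in the trivialising set; the values of \<open>const_sec\<close> outside \<open>U\<close>
  are arbitrary but are multiplied by 0.\<close>

lemma section_bump:
  assumes t: "(U, \<phi>) \<in> trivs A" and \<eta>: "bump U \<eta>"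
  shows "(\<lambda>p. \<eta> p *\<^sub>R const_sec A \<phi> w p) \<in> sections A"
proof (rule sectionsI)
  have \<eta>0: "\<eta> p = 0" if "p \<notin> U" for p using \<eta> that unfolding bump_def by blast
  show "\<eta> p *\<^sub>R const_sec A \<phi> w p \<in> fibre A p" for p
    using \<eta>0[of p] const_sec_in_fibre[OF t, of p w] by (cases "p \<in> U") (auto simp: fibre_ops)
  fix V \<psi> assume t': "(V, \<psi>) \<in> trivs A"
  show "smooth_map_on (atlas A) V (\<lambda>p. \<psi> p (\<eta> p *\<^sub>R const_sec A \<phi> w p))"
  proof (rule smooth_map_on_cong[OF smooth_map_on_bump_scaleR[OF \<eta> triv_open[OF t] triv_open[OF t']
          const_sec_smooth[OF t t']] triv_open[OF t']])
    fix p assume p: "p \<in> V"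
    show "\<eta> p *\<^sub>R \<psi> p (const_sec A \<phi> w p) = \<psi> p (\<eta> p *\<^sub>R const_sec A \<phi> w p)"
      using \<eta>0[of p] lin_onD(2)[OF triv_lin_on[OF t' p] const_sec_in_fibre[OF t, of p]]
        lin_on_0[OF triv_lin_on[OF t' p] subspace_fibre]
      by (cases "p \<in> U") auto
  qed
qed

text \<open>This turns identities between sections into statements about single vectors of a
  fibre.\<close>

lemma section_through:
  assumes "v \<in> fibre A p"
  obtains x where "x \<in> sections A" "x p = v"
proof -
  obtain U \<phi> where t: "(U, \<phi>) \<in> trivs A" "p \<in> U" using triv_exists by blast
  obtain \<eta> where \<eta>: "bump U \<eta>" "\<eta> p = 1" using bump_exists[OF triv_open[OF t(1)] t(2)] by blast
  have "const_sec A \<phi> (\<phi> p v) p = v"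
    by (rule triv_eqD[OF t]) (simp_all add: const_sec_in_fibre[OF t] triv_const_sec[OF t] assms)
  then show ?thesis
    using that[OF section_bump[OF t(1) \<eta>(1), of "\<phi> p v"]] \<eta>(2) by simp
qed

section \<open>Dual sections and their pairing with sections\<close>

lemma dual_sectionsI:
  "(\<And>p. \<alpha> p \<in> dual_fibre A p) \<Longrightarrow>
    (\<And>U \<phi> w. (U, \<phi>) \<in> trivs A \<Longrightarrow> smooth_map_on (atlas A) U (\<lambda>p. \<alpha> p (const_sec A \<phi> w p)))
    \<Longrightarrow> \<alpha> \<in> dual_sections A"
  by (auto simp: dual_sections_def)

lemma dual_fibre_lin_on: "\<alpha> \<in> dual_fibre A p \<Longrightarrow> lin_on (fibre A p) \<alpha>"
  by (simp add: dual_fibre_def)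

lemma
  assumes "\<alpha> \<in> dual_sections A"
  shows dual_sections_fibre: "\<alpha> p \<in> dual_fibre A p"
    and dual_sections_lin_on: "lin_on (fibre A p) (\<alpha> p)"
    and dual_sections_smooth: "(U, \<phi>) \<in> trivs A \<Longrightarrow> smooth_map_on (atlas A) U (\<lambda>p. \<alpha> p (const_sec A \<phi> w p))"
  using assms by (auto simp: dual_sections_def dual_fibre_def)

lemma pair_smooth:
  assumes \<alpha>: "\<alpha> \<in> dual_sections A" and x: "x \<in> sections A"
  shows "pair \<alpha> x \<in> smooth_funs A"
proof (rule smooth_funsI, rule smooth_map_on_local)
  fix p
  obtain U \<phi> where t: "(U, \<phi>) \<in> trivs A" "p \<in> U" using triv_exists by blast
  have "smooth_map_on (atlas A) U (pair \<alpha> x)"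
    unfolding pair_def
    by (rule smooth_map_on_lin_on_app[OF t(1) triv_open[OF t(1)] order.refl dual_sections_lin_on[OF \<alpha>]
          dual_sections_smooth[OF \<alpha> t(1)] sections_fibre[OF x] sections_smooth[OF x t(1)]])
  then show "\<exists>V. open V \<and> p \<in> V \<and> smooth_map_on (atlas A) V (pair \<alpha> x)"
    using t triv_open[OF t(1)] by blast
qed

text \<open>On the fibres, sections through each vector decide the values; off the fibres both
  families vanish by convention.\<close>

lemma dual_section_eqI:
  assumes "\<And>p. \<alpha> p \<in> dual_fibre A p" "\<And>p. \<beta> p \<in> dual_fibre A p"
    and "\<And>y. y \<in> sections A \<Longrightarrow> pair \<alpha> y = pair \<beta> y"
  shows "\<alpha> = \<beta>"
proof (intro ext)
  fix p v
  show "\<alpha> p v = \<beta> p v"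
  proof (cases "v \<in> fibre A p")
    case True
    then obtain x where "x \<in> sections A" "x p = v" using section_through by blast
    then show ?thesis using fun_cong[OF assms(3), of x p] by (auto simp: pair_def)
  next
    case False
    then show ?thesis using assms(1,2)[of p] by (simp add: dual_fibre_def)
  qed
qed

section \<open>Tensorial functionals on sections come from dual sections\<close>

context
  fixes F :: "('m \<Rightarrow> 'v) \<Rightarrow> 'm \<Rightarrow> real"
  assumes add: "\<And>y z. y \<in> sections A \<Longrightarrow> z \<in> sections A \<Longrightarrow> F (\<lambda>p. y p + z p) = (\<lambda>p. F y p + F z p)"
    and scale: "\<And>f y. f \<in> smooth_funs A \<Longrightarrow> y \<in> sections A \<Longrightarrow> F (\<lambda>p. f p *\<^sub>R y p) = (\<lambda>p. f p * F y p)"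
    and smooth: "\<And>y. y \<in> sections A \<Longrightarrow> F y \<in> smooth_funs A"
begin

lemma tensorial_sum:
  assumes "finite I" "\<And>i. i \<in> I \<Longrightarrow> f i \<in> smooth_funs A" "\<And>i. i \<in> I \<Longrightarrow> y i \<in> sections A"
  shows "(\<lambda>p. \<Sum>i\<in>I. f i p *\<^sub>R y i p) \<in> sections A \<and>
    F (\<lambda>p. \<Sum>i\<in>I. f i p *\<^sub>R y i p) = (\<lambda>p. \<Sum>i\<in>I. f i p * F (y i) p)"
  using assms
proof (induction I)
  case empty
  \<comment> \<open>The empty sum is the zero section, written as 0 times some section
    \<open>y\<close> so that the scaling hypothesis determines the value of \<open>F\<close>
    there.\<close>
  obtain y where y: "y \<in> sections A"
  proof -
    obtain x where "x \<in> sections A" "x undefined = 0"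
      using section_through[of 0 undefined] fibre_ops(3) by blast
    then show ?thesis using that by blast
  qed
  from scale[OF smooth_funs_const[of 0] y] sections_scale_const[OF y, of 0] show ?case by simp
next
  case (insert i I)
  then have s: "(\<lambda>p. f i p *\<^sub>R y i p) \<in> sections A" by (intro sections_scale) auto
  from insert add[OF s] sections_add[OF s] scale[of "f i" "y i"] show ?case by simp
qed

text \<open>Near \<open>p\<close>, expand \<open>y\<close> in a frame and multiply by the square of
  a bump function \<open>\<eta>\<close>: one factor makes the coefficients global functions, the
  other makes the frame vectors global sections. Then \<open>F\<close> of the product at
  \<open>p\<close> is a combination with coefficients vanishing at \<open>p\<close>, while on the
  other side the factor is 1 there.\<close>

lemma tensorial_zero:
  assumes y: "y \<in> sections A" and "y p = 0"
  shows "F y p = 0"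
proof -
  obtain U \<phi> where t: "(U, \<phi>) \<in> trivs A" "p \<in> U" using triv_exists by blast
  note U = triv_open[OF t(1)]
  obtain \<eta> where \<eta>: "bump U \<eta>" "\<eta> p = 1" using bump_exists[OF U t(2)] by blast
  define f where "f b q = \<eta> q * coord b (\<phi> q (y q))" for b q
  define e where "e b q = \<eta> q *\<^sub>R const_sec A \<phi> b q" for b q
  have \<eta>s: "\<eta> \<in> smooth_funs A" using \<eta>(1) unfolding bump_def by (intro smooth_funsI) auto
  have \<eta>2: "(\<lambda>q. \<eta> q * \<eta> q) \<in> smooth_funs A"
    using smooth_map_on_scaleR[OF open_UNIV smooth_funsD[OF \<eta>s] smooth_funsD[OF \<eta>s]]
    by (intro smooth_funsI) simp
  have f: "f b \<in> smooth_funs A" if b: "b \<in> fbasis" for b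
  proof -
    have "smooth_map_on (atlas A) (U \<inter> UNIV) (\<lambda>q. coord b (\<phi> q (y q)))"
      using smooth_map_on_bounded_linear[OF U bounded_linear_coord[OF finite_dim_fibre b] sections_smooth[OF y t(1)]]
      by simp
    from smooth_map_on_bump_scaleR[OF \<eta>(1) U open_UNIV this] show ?thesis
      by (intro smooth_funsI) (simp add: f_def[abs_def])
  qed
  have e: "e b \<in> sections A" for b
    unfolding e_def[abs_def] by (rule section_bump[OF t(1) \<eta>(1)])
  have "(\<lambda>q. (\<eta> q * \<eta> q) *\<^sub>R y q) = (\<lambda>q. \<Sum>b\<in>fbasis. f b q *\<^sub>R e b q)"
  proof
    fix q
    show "(\<eta> q * \<eta> q) *\<^sub>R y q = (\<Sum>b\<in>fbasis. f b q *\<^sub>R e b q)"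
    proof (cases "q \<in> U")
      case True
      have "(\<eta> q * \<eta> q) *\<^sub>R y q = (\<eta> q * \<eta> q) *\<^sub>R (\<Sum>b\<in>fbasis. coord b (\<phi> q (y q)) *\<^sub>R const_sec A \<phi> b q)"
        using const_sec_expansion[OF t(1) True sections_fibre[OF y]] by simp
      also have "\<dots> = (\<Sum>b\<in>fbasis. f b q *\<^sub>R e b q)"
        by (simp add: f_def e_def scaleR_sum_right mult_ac)
      finally show ?thesis .
    next
      case False
      then have "\<eta> q = 0" using \<eta>(1) unfolding bump_def by blast
      then show ?thesis by (simp add: f_def)
    qed
  qed
  then have "(\<lambda>q. (\<eta> q * \<eta> q) * F y q) = (\<lambda>q. \<Sum>b\<in>fbasis. f b q * F (e b) q)"
    using scale[OF \<eta>2 y] tensorial_sum[OF finite_fbasis[OF finite_dim_fibre] f e] by simp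
  from fun_cong[OF this, of p] show ?thesis
    using \<eta>(2) assms(2) lin_on_0[OF triv_lin_on[OF t] subspace_fibre]
    by (simp add: f_def linear_0[OF linear_coord])
qed

lemma tensorial_cong:
  assumes "y \<in> sections A" "z \<in> sections A" "y p = z p"
  shows "F y p = F z p"
proof -
  have "F (\<lambda>p. y p + (- 1) *\<^sub>R z p) p = 0"
    using assms by (intro tensorial_zero sections_add sections_scale_const) auto
  then show ?thesis
    using add[OF assms(1) sections_scale_const[OF assms(2), of "- 1"]] scale[OF smooth_funs_const[of "- 1"] assms(2)]
    by simp
qed

text \<open>Since \<open>F y p\<close> depends on \<open>y p\<close> only, the covector at
  \<open>p\<close> may be evaluated with an arbitrary section through the given vector. Linearity on
  the fibres is then inherited from \<open>F\<close>.\<close>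

lemma tensorial_dual_section:
  obtains \<gamma> where "\<gamma> \<in> dual_sections A" "\<And>y. y \<in> sections A \<Longrightarrow> pair \<gamma> y = F y"
proof -
  define \<gamma> where "\<gamma> p v = (if v \<in> fibre A p then F (SOME y. y \<in> sections A \<and> y p = v) p else 0)" for p v
  have \<gamma>: "\<gamma> p (y p) = F y p" if y: "y \<in> sections A" for y p
  proof -
    have "\<exists>z. z \<in> sections A \<and> z p = y p" using y by blast
    then have "(SOME z. z \<in> sections A \<and> z p = y p) \<in> sections A \<and> (SOME z. z \<in> sections A \<and> z p = y p) p = y p"
      by (rule someI_ex)
    then show ?thesis
      using tensorial_cong[OF _ y] sections_fibre[OF y] by (simp add: \<gamma>_def)
  qed
  have lin: "lin_on (fibre A p) (\<gamma> p)" for p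
    unfolding lin_on_def
  proof (intro conjI ballI allI)
    fix v w assume "v \<in> fibre A p" "w \<in> fibre A p"
    then obtain x y where xy: "x \<in> sections A" "x p = v" "y \<in> sections A" "y p = w"
      using section_through by metis
    then show "\<gamma> p (v + w) = \<gamma> p v + \<gamma> p w"
      using \<gamma>[OF sections_add[OF xy(1,3)], of p] add[OF xy(1,3)] \<gamma>[OF xy(1), of p] \<gamma>[OF xy(3), of p] by simp
  next
    fix c v assume "v \<in> fibre A p"
    then obtain x where x: "x \<in> sections A" "x p = v" using section_through by metis
    then show "\<gamma> p (c *\<^sub>R v) = c *\<^sub>R \<gamma> p v"
      using \<gamma>[OF sections_scale_const[OF x(1), of c], of p] scale[OF smooth_funs_const[of c] x(1)] \<gamma>[OF x(1), of p]
      by simp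
  qed
  have "\<gamma> \<in> dual_sections A"
  proof (rule dual_sectionsI)
    show "\<gamma> p \<in> dual_fibre A p" for p using lin[of p] by (simp add: dual_fibre_def \<gamma>_def)
    fix U \<phi> w assume t: "(U, \<phi>) \<in> trivs A"
    note U = triv_open[OF t]
    show "smooth_map_on (atlas A) U (\<lambda>p. \<gamma> p (const_sec A \<phi> w p))"
    proof (rule smooth_map_on_local)
      fix p assume p: "p \<in> U"
      obtain \<eta> where \<eta>: "bump U \<eta>" "\<eta> p = 1" using bump_exists[OF U p] by blast
      have \<eta>s: "smooth_map_on (atlas A) UNIV \<eta>" using \<eta>(1) unfolding bump_def by blast
      define e where "e q = \<eta> q *\<^sub>R const_sec A \<phi> w q" for q
      have e: "e \<in> sections A" unfolding e_def[abs_def] by (rule section_bump[OF t \<eta>(1)])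
      \<comment> \<open>On \<open>W\<close> the frame vector is the global section \<open>e\<close>
        divided by \<open>\<eta>\<close>, so its image under \<gamma> is the smooth function
        \<open>F e\<close> divided by \<open>\<eta>\<close>.\<close>
      define W where "W = U \<inter> \<eta> -` (- {0})"
      have W: "open W" unfolding W_def
        by (rule continuous_open_preimage[OF continuous_on_subset[OF smooth_map_on_imp_continuous_on[OF open_UNIV \<eta>s]] U]) auto
      have "smooth_map_on (atlas A) W (\<lambda>q. inverse (\<eta> q) *\<^sub>R F e q)"
        by (rule smooth_map_on_scaleR[OF W smooth_map_on_inverse[OF W smooth_map_on_subset[OF \<eta>s]]
              smooth_funsD[OF smooth[OF e]]]) (auto simp: W_def)
      then have "smooth_map_on (atlas A) W (\<lambda>q. \<gamma> q (const_sec A \<phi> w q))"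
      proof (rule smooth_map_on_cong[OF _ W])
        fix q assume "q \<in> W"
        then have q: "q \<in> U" "\<eta> q \<noteq> 0" by (auto simp: W_def)
        have "F e q = \<eta> q *\<^sub>R \<gamma> q (const_sec A \<phi> w q)"
          using \<gamma>[OF e, of q] lin_onD(2)[OF lin const_sec_in_fibre[OF t q(1)]] by (simp add: e_def)
        then show "inverse (\<eta> q) *\<^sub>R F e q = \<gamma> q (const_sec A \<phi> w q)" using q(2) by simp
      qed
      then show "\<exists>V. open V \<and> p \<in> V \<and> smooth_map_on (atlas A) V (\<lambda>p. \<gamma> p (const_sec A \<phi> w p))"
        using W p \<eta>(2) unfolding W_def by (intro exI[of _ W]) (auto simp: W_def)
    qed
  qed
  moreover have "pair \<gamma> y = F y" if "y \<in> sections A" for y using \<gamma>[OF that] by (auto simp: pair_def)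
  ultimately show ?thesis by (rule that)
qed

text \<open>This justifies the definite description: existence is the representation just obtained,
  and uniqueness holds because sections pass through every fibre vector.\<close>

lemma dual_sec_of_tensorial:
  shows "dual_sec_of A F \<in> dual_sections A" and "y \<in> sections A \<Longrightarrow> pair (dual_sec_of A F) y = F y"
proof -
  obtain \<gamma> where \<gamma>: "\<gamma> \<in> dual_sections A" "\<And>y. y \<in> sections A \<Longrightarrow> pair \<gamma> y = F y"
    using tensorial_dual_section by blast
  have "dual_sec_of A F \<in> dual_sections A \<and> (\<forall>y\<in>sections A. pair (dual_sec_of A F) y = F y)"
    unfolding dual_sec_of_def
  proof (rule theI[of _ \<gamma>])
    fix \<beta> assume "\<beta> \<in> dual_sections A \<and> (\<forall>y\<in>sections A. pair \<beta> y = F y)"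
    with \<gamma> show "\<beta> = \<gamma>" by (intro dual_section_eqI dual_sections_fibre) auto
  qed (use \<gamma> in auto)
  then show "dual_sec_of A F \<in> dual_sections A" "y \<in> sections A \<Longrightarrow> pair (dual_sec_of A F) y = F y"
    by auto
qed

end

section \<open>The sharp map of a symmetric tensor\<close>

lemma dual_fibre_separates:
  assumes "v \<in> fibre A p" "w \<in> fibre A p" "\<And>\<beta>. \<beta> \<in> dual_fibre A p \<Longrightarrow> \<beta> v = \<beta> w"
  shows "v = w"
proof -
  obtain U \<phi> where t: "(U, \<phi>) \<in> trivs A" "p \<in> U" using triv_exists by blast
  have c: "coord b (\<phi> p v) = coord b (\<phi> p w)" for b
    using assms(3)[OF const_cosec_in_dual_fibre[OF t linear_coord[of b]]] assms(1,2)
    by (simp add: const_cosec_def)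
  have "\<phi> p v = (\<Sum>b\<in>fbasis. coord b (\<phi> p v) *\<^sub>R b)"
    by (rule sum_coord[OF finite_dim_fibre, symmetric])
  also have "\<dots> = \<phi> p w" unfolding c by (rule sum_coord[OF finite_dim_fibre])
  finally have "\<phi> p v = \<phi> p w" .
  then show ?thesis using triv_eqD[OF t assms(1,2)] by blast
qed

lemma sharp_eqI:
  assumes "v \<in> fibre A p" "\<And>\<beta>. \<beta> \<in> dual_fibre A p \<Longrightarrow> \<beta> v = H p \<alpha> \<beta>"
  shows "sharp A H p \<alpha> = v"
  unfolding sharp_def
proof (rule the_equality)
  fix w assume "w \<in> fibre A p \<and> (\<forall>\<beta>\<in>dual_fibre A p. \<beta> w = H p \<alpha> \<beta>)"
  then show "w = v" using assms by (intro dual_fibre_separates) auto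
qed (use assms in auto)

lemma dual_fibre_subspace:
  shows "(\<lambda>v. 0) \<in> dual_fibre A p"
    and "\<alpha> \<in> dual_fibre A p \<Longrightarrow> \<beta> \<in> dual_fibre A p \<Longrightarrow> (\<lambda>v. \<alpha> v + \<beta> v) \<in> dual_fibre A p"
    and "\<alpha> \<in> dual_fibre A p \<Longrightarrow> (\<lambda>v. c * \<alpha> v) \<in> dual_fibre A p"
  by (auto simp: dual_fibre_def lin_on_def algebra_simps)

context
  fixes H
  assumes H: "H \<in> Sym2 A"
begin

lemma Sym2_sym: "\<alpha> \<in> dual_fibre A p \<Longrightarrow> \<beta> \<in> dual_fibre A p \<Longrightarrow> H p \<alpha> \<beta> = H p \<beta> \<alpha>"
  using H by (simp add: Sym2_def)

lemma Sym2_linear: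
  assumes "\<alpha> \<in> dual_fibre A p" "\<beta> \<in> dual_fibre A p" "\<gamma> \<in> dual_fibre A p"
  shows "H p (\<lambda>v. \<alpha> v + \<beta> v) \<gamma> = H p \<alpha> \<gamma> + H p \<beta> \<gamma>" "H p (\<lambda>v. c * \<alpha> v) \<gamma> = c * H p \<alpha> \<gamma>"
  using H assms unfolding Sym2_def by blast+

lemma Sym2_smooth:
  assumes "(U, \<phi>) \<in> trivs A" "linear u" "linear w"
  shows "smooth_map_on (atlas A) U (\<lambda>p. H p (const_cosec A \<phi> u p) (const_cosec A \<phi> w p))"
proof -
  have "\<forall>(U, \<phi>)\<in>trivs A. \<forall>u w. linear u \<longrightarrow> linear w \<longrightarrow>
        smooth_map_on (atlas A) U (\<lambda>p. H p (const_cosec A \<phi> u p) (const_cosec A \<phi> w p))"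
    using H unfolding Sym2_def by (elim CollectE conjE)
  from bspec[OF this assms(1)] show ?thesis using assms by simp
qed

lemma Sym2_sum:
  assumes "\<And>i. i \<in> I \<Longrightarrow> \<alpha> i \<in> dual_fibre A p" "\<gamma> \<in> dual_fibre A p"
  shows "(\<lambda>v. \<Sum>i\<in>I. c i * \<alpha> i v) \<in> dual_fibre A p \<and>
    H p (\<lambda>v. \<Sum>i\<in>I. c i * \<alpha> i v) \<gamma> = (\<Sum>i\<in>I. c i * H p (\<alpha> i) \<gamma>)"
  using assms(1)
proof (induction I rule: infinite_finite_induct)
  case (infinite I)
  then show ?case using Sym2_linear(2)[OF dual_fibre_subspace(1,1) assms(2), of 0] by (simp add: dual_fibre_subspace)
next
  case empty
  then show ?case using Sym2_linear(2)[OF dual_fibre_subspace(1,1) assms(2), of 0] by (simp add: dual_fibre_subspace)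
next
  case (insert i I)
  then show ?case
    using Sym2_linear(1)[OF dual_fibre_subspace(3) _ assms(2), of "\<alpha> i" "\<lambda>v. \<Sum>i\<in>I. c i * \<alpha> i v" "c i"]
      Sym2_linear(2)[OF _ _ assms(2), of "\<alpha> i" "\<alpha> i" "c i"]
    by (simp add: dual_fibre_subspace)
qed

lemma Sym2_expansion:
  assumes t: "(U, \<phi>) \<in> trivs A" "p \<in> U" and "\<alpha> \<in> dual_fibre A p" "\<gamma> \<in> dual_fibre A p"
  shows "H p \<alpha> \<gamma> = (\<Sum>b\<in>fbasis. \<alpha> (const_sec A \<phi> b p) * H p (const_cosec A \<phi> (coord b) p) \<gamma>)"
proof -
  have "H p \<alpha> \<gamma> = H p (\<lambda>v. \<Sum>b\<in>fbasis. \<alpha> (const_sec A \<phi> b p) * const_cosec A \<phi> (coord b) p v) \<gamma>"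
    using dual_fibre_expansion[OF t assms(3)] by simp
  also have "\<dots> = (\<Sum>b\<in>fbasis. \<alpha> (const_sec A \<phi> b p) * H p (const_cosec A \<phi> (coord b) p) \<gamma>)"
    by (rule Sym2_sum[of fbasis "\<lambda>b. const_cosec A \<phi> (coord b) p" p \<gamma>
          "\<lambda>b. \<alpha> (const_sec A \<phi> b p)", THEN conjunct2])
      (rule const_cosec_in_dual_fibre[OF t linear_coord] assms(4))+
  finally show ?thesis .
qed

text \<open>The vector whose frame components are the values of \<open>H p \<alpha>\<close> on the
  dual frame represents the functional \<open>H p \<alpha>\<close>. Covectors separate the points of
  a fibre, so it is the vector described by \<open>sharp\<close>.\<close>

lemma
  assumes \<alpha>: "\<alpha> \<in> dual_fibre A p"
  shows sharp_in_fibre: "sharp A H p \<alpha> \<in> fibre A p"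
    and sharp_pairing: "\<beta> \<in> dual_fibre A p \<Longrightarrow> \<beta> (sharp A H p \<alpha>) = H p \<alpha> \<beta>"
proof -
  obtain U \<phi> where t: "(U, \<phi>) \<in> trivs A" "p \<in> U" using triv_exists by blast
  define v where "v = (\<Sum>b\<in>fbasis. H p \<alpha> (const_cosec A \<phi> (coord b) p) *\<^sub>R const_sec A \<phi> b p)"
  note cs = const_sec_in_fibre[OF t] and cc = const_cosec_in_dual_fibre[OF t linear_coord]
  have v: "v \<in> fibre A p" unfolding v_def by (intro fibre_ops cs)
  have "\<beta> v = H p \<alpha> \<beta>" if \<beta>: "\<beta> \<in> dual_fibre A p" for \<beta>
  proof -
    have "\<beta> v = (\<Sum>b\<in>fbasis. H p \<alpha> (const_cosec A \<phi> (coord b) p) *\<^sub>R \<beta> (const_sec A \<phi> b p))"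
      unfolding v_def by (rule lin_on_sum[OF dual_fibre_lin_on[OF \<beta>] subspace_fibre cs])
    also have "\<dots> = (\<Sum>b\<in>fbasis. \<beta> (const_sec A \<phi> b p) * H p (const_cosec A \<phi> (coord b) p) \<alpha>)"
      by (simp add: Sym2_sym[OF \<alpha> cc] mult.commute)
    also have "\<dots> = H p \<alpha> \<beta>"
      using Sym2_expansion[OF t \<beta> \<alpha>] Sym2_sym[OF \<alpha> \<beta>] by simp
    finally show ?thesis .
  qed
  with v have "sharp A H p \<alpha> = v" by (rule sharp_eqI)
  with v \<open>\<And>\<beta>. \<beta> \<in> dual_fibre A p \<Longrightarrow> \<beta> v = H p \<alpha> \<beta>\<close>
  show "sharp A H p \<alpha> \<in> fibre A p" "\<beta> \<in> dual_fibre A p \<Longrightarrow> \<beta> (sharp A H p \<alpha>) = H p \<alpha> \<beta>" by auto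
qed

text \<open>The hypotheses concern a single trivialising set, so that the result applies to
  covectors constant in a trivialisation as well as to global dual sections.\<close>

lemma sharp_smooth:
  assumes t: "(U, \<phi>) \<in> trivs A" and \<alpha>: "\<And>p. p \<in> U \<Longrightarrow> \<alpha> p \<in> dual_fibre A p"
    and s: "\<And>w. smooth_map_on (atlas A) U (\<lambda>p. \<alpha> p (const_sec A \<phi> w p))"
  shows "smooth_map_on (atlas A) U (\<lambda>p. \<phi> p (sharp A H p (\<alpha> p)))"
proof -
  note U = triv_open[OF t]
  let ?h = "\<lambda>b p. \<Sum>c\<in>fbasis. \<alpha> p (const_sec A \<phi> c p) *\<^sub>R
    H p (const_cosec A \<phi> (coord c) p) (const_cosec A \<phi> (coord b) p)"
  have "smooth_map_on (atlas A) U (\<lambda>p. \<Sum>b\<in>fbasis. ?h b p *\<^sub>R b)"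
    by (rule smooth_map_on_sum[OF U], rule smooth_map_on_scaleR[OF U _ smooth_map_on_const],
        rule smooth_map_on_sum[OF U], rule smooth_map_on_scaleR[OF U s Sym2_smooth[OF t linear_coord linear_coord]])
  then show ?thesis
  proof (rule smooth_map_on_cong[OF _ U])
    fix p assume p: "p \<in> U"
    note cc = const_cosec_in_dual_fibre[OF t p linear_coord]
    have "coord b (\<phi> p (sharp A H p (\<alpha> p))) = ?h b p" for b
      using sharp_pairing[OF \<alpha>[OF p] cc[of b]] Sym2_expansion[OF t p \<alpha>[OF p] cc[of b]]
        sharp_in_fibre[OF \<alpha>[OF p]] by (simp add: const_cosec_def)
    then show "(\<Sum>b\<in>fbasis. ?h b p *\<^sub>R b) = \<phi> p (sharp A H p (\<alpha> p))"
      using sum_coord[OF finite_dim_fibre, of "\<phi> p (sharp A H p (\<alpha> p))"] by simp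
  qed
qed

lemma sharp_section:
  assumes "\<alpha> \<in> dual_sections A"
  shows "app (sharp A H) \<alpha> \<in> sections A"
  unfolding app_def
  by (intro sectionsI sharp_smooth sharp_in_fibre dual_sections_fibre dual_sections_smooth assms)

lemma pair_sharp:
  assumes "\<alpha> \<in> dual_sections A" "\<beta> \<in> dual_sections A"
  shows "pair \<beta> (app (sharp A H) \<alpha>) = (\<lambda>p. H p (\<alpha> p) (\<beta> p))"
  using sharp_pairing[OF dual_sections_fibre[OF assms(1)] dual_sections_fibre[OF assms(2)]]
  by (auto simp: pair_def app_def)

end

section \<open>Bundle endomorphisms and their dual maps\<close>

context
  fixes N
  assumes N: "bundle_endo A N"
begin

lemma endo_lin_on: "lin_on (fibre A p) (N p)"
  and endo_fibre: "v \<in> fibre A p \<Longrightarrow> N p v \<in> fibre A p"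
  using N by (auto simp: bundle_endo_def)

lemma endo_smooth_const_sec:
  assumes t: "(U, \<phi>) \<in> trivs A"
  shows "smooth_map_on (atlas A) U (\<lambda>p. \<phi> p (N p (const_sec A \<phi> w p)))"
proof -
  have "\<forall>(U, \<phi>)\<in>trivs A. \<forall>(V, \<psi>)\<in>trivs A. \<forall>w.
        smooth_map_on (atlas A) (U \<inter> V) (\<lambda>p. \<psi> p (N p (const_sec A \<phi> w p)))"
    using N unfolding bundle_endo_def by (elim conjE)
  from bspec[OF this assms(1)] have "\<forall>(V, \<psi>)\<in>trivs A. \<forall>w.
        smooth_map_on (atlas A) (U \<inter> V) (\<lambda>p. \<psi> p (N p (const_sec A \<phi> w p)))" by simp
  from bspec[OF this assms(1)] show ?thesis by simp
qed

lemma endo_smooth: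
  assumes t: "(U, \<phi>) \<in> trivs A" and x: "\<And>p. p \<in> U \<Longrightarrow> x p \<in> fibre A p"
    and s: "smooth_map_on (atlas A) U (\<lambda>p. \<phi> p (x p))"
  shows "smooth_map_on (atlas A) U (\<lambda>p. \<phi> p (N p (x p)))"
proof (rule smooth_map_on_lin_on_app[where g = "\<lambda>p v. \<phi> p (N p v)",
      OF t triv_open[OF t] order.refl _ endo_smooth_const_sec[OF t] x s])
  fix p assume p: "p \<in> U"
  show "lin_on (fibre A p) (\<lambda>v. \<phi> p (N p v))"
    using lin_onD[OF endo_lin_on, of _ p] lin_onD[OF triv_lin_on[OF t p]] endo_fibre
    by (simp add: lin_on_def)
qed

lemma endo_section:
  assumes x: "x \<in> sections A"
  shows "app N x \<in> sections A"
  unfolding app_def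
proof (rule sectionsI)
  show "N p (x p) \<in> fibre A p" for p by (rule endo_fibre[OF sections_fibre[OF x]])
  show "smooth_map_on (atlas A) U (\<lambda>p. \<phi> p (N p (x p)))" if t: "(U, \<phi>) \<in> trivs A" for U \<phi>
    by (rule endo_smooth[OF t sections_fibre[OF x] sections_smooth[OF x t]])
qed

lemma dual_map_fibre: "\<alpha> \<in> dual_fibre A p \<Longrightarrow> dual_map A N p \<alpha> \<in> dual_fibre A p"
  using lin_onD[OF endo_lin_on, of _ p] endo_fibre
  by (simp add: dual_fibre_def dual_map_def lin_on_def fibre_ops)

lemma dual_map_section:
  assumes \<alpha>: "\<alpha> \<in> dual_sections A"
  shows "app (dual_map A N) \<alpha> \<in> dual_sections A"
proof (rule dual_sectionsI)
  show "app (dual_map A N) \<alpha> p \<in> dual_fibre A p" for p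
    by (simp add: app_def dual_map_fibre dual_sections_fibre[OF \<alpha>])
  fix U \<phi> w assume t: "(U, \<phi>) \<in> trivs A"
  have "smooth_map_on (atlas A) U (\<lambda>p. \<alpha> p (N p (const_sec A \<phi> w p)))"
    by (rule smooth_map_on_lin_on_app[OF t triv_open[OF t] order.refl dual_sections_lin_on[OF \<alpha>]
          dual_sections_smooth[OF \<alpha> t] _ endo_smooth_const_sec[OF t]])
      (use endo_fibre const_sec_in_fibre[OF t] in auto)
  then show "smooth_map_on (atlas A) U (\<lambda>p. app (dual_map A N) \<alpha> p (const_sec A \<phi> w p))"
    by (rule smooth_map_on_cong[OF _ triv_open[OF t]])
      (use const_sec_in_fibre[OF t] in \<open>simp add: app_def dual_map_def\<close>)
qed

lemma pair_dual_map: "x \<in> sections A \<Longrightarrow> pair (app (dual_map A N) \<alpha>) x = pair \<alpha> (app N x)"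
  using sections_fibre by (auto simp: pair_def app_def dual_map_def)

end

end


section \<open>Algebroids\<close>

text \<open>
  Left symmetry is left out: the deformed algebroid then satisfies these axioms without
  using the Nijenhuis identity.
\<close>

locale anchored_bundle = vbundle A
  for A :: "('m::{t2_space,second_countable_topology}, 'e::real_normed_vector, 'v::real_vector,
    'f::real_normed_vector, 'z) lsa_scheme" +
  assumes anchor_map: "anchor_map A"
    and mul_section: "\<And>x y. x \<in> sections A \<Longrightarrow> y \<in> sections A \<Longrightarrow> mul A x y \<in> sections A"
    and mul_add_left: "\<And>x y z. x \<in> sections A \<Longrightarrow> y \<in> sections A \<Longrightarrow> z \<in> sections A \<Longrightarrow>
      mul A (\<lambda>p. x p + y p) z = (\<lambda>p. mul A x z p + mul A y z p)"
    and mul_add_right: "\<And>x y z. x \<in> sections A \<Longrightarrow> y \<in> sections A \<Longrightarrow> z \<in> sections A \<Longrightarrow>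
      mul A x (\<lambda>p. y p + z p) = (\<lambda>p. mul A x y p + mul A x z p)"
    and mul_scale_left: "\<And>f x y. f \<in> smooth_funs A \<Longrightarrow> x \<in> sections A \<Longrightarrow> y \<in> sections A \<Longrightarrow>
      mul A (\<lambda>p. f p *\<^sub>R x p) y = (\<lambda>p. f p *\<^sub>R mul A x y p)"
    and mul_scale_right: "\<And>f x y. f \<in> smooth_funs A \<Longrightarrow> x \<in> sections A \<Longrightarrow> y \<in> sections A \<Longrightarrow>
      mul A x (\<lambda>p. f p *\<^sub>R y p) = (\<lambda>p. f p *\<^sub>R mul A x y p + rho A x f p *\<^sub>R y p)"
begin

section \<open>Sections acting on functions through the anchor\<close>

lemma anchor_tangent: "v \<in> fibre A p \<Longrightarrow> anchor A p v \<in> tangent_space (atlas A) p"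
  and anchor_lin_on: "lin_on (fibre A p) (\<lambda>v. anchor A p v \<kappa>)"
  using anchor_map by (auto simp: anchor_map_def simp del: split_paired_All)

lemma anchor_smooth_const_sec:
  assumes t: "(U, \<phi>) \<in> trivs A" and d: "(V, d) \<in> atlas A"
  shows "smooth_map_on (atlas A) (U \<inter> V) (\<lambda>p. anchor A p (const_sec A \<phi> w p) (V, d))"
proof -
  have "\<forall>(U, \<phi>)\<in>trivs A. \<forall>(V, c)\<in>atlas A. \<forall>w.
        smooth_map_on (atlas A) (U \<inter> V) (\<lambda>p. anchor A p (const_sec A \<phi> w p) (V, c))"
    using anchor_map unfolding anchor_map_def by (elim conjE)
  from bspec[OF this t] have "\<forall>(V, c)\<in>atlas A. \<forall>w.
        smooth_map_on (atlas A) (U \<inter> V) (\<lambda>p. anchor A p (const_sec A \<phi> w p) (V, c))" by simp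
  from bspec[OF this d] show ?thesis by simp
qed

lemma anchor_smooth:
  assumes x: "x \<in> sections A" and d: "(V, d) \<in> atlas A"
  shows "smooth_map_on (atlas A) V (\<lambda>p. anchor A p (x p) (V, d))"
proof (rule smooth_map_on_local)
  fix p assume p: "p \<in> V"
  obtain U \<phi> where t: "(U, \<phi>) \<in> trivs A" "p \<in> U" using triv_exists by blast
  have o: "open (U \<inter> V)" using triv_open[OF t(1)] chart_open[OF d] by blast
  have "smooth_map_on (atlas A) (U \<inter> V) (\<lambda>p. anchor A p (x p) (V, d))"
    by (rule smooth_map_on_lin_on_app[where g = "\<lambda>p v. anchor A p v (V, d)",
          OF t(1) o _ anchor_lin_on anchor_smooth_const_sec[OF t(1) d] sections_fibre[OF x] smooth_map_on_subset[OF sections_smooth[OF x t(1)]]]) auto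
  then show "\<exists>W. open W \<and> p \<in> W \<and> smooth_map_on (atlas A) W (\<lambda>p. anchor A p (x p) (V, d))"
    using o p t(2) by blast
qed

lemma rho_smooth:
  assumes "x \<in> sections A" "f \<in> smooth_funs A"
  shows "rho A x f \<in> smooth_funs A"
  unfolding rho_def
  by (rule smooth_funsI, rule smooth_tangent_deriv[OF smooth_funsD[OF assms(2)]
        anchor_tangent[OF sections_fibre[OF assms(1)]] anchor_smooth[OF assms(1)]])

lemma rho_mult:
  assumes "x \<in> sections A" "f \<in> smooth_funs A" "g \<in> smooth_funs A"
  shows "rho A x (\<lambda>p. f p * g p) p = f p * rho A x g p + rho A x f p * g p"
  unfolding rho_def
  by (rule tangent_deriv_mult[OF smooth_funsD[OF assms(2)] smooth_funsD[OF assms(3)]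
        anchor_tangent[OF sections_fibre[OF assms(1)]]])

lemma rho_add:
  assumes "x \<in> sections A" "f \<in> smooth_funs A" "g \<in> smooth_funs A"
  shows "rho A x (\<lambda>p. f p + g p) p = rho A x f p + rho A x g p"
  unfolding rho_def
  by (rule tangent_deriv_add[OF smooth_funsD[OF assms(2)] smooth_funsD[OF assms(3)]
        anchor_tangent[OF sections_fibre[OF assms(1)]]])

lemma rho_linear:
  assumes "x \<in> sections A" "y \<in> sections A" "f \<in> smooth_funs A"
  shows "rho A (\<lambda>p. k p *\<^sub>R x p + y p) f p = k p * rho A x f p + rho A y f p"
  unfolding rho_def
proof (rule tangent_deriv_linear[OF smooth_funsD[OF assms(3)]])
  note x = sections_fibre[OF assms(1), of p] and y = sections_fibre[OF assms(2), of p]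
  show "anchor A p (x p) \<in> tangent_space (atlas A) p" "anchor A p (y p) \<in> tangent_space (atlas A) p"
    "anchor A p (k p *\<^sub>R x p + y p) \<in> tangent_space (atlas A) p"
    by (intro anchor_tangent fibre_ops x y)+
  show "anchor A p (k p *\<^sub>R x p + y p) \<kappa> = k p *\<^sub>R anchor A p (x p) \<kappa> + anchor A p (y p) \<kappa>" for \<kappa>
    using x y lin_onD[OF anchor_lin_on] by (simp add: fibre_ops)
qed

section \<open>Pairings with the operations on dual sections\<close>

lemma pair_add: "\<alpha> \<in> dual_sections A \<Longrightarrow> y \<in> sections A \<Longrightarrow> z \<in> sections A \<Longrightarrow>
    pair \<alpha> (\<lambda>p. y p + z p) = (\<lambda>p. pair \<alpha> y p + pair \<alpha> z p)"
  by (simp add: pair_def lin_onD(1)[OF dual_sections_lin_on] sections_fibre)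

lemma pair_scale: "\<alpha> \<in> dual_sections A \<Longrightarrow> y \<in> sections A \<Longrightarrow>
    pair \<alpha> (\<lambda>p. f p *\<^sub>R y p) = (\<lambda>p. f p * pair \<alpha> y p)"
  by (simp add: pair_def lin_onD(2)[OF dual_sections_lin_on] sections_fibre)

lemma pair_diff: "\<alpha> \<in> dual_sections A \<Longrightarrow> y \<in> sections A \<Longrightarrow> z \<in> sections A \<Longrightarrow>
    pair \<alpha> (\<lambda>p. y p - z p) = (\<lambda>p. pair \<alpha> y p - pair \<alpha> z p)"
  by (simp add: pair_def lin_on_diff[OF dual_sections_lin_on subspace_fibre] sections_fibre)

lemma bracket_section: "x \<in> sections A \<Longrightarrow> y \<in> sections A \<Longrightarrow> bracket A x y \<in> sections A"
  unfolding bracket_def by (intro sections_diff mul_section)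

lemma pair_bracket: "\<alpha> \<in> dual_sections A \<Longrightarrow> x \<in> sections A \<Longrightarrow> y \<in> sections A \<Longrightarrow>
    pair \<alpha> (bracket A x y) = (\<lambda>p. pair \<alpha> (mul A x y) p - pair \<alpha> (mul A y x) p)"
  unfolding bracket_def by (simp add: pair_diff mul_section)

text \<open>The defining functional is tensorial: when \<open>y\<close> is multiplied by
  \<open>f\<close>, the derivative of \<open>f\<close> arises once from the Leibniz rule of the
  anchor and once from the bracket, and the two terms cancel.\<close>

lemma pair_lie_der:
  assumes x: "x \<in> sections A" and \<alpha>: "\<alpha> \<in> dual_sections A" and y: "y \<in> sections A"
  shows "pair (lie_der A x \<alpha>) y = (\<lambda>p. rho A x (pair \<alpha> y) p - pair \<alpha> (bracket A x y) p)"
  unfolding lie_der_def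
proof (rule dual_sec_of_tensorial(2)[OF _ _ _ y])
  fix y z assume yz: "y \<in> sections A" "z \<in> sections A"
  show "(\<lambda>p. rho A x (pair \<alpha> (\<lambda>p. y p + z p)) p - pair \<alpha> (bracket A x (\<lambda>p. y p + z p)) p) =
    (\<lambda>p. rho A x (pair \<alpha> y) p - pair \<alpha> (bracket A x y) p + (rho A x (pair \<alpha> z) p - pair \<alpha> (bracket A x z) p))"
    by (simp add: pair_bracket pair_add sections_add mul_add_left mul_add_right mul_section rho_add pair_smooth \<alpha> x yz
        fun_eq_iff algebra_simps)
next
  fix f y assume f: "f \<in> smooth_funs A" and y: "y \<in> sections A"
  have "pair \<alpha> (mul A x (\<lambda>p. f p *\<^sub>R y p)) = (\<lambda>p. f p * pair \<alpha> (mul A x y) p + rho A x f p * pair \<alpha> y p)"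
    by (simp add: mul_scale_right pair_add pair_scale sections_scale mul_section rho_smooth f x y \<alpha>)
  then show "(\<lambda>p. rho A x (pair \<alpha> (\<lambda>p. f p *\<^sub>R y p)) p - pair \<alpha> (bracket A x (\<lambda>p. f p *\<^sub>R y p)) p) =
    (\<lambda>p. f p * (rho A x (pair \<alpha> y) p - pair \<alpha> (bracket A x y) p))"
    by (simp add: pair_bracket pair_scale sections_scale mul_scale_left mul_section rho_mult pair_smooth
        \<alpha> x y f algebra_simps)
next
  fix y assume y: "y \<in> sections A"
  show "(\<lambda>p. rho A x (pair \<alpha> y) p - pair \<alpha> (bracket A x y) p) \<in> smooth_funs A"
    by (intro smooth_funs_diff rho_smooth pair_smooth bracket_section x y \<alpha>)
qed

text \<open>Tensoriality is immediate here because \<open>y\<close> occupies the left slot of the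
  product, which is linear over functions.\<close>

lemma pair_right_der:
  assumes x: "x \<in> sections A" and \<alpha>: "\<alpha> \<in> dual_sections A" and y: "y \<in> sections A"
  shows "pair (right_der A x \<alpha>) y = (\<lambda>p. - pair \<alpha> (mul A y x) p)"
  unfolding right_der_def
proof (rule dual_sec_of_tensorial(2)[OF _ _ _ y])
  fix y z assume yz: "y \<in> sections A" "z \<in> sections A"
  show "(\<lambda>p. - pair \<alpha> (mul A (\<lambda>p. y p + z p) x) p) =
    (\<lambda>p. - pair \<alpha> (mul A y x) p + - pair \<alpha> (mul A z x) p)"
    by (simp add: pair_add mul_add_left mul_section \<alpha> x yz)
next
  fix f y assume f: "f \<in> smooth_funs A" and y: "y \<in> sections A"
  show "(\<lambda>p. - pair \<alpha> (mul A (\<lambda>p. f p *\<^sub>R y p) x) p) = (\<lambda>p. f p * - pair \<alpha> (mul A y x) p)"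
    by (simp add: pair_scale mul_scale_left mul_section f x y \<alpha>)
next
  fix y assume y: "y \<in> sections A"
  show "(\<lambda>p. - pair \<alpha> (mul A y x) p) \<in> smooth_funs A"
    by (intro smooth_funs_minus pair_smooth mul_section x y \<alpha>)
qed

lemma pair_ext_d:
  assumes f: "f \<in> smooth_funs A" and y: "y \<in> sections A"
  shows "pair (ext_d A f) y = rho A y f"
  unfolding ext_d_def
proof (rule dual_sec_of_tensorial(2)[OF _ _ _ y])
  fix y z assume yz: "y \<in> sections A" "z \<in> sections A"
  show "rho A (\<lambda>p. y p + z p) f = (\<lambda>p. rho A y f p + rho A z f p)"
    using rho_linear[OF yz f, of "\<lambda>p. 1"] by auto
next
  fix g y assume g: "g \<in> smooth_funs A" and y: "y \<in> sections A"
  note z = sections_scale_const[OF y, of 0]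
  \<comment> \<open>Adding the zero section to itself shows that it acts as twice itself, hence as
    0; with zero as second summand, \<open>rho_linear\<close> becomes the scaling rule.\<close>
  have "rho A (\<lambda>p. 0 *\<^sub>R y p) f p = 0" for p
    using rho_linear[OF z z f, of "\<lambda>p. 1"] by simp
  then show "rho A (\<lambda>p. g p *\<^sub>R y p) f = (\<lambda>p. g p * rho A y f p)"
    using rho_linear[OF y z f, of g] by auto
next
  fix y assume y: "y \<in> sections A"
  show "rho A y f \<in> smooth_funs A" by (rule rho_smooth[OF y f])
qed

text \<open>The only access to the product on dual sections. As it holds in every anchored bundle,
  it evaluates the star product too, by way of the deformed bundle.\<close>

lemma pair_dual_mul:
  assumes H: "H \<in> Sym2 A" and \<alpha>: "\<alpha> \<in> dual_sections A" and \<beta>: "\<beta> \<in> dual_sections A"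
    and y: "y \<in> sections A"
  shows "pair (dual_mul A H \<alpha> \<beta>) y p =
    rho A (app (sharp A H) \<alpha>) (pair \<beta> y) p - pair \<beta> (bracket A (app (sharp A H) \<alpha>) y) p
    + pair \<alpha> (mul A y (app (sharp A H) \<beta>)) p - rho A y (pair \<beta> (app (sharp A H) \<alpha>)) p"
proof -
  note s = sharp_section[OF H]
  have h: "(\<lambda>q. H q (\<alpha> q) (\<beta> q)) = pair \<beta> (app (sharp A H) \<alpha>)"
    using pair_sharp[OF H \<alpha> \<beta>] by simp
  have "pair (dual_mul A H \<alpha> \<beta>) y p = pair (lie_der A (app (sharp A H) \<alpha>) \<beta>) y p
     - pair (right_der A (app (sharp A H) \<beta>) \<alpha>) y p - pair (ext_d A (pair \<beta> (app (sharp A H) \<alpha>))) y p"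
    unfolding dual_mul_def h by (simp add: pair_def)
  then show ?thesis
    using pair_lie_der[OF s[OF \<alpha>] \<beta> y] pair_right_der[OF s[OF \<beta>] \<alpha> y]
      pair_ext_d[OF pair_smooth[OF \<beta> s[OF \<alpha>]] y] by simp
qed

lemma app_add:
  assumes "bundle_endo A N" "x \<in> sections A" "y \<in> sections A"
  shows "app N (\<lambda>p. x p + y p) = (\<lambda>p. app N x p + app N y p)"
  using lin_onD(1)[OF endo_lin_on[OF assms(1)]] assms(2,3) by (simp add: app_def sections_fibre)

lemma app_diff:
  assumes "bundle_endo A N" "x \<in> sections A" "y \<in> sections A"
  shows "app N (\<lambda>p. x p - y p) = (\<lambda>p. app N x p - app N y p)"
  using lin_on_diff[OF endo_lin_on[OF assms(1)] subspace_fibre] assms(2,3) by (simp add: app_def sections_fibre)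

lemma app_scale:
  assumes "bundle_endo A N" "x \<in> sections A"
  shows "app N (\<lambda>p. f p *\<^sub>R x p) = (\<lambda>p. f p *\<^sub>R app N x p)"
  using lin_onD(2)[OF endo_lin_on[OF assms(1)]] assms(2) by (simp add: app_def sections_fibre)

end

section \<open>The deformed algebroid as an anchored bundle\<close>

lemma deformed_simps [simp]:
  "atlas (deformed A N) = atlas A" "fibre (deformed A N) = fibre A" "trivs (deformed A N) = trivs A"
  "anchor (deformed A N) = (\<lambda>p v. anchor A p (N p v))"
  "mul (deformed A N) = (\<lambda>x y p. mul A (app N x) y p + mul A x (app N y) p - app N (mul A x y) p)"
  by (simp_all add: deformed_def)

lemma deformed_bundle [simp]:
  "const_sec (deformed A N) = const_sec A" "const_cosec (deformed A N) = const_cosec A"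
  "sections (deformed A N) = sections A" "dual_fibre (deformed A N) = dual_fibre A"
  "dual_sections (deformed A N) = dual_sections A" "smooth_funs (deformed A N) = smooth_funs A"
  "Sym2 (deformed A N) = Sym2 A" "sharp (deformed A N) = sharp A"
  "vector_bundle (deformed A N) = vector_bundle A"
proof -
  show cs: "const_sec (deformed A N) = const_sec A" "const_cosec (deformed A N) = const_cosec A"
    and df: "dual_fibre (deformed A N) = dual_fibre A"
    by (simp_all add: const_sec_def const_cosec_def dual_fibre_def fun_eq_iff)
  show "sections (deformed A N) = sections A" "smooth_funs (deformed A N) = smooth_funs A"
    by (simp_all add: sections_def smooth_funs_def)
  show "dual_sections (deformed A N) = dual_sections A" "Sym2 (deformed A N) = Sym2 A"
    "sharp (deformed A N) = sharp A" "vector_bundle (deformed A N) = vector_bundle A"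
    by (simp_all add: dual_sections_def Sym2_def sharp_def vector_bundle_def cs df fun_eq_iff)
qed

lemma rho_deformed: "rho (deformed A N) x f = rho A (app N x) f"
  by (simp add: rho_def app_def)

lemma (in anchored_bundle) deformed_anchored_bundle:
  assumes N: "bundle_endo A N"
  shows "anchored_bundle (deformed A N)"
proof unfold_locales
  note sec = mul_section endo_section[OF N] sections_add sections_diff sections_scale
  show "vector_bundle (deformed A N)" using vector_bundle by simp
  show "anchor_map (deformed A N)"
    unfolding anchor_map_def
  proof (intro conjI allI ballI, goal_cases)
    case (1 p v)
    then show ?case using anchor_tangent endo_fibre[OF N] by simp
  next
    case (2 p \<kappa>)
    show ?case
      using lin_onD[OF endo_lin_on[OF N], of _ p] lin_onD[OF anchor_lin_on, of _ p _ \<kappa>] endo_fibre[OF N]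
      by (simp add: lin_on_def)
  next
    case (3 \<tau>)
    obtain U \<phi> where \<tau>: "\<tau> = (U, \<phi>)" by force
    with 3 have t: "(U, \<phi>) \<in> trivs A" by simp
    have "smooth_map_on (atlas A) (U \<inter> V) (\<lambda>p. anchor A p (N p (const_sec A \<phi> w p)) (V, d))"
      if d: "(V, d) \<in> atlas A" for V d w
    proof -
      have o: "open (U \<inter> V)" using triv_open[OF t] chart_open[OF d] by blast
      show ?thesis
        by (rule smooth_map_on_lin_on_app[where g = "\<lambda>p v. anchor A p v (V, d)",
              OF t o _ anchor_lin_on anchor_smooth_const_sec[OF t d] _ smooth_map_on_subset[OF endo_smooth_const_sec[OF N t]]])
          (use endo_fibre[OF N] const_sec_in_fibre[OF t] in auto)
    qed
    then show ?case by (auto simp: \<tau>)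
  qed
  fix x y z f
  show "mul (deformed A N) x y \<in> sections (deformed A N)"
    if "x \<in> sections (deformed A N)" "y \<in> sections (deformed A N)"
    using that by (simp add: sec)
  show "mul (deformed A N) (\<lambda>p. x p + y p) z = (\<lambda>p. mul (deformed A N) x z p + mul (deformed A N) y z p)"
    if "x \<in> sections (deformed A N)" "y \<in> sections (deformed A N)" "z \<in> sections (deformed A N)"
    using that by (simp add: app_add[OF N] mul_add_left sec fun_eq_iff algebra_simps)
  show "mul (deformed A N) x (\<lambda>p. y p + z p) = (\<lambda>p. mul (deformed A N) x y p + mul (deformed A N) x z p)"
    if "x \<in> sections (deformed A N)" "y \<in> sections (deformed A N)" "z \<in> sections (deformed A N)"
    using that by (simp add: app_add[OF N] mul_add_right sec fun_eq_iff algebra_simps)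
  show "mul (deformed A N) (\<lambda>p. f p *\<^sub>R x p) y = (\<lambda>p. f p *\<^sub>R mul (deformed A N) x y p)"
    if "f \<in> smooth_funs (deformed A N)" "x \<in> sections (deformed A N)" "y \<in> sections (deformed A N)"
    using that by (simp add: app_scale[OF N] mul_scale_left sec fun_eq_iff algebra_simps)
  \<comment> \<open>Two derivative terms \<open>rho A x f\<close> times \<open>app N y\<close>
    appear, from the product with \<open>app N y\<close> and from \<open>app N\<close> of the
    product. They cancel, and what remains is the derivative along \<open>app N x\<close>, the
    deformed anchor.\<close>
  show "mul (deformed A N) x (\<lambda>p. f p *\<^sub>R y p) =
      (\<lambda>p. f p *\<^sub>R mul (deformed A N) x y p + rho (deformed A N) x f p *\<^sub>R y p)"
    if "f \<in> smooth_funs (deformed A N)" "x \<in> sections (deformed A N)" "y \<in> sections (deformed A N)"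
    using that
    by (simp add: app_scale[OF N] app_add[OF N] mul_scale_right sec rho_smooth rho_deformed fun_eq_iff algebra_simps)
qed

lemma left_symmetric_algebroid_anchored_bundle:
  assumes "left_symmetric_algebroid A"
  shows "anchored_bundle A"
  using assms unfolding left_symmetric_algebroid_def by unfold_locales blast+


section \<open>The hierarchy of a Koszul-Vinberg-Nijenhuis structure\<close>

locale kvn = anchored_bundle A
  for A :: "('m::{t2_space,second_countable_topology}, 'e::real_normed_vector, 'v::real_vector,
    'f::real_normed_vector, 'z) lsa_scheme" +
  fixes H N
  assumes KVN: "KVN_structure A H N"
begin

lemma H_Sym2: "H \<in> Sym2 A"
  and N_endo: "bundle_endo A N"
  and N_nijenhuis: "\<And>x y. x \<in> sections A \<Longrightarrow> y \<in> sections A \<Longrightarrow>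
        mul A (app N x) (app N y) =
        app N (\<lambda>p. mul A x (app N y) p + mul A (app N x) y p - app N (mul A x y) p)"
  and N_sharp: "\<And>p \<alpha>. \<alpha> \<in> dual_fibre A p \<Longrightarrow> N p (sharp A H p \<alpha>) = sharp A H p (dual_map A N p \<alpha>)"
  and star_eq: "\<And>\<alpha> \<beta>. \<alpha> \<in> dual_sections A \<Longrightarrow> \<beta> \<in> dual_sections A \<Longrightarrow>
    star_mul A N H \<alpha> \<beta> = dual_mul_deformed A N H \<alpha> \<beta>"
  and H_bracket: "KV_bracket_zero A H H"
  using KVN by (auto simp: KVN_structure_def koszul_vinberg_def nijenhuis_def)

abbreviation \<pi> where "\<pi> \<equiv> app (sharp A H)"
abbreviation \<nu> where "\<nu> \<equiv> app N"
abbreviation \<nu>' where "\<nu>' \<equiv> app (dual_map A N)"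

lemmas sec = mul_section bracket_section endo_section[OF N_endo] sharp_section[OF H_Sym2]
  dual_map_section[OF N_endo] sections_add sections_diff
lemmas \<nu>_add = app_add[OF N_endo] and \<nu>_diff = app_diff[OF N_endo]
lemmas pair_\<nu>' = pair_dual_map[OF N_endo]

lemma \<pi>_\<nu>': "\<alpha> \<in> dual_sections A \<Longrightarrow> \<pi> (\<nu>' \<alpha>) = \<nu> (\<pi> \<alpha>)"
  by (simp add: app_def N_sharp dual_sections_fibre)

lemma \<nu>_pow_sec: "x \<in> sections A \<Longrightarrow> (\<nu> ^^ k) x \<in> sections A"
  by (induction k) (auto intro: sec)

lemma \<nu>'_pow_sec: "\<alpha> \<in> dual_sections A \<Longrightarrow> (\<nu>' ^^ k) \<alpha> \<in> dual_sections A"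
  by (induction k) (auto intro: sec)

lemma \<pi>_\<nu>'_pow: "\<alpha> \<in> dual_sections A \<Longrightarrow> \<pi> ((\<nu>' ^^ k) \<alpha>) = (\<nu> ^^ k) (\<pi> \<alpha>)"
  by (induction k) (simp_all add: \<pi>_\<nu>' \<nu>'_pow_sec)

lemma pair_\<nu>'_pow: "x \<in> sections A \<Longrightarrow> pair ((\<nu>' ^^ k) \<alpha>) x = pair \<alpha> ((\<nu> ^^ k) x)"
proof (induction k arbitrary: x)
  case (Suc k)
  have "(\<nu> ^^ k) (\<nu> x) = \<nu> ((\<nu> ^^ k) x)" by (simp add: funpow_swap1)
  then show ?case using Suc.IH[of "\<nu> x"] Suc.prems by (simp add: pair_\<nu>' sec)
qed simp

text \<open>The condition \<open>\<lbrakk>H, H\<rbrakk> = 0\<close> says that \<open>H\<^sup>\<sharp>\<close> is multiplicative for the product on \<open>A\<^sup>*\<close>.\<close>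

lemma KV_identity:
  assumes "\<alpha> \<in> dual_sections A" "\<beta> \<in> dual_sections A" "\<gamma> \<in> dual_sections A"
  shows "rho A (\<pi> \<alpha>) (pair \<beta> (\<pi> \<gamma>)) p - pair \<beta> (bracket A (\<pi> \<alpha>) (\<pi> \<gamma>)) p
    + pair \<alpha> (mul A (\<pi> \<gamma>) (\<pi> \<beta>)) p - rho A (\<pi> \<gamma>) (pair \<beta> (\<pi> \<alpha>)) p
    - pair \<gamma> (mul A (\<pi> \<alpha>) (\<pi> \<beta>)) p = 0"
proof -
  \<comment> \<open>The slots are filled in the order \<alpha>, \<gamma>, \<beta>: the third slot of
    the bracket belongs to the second factor of the product, and \<gamma> only enters to test
    it.\<close>
  have "KV_bracket A H H \<alpha> \<gamma> \<beta> = (\<lambda>p. 0)"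
    using H_bracket assms unfolding KV_bracket_zero_def by blast
  from fun_cong[OF this, of p] show ?thesis
    by (simp add: KV_bracket_def KV_summand_def)
qed

text \<open>Both products are expanded by \<open>pair_dual_mul\<close>, the first one in the
  deformed bundle. Since \<open>\<pi>\<close> intertwines \<open>\<nu>'\<close> and
  \<open>\<nu>\<close>, the two derivatives along \<open>y\<close> coincide. The terms that do not
  cancel all occur twice, and the statement is half of the resulting difference.\<close>

lemma star_identity:
  assumes \<alpha>: "\<alpha> \<in> dual_sections A" and \<beta>: "\<beta> \<in> dual_sections A" and y: "y \<in> sections A"
  shows "pair \<beta> (\<nu> (bracket A (\<pi> \<alpha>) y)) p - pair \<beta> (bracket A (\<pi> \<alpha>) (\<nu> y)) p
    + pair \<alpha> (mul A (\<nu> y) (\<pi> \<beta>)) p - pair \<alpha> (\<nu> (mul A y (\<pi> \<beta>))) p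
    - rho A (\<nu> y) (pair \<beta> (\<pi> \<alpha>)) p + rho A y (pair \<beta> (\<nu> (\<pi> \<alpha>))) p = 0"
proof -
  interpret D: anchored_bundle "deformed A N"
    by (rule deformed_anchored_bundle[OF N_endo])
  note pdm = pair_dual_mul[OF H_Sym2]
  have "pair (star_mul A N H \<alpha> \<beta>) y p = rho A (\<nu> (\<pi> \<alpha>)) (pair \<beta> y) p
      - pair \<beta> (bracket (deformed A N) (\<pi> \<alpha>) y) p
      + pair \<alpha> (mul (deformed A N) y (\<pi> \<beta>)) p - rho A (\<nu> y) (pair \<beta> (\<pi> \<alpha>)) p"
    unfolding star_mul_def
    using D.pair_dual_mul[of H \<alpha> \<beta> y p] H_Sym2 \<alpha> \<beta> y
    by (simp only: deformed_bundle rho_deformed)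
  moreover have "pair \<beta> (bracket (deformed A N) (\<pi> \<alpha>) y) p =
      pair \<beta> (bracket A (\<nu> (\<pi> \<alpha>)) y) p + pair \<beta> (bracket A (\<pi> \<alpha>) (\<nu> y)) p - pair \<beta> (\<nu> (bracket A (\<pi> \<alpha>) y)) p"
    by (simp add: bracket_def \<nu>_diff pair_add pair_diff sec \<alpha> \<beta> y)
  moreover have "pair \<alpha> (mul (deformed A N) y (\<pi> \<beta>)) p =
      pair \<alpha> (mul A (\<nu> y) (\<pi> \<beta>)) p + pair \<alpha> (mul A y (\<nu> (\<pi> \<beta>))) p - pair \<alpha> (\<nu> (mul A y (\<pi> \<beta>))) p"
    by (simp add: pair_add pair_diff sec \<alpha> \<beta> y)
  moreover have "pair (star_mul A N H \<alpha> \<beta>) y p = pair (dual_mul A H (\<nu>' \<alpha>) \<beta>) y p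
      + pair (dual_mul A H \<alpha> (\<nu>' \<beta>)) y p - pair (dual_mul A H \<alpha> \<beta>) (\<nu> y) p"
    unfolding star_eq[OF \<alpha> \<beta>] dual_mul_deformed_def pair_\<nu>'[OF y, symmetric] by (simp add: pair_def)
  ultimately show ?thesis
    using pdm[OF dual_map_section[OF N_endo \<alpha>] \<beta> y, of p] pdm[OF \<alpha> dual_map_section[OF N_endo \<beta>] y, of p]
      pdm[OF \<alpha> \<beta> endo_section[OF N_endo y], of p]
    by (simp add: \<pi>_\<nu>' pair_\<nu>' sec \<alpha> \<beta> y)
qed

text \<open>The commutator of left multiplication by \<open>x\<close> with the power of
  \<open>\<nu>\<close>, evaluated at \<open>b\<close>. The argument \<open>b\<close> precedes
  \<open>x\<close> because the later arguments treat this as an operator in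
  \<open>x\<close>.\<close>

definition defect :: "nat \<Rightarrow> ('m \<Rightarrow> 'v) \<Rightarrow> ('m \<Rightarrow> 'v) \<Rightarrow> 'm \<Rightarrow> 'v" where
  "defect l b x = (\<lambda>p. mul A x ((\<nu> ^^ l) b) p - (\<nu> ^^ l) (mul A x b) p)"

lemma defect_section: "b \<in> sections A \<Longrightarrow> x \<in> sections A \<Longrightarrow> defect l b x \<in> sections A"
  unfolding defect_def by (intro sections_diff mul_section \<nu>_pow_sec)

text \<open>Add and subtract \<open>\<nu>\<close> applied to the product of \<open>x\<close> with
  \<open>(\<nu> ^^ l) b\<close>.\<close>

lemma defect_Suc:
  assumes "b \<in> sections A" "x \<in> sections A"
  shows "defect (Suc l) b x = (\<lambda>p. defect 1 ((\<nu> ^^ l) b) x p + \<nu> (defect l b x) p)"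
  using assms by (simp add: defect_def \<nu>_diff mul_section \<nu>_pow_sec)

text \<open>This is the Nijenhuis identity for \<open>x\<close> and \<open>b\<close> with the term
  \<open>\<nu> (mul A (\<nu> x) b)\<close> moved to the other side.\<close>

lemma defect_1_\<nu>:
  assumes "b \<in> sections A" "x \<in> sections A"
  shows "defect 1 b (\<nu> x) = \<nu> (defect 1 b x)"
  using assms by (simp add: defect_def N_nijenhuis \<nu>_diff \<nu>_add sec)

lemma defect_\<nu>:
  assumes "b \<in> sections A" "x \<in> sections A"
  shows "defect l b (\<nu> x) = \<nu> (defect l b x)"
proof (induction l)
  case 0
  show ?case using lin_on_0[OF endo_lin_on[OF N_endo] subspace_fibre] by (simp add: defect_def app_def)
next
  case (Suc l)
  then show ?case
    using assms by (simp add: defect_Suc defect_1_\<nu> \<nu>_add defect_section sec \<nu>_pow_sec del: One_nat_def)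
qed

lemma defect_\<nu>_pow:
  assumes "b \<in> sections A" "x \<in> sections A"
  shows "defect l b ((\<nu> ^^ k) x) = (\<nu> ^^ k) (defect l b x)"
  by (induction k) (simp_all add: defect_\<nu> assms \<nu>_pow_sec)

text \<open>Combine \<open>star_identity\<close> at \<open>y = \<pi> \<gamma>\<close> with \<open>KV_identity\<close> at \<open>(\<alpha>, \<beta>, \<nu>' \<gamma>)\<close> and \<open>(\<alpha>, \<nu>' \<beta>, \<gamma>)\<close>.\<close>

lemma defect_1_symmetric:
  assumes \<alpha>: "\<alpha> \<in> dual_sections A" and \<beta>: "\<beta> \<in> dual_sections A" and \<gamma>: "\<gamma> \<in> dual_sections A"
  shows "pair \<gamma> (defect 1 (\<pi> \<beta>) (\<pi> \<alpha>)) = pair \<alpha> (defect 1 (\<pi> \<beta>) (\<pi> \<gamma>))"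
proof
  fix p
  note [simp] = \<pi>_\<nu>' pair_\<nu>' sec \<alpha> \<beta> \<gamma>
  show "pair \<gamma> (defect 1 (\<pi> \<beta>) (\<pi> \<alpha>)) p = pair \<alpha> (defect 1 (\<pi> \<beta>) (\<pi> \<gamma>)) p"
    using star_identity[OF \<alpha> \<beta>, of "\<pi> \<gamma>" p] KV_identity[OF \<alpha> \<beta>, of "\<nu>' \<gamma>" p]
      KV_identity[OF \<alpha> _ \<gamma>, of "\<nu>' \<beta>" p]
    by (simp add: defect_def pair_diff)
qed

text \<open>By \<open>defect_Suc\<close> the defect splits into two symmetric parts. In the second,
  \<open>\<nu>\<close> moves onto \<gamma> as \<open>\<nu>'\<close>, the induction hypothesis
  exchanges the covectors, and \<open>defect_\<nu>\<close> brings \<open>\<nu>\<close> back out.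
  This is why the induction must leave the covectors arbitrary.\<close>

lemma defect_symmetric:
  assumes \<beta>: "\<beta> \<in> dual_sections A"
  shows "\<alpha> \<in> dual_sections A \<Longrightarrow> \<gamma> \<in> dual_sections A \<Longrightarrow>
    pair \<gamma> (defect l (\<pi> \<beta>) (\<pi> \<alpha>)) = pair \<alpha> (defect l (\<pi> \<beta>) (\<pi> \<gamma>))"
proof (induction l arbitrary: \<alpha> \<gamma>)
  case 0
  then show ?case
    using lin_on_0[OF dual_sections_lin_on[of \<alpha>] subspace_fibre]
      lin_on_0[OF dual_sections_lin_on[of \<gamma>] subspace_fibre]
    by (simp add: defect_def pair_def)
next
  case (Suc l)
  note \<alpha> = Suc.prems(1) and \<gamma> = Suc.prems(2)
  note sec' = defect_section sec \<nu>_pow_sec \<alpha> \<beta> \<gamma>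
  \<comment> \<open>The power of \<open>\<nu>\<close> is absorbed into the covector: the one-step
    symmetry is used with \<open>(\<nu>' ^^ l) \<beta>\<close> in place of \<beta>.\<close>
  have D1: "pair \<gamma> (defect 1 ((\<nu> ^^ l) (\<pi> \<beta>)) (\<pi> \<alpha>)) = pair \<alpha> (defect 1 ((\<nu> ^^ l) (\<pi> \<beta>)) (\<pi> \<gamma>))"
    using defect_1_symmetric[OF \<alpha> \<nu>'_pow_sec[OF \<beta>, of l] \<gamma>] by (simp only: \<pi>_\<nu>'_pow[OF \<beta>])
  have "pair \<gamma> (\<nu> (defect l (\<pi> \<beta>) (\<pi> \<alpha>))) = pair (\<nu>' \<gamma>) (defect l (\<pi> \<beta>) (\<pi> \<alpha>))"
    by (simp add: pair_\<nu>' sec')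
  also have "\<dots> = pair \<alpha> (defect l (\<pi> \<beta>) (\<pi> (\<nu>' \<gamma>)))"
    by (intro Suc.IH \<alpha> dual_map_section[OF N_endo] \<gamma>)
  also have "\<dots> = pair \<alpha> (\<nu> (defect l (\<pi> \<beta>) (\<pi> \<gamma>)))"
    by (simp add: \<pi>_\<nu>' defect_\<nu> sec')
  finally show ?case using D1 by (simp add: defect_Suc pair_add sec' del: One_nat_def)
qed

text \<open>Apply the symmetry to \<open>(\<nu>' ^^ k) \<alpha>\<close>. On one side the power
  appears as \<open>\<nu> ^^ k\<close> inside the defect; on the other it passes through the pairing
  and back into the defect, which commutes with \<open>\<nu>\<close>.\<close>

lemma defect_symmetric_pow:
  assumes \<alpha>: "\<alpha> \<in> dual_sections A" and \<beta>: "\<beta> \<in> dual_sections A" and \<gamma>: "\<gamma> \<in> dual_sections A"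
  shows "pair \<gamma> (defect l (\<pi> \<beta>) ((\<nu> ^^ k) (\<pi> \<alpha>))) = pair \<alpha> (defect l (\<pi> \<beta>) ((\<nu> ^^ k) (\<pi> \<gamma>)))"
proof -
  note s = sharp_section[OF H_Sym2]
  have "pair \<gamma> (defect l (\<pi> \<beta>) (\<pi> ((\<nu>' ^^ k) \<alpha>))) = pair ((\<nu>' ^^ k) \<alpha>) (defect l (\<pi> \<beta>) (\<pi> \<gamma>))"
    by (rule defect_symmetric[OF \<beta> \<nu>'_pow_sec[OF \<alpha>] \<gamma>])
  then show ?thesis
    by (simp add: \<pi>_\<nu>'_pow \<alpha> pair_\<nu>'_pow defect_section s \<beta> \<gamma> defect_\<nu>_pow)
qed

section \<open>The symmetric tensors of the hierarchy\<close>

lemma endo_pow_fibre: "v \<in> fibre A p \<Longrightarrow> (N p ^^ k) v \<in> fibre A p"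
  by (induction k) (auto intro: endo_fibre[OF N_endo])

lemma endo_pow_sharp:
  assumes "\<alpha> \<in> dual_fibre A p"
  shows "(dual_map A N p ^^ k) \<alpha> \<in> dual_fibre A p"
    and "(N p ^^ k) (sharp A H p \<alpha>) = sharp A H p ((dual_map A N p ^^ k) \<alpha>)"
  using assms by (induction k) (simp_all add: N_sharp dual_map_fibre[OF N_endo])

lemma dual_map_pow: "v \<in> fibre A p \<Longrightarrow> (dual_map A N p ^^ k) \<alpha> v = \<alpha> ((N p ^^ k) v)"
proof (induction k arbitrary: v)
  case (Suc k)
  then show ?case by (simp add: dual_map_def endo_fibre[OF N_endo] funpow_swap1)
qed simp

text \<open>A power of \<open>N p\<close> after the sharp map equals the sharp map after the same
  power of the dual map, so the symmetry of \<open>H\<close> applies and the power can be returned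
  to the vector on the other side.\<close>

lemma H_pow_commute:
  assumes "\<alpha> \<in> dual_fibre A p" "\<beta> \<in> dual_fibre A p"
  shows "\<beta> ((N p ^^ k) (sharp A H p \<alpha>)) = \<alpha> ((N p ^^ k) (sharp A H p \<beta>))"
proof -
  note sp = sharp_pairing[OF H_Sym2] and d = endo_pow_sharp(1)[OF assms(1), of k]
  have "\<beta> ((N p ^^ k) (sharp A H p \<alpha>)) = (dual_map A N p ^^ k) \<alpha> (sharp A H p \<beta>)"
    using sp[OF d assms(2)] sp[OF assms(2) d] Sym2_sym[OF H_Sym2 d assms(2)]
    by (simp add: endo_pow_sharp(2) assms)
  then show ?thesis by (simp add: dual_map_pow sharp_in_fibre[OF H_Sym2] assms)
qed

lemma H_pow_Sym2: "H_pow A H N k \<in> Sym2 A"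
  unfolding Sym2_def
proof (intro CollectI conjI allI ballI impI, goal_cases)
  case (1 p \<alpha> \<beta>)
  then show ?case by (simp add: H_pow_def H_pow_commute)
next
  case (2 p \<alpha> \<beta> \<gamma> c)
  \<comment> \<open>Symmetry moves the covector in which linearity is claimed to the outside, where
    it is merely evaluated at a fixed vector.\<close>
  then show ?case
    by (simp add: H_pow_def dual_fibre_subspace H_pow_commute[of _ p \<gamma>])
next
  case (3 p \<alpha> \<beta> \<gamma> c)
  then show ?case
    by (simp add: H_pow_def dual_fibre_subspace H_pow_commute[of _ p \<gamma>])
next
  case (4 p \<alpha> \<beta>)
  then show ?case by (auto simp: H_pow_def)
next
  case (5 \<tau>)
  obtain U \<phi> where \<tau>: "\<tau> = (U, \<phi>)" by force
  with 5 have t: "(U, \<phi>) \<in> trivs A" by simp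
  note U = triv_open[OF t]
  have "smooth_map_on (atlas A) U (\<lambda>p. H_pow A H N k p (const_cosec A \<phi> u p) (const_cosec A \<phi> w p))"
    if u: "linear u" and w: "linear w" for u w
  proof -
    note cc = const_cosec_in_dual_fibre[OF t]
    let ?v = "\<lambda>p. sharp A H p (const_cosec A \<phi> u p)"
    have v: "?v p \<in> fibre A p" if "p \<in> U" for p
      using sharp_in_fibre[OF H_Sym2 cc[OF that u]] .
    \<comment> \<open>The covector is constant in the trivialisation: its values on the frame are
      the numbers \<open>u w\<close>.\<close>
    have "smooth_map_on (atlas A) U (\<lambda>p. const_cosec A \<phi> u p (const_sec A \<phi> w p))" for w
      by (rule smooth_map_on_cong[OF smooth_map_on_const[of _ _ "u w"] U])
        (simp add: const_cosec_def const_sec_in_fibre[OF t] triv_const_sec[OF t])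
    then have s: "smooth_map_on (atlas A) U (\<lambda>p. \<phi> p (?v p))"
      by (intro sharp_smooth[OF H_Sym2 t] cc u)
    have "smooth_map_on (atlas A) U (\<lambda>p. \<phi> p ((N p ^^ k) (?v p)))"
    proof (induction k)
      case (Suc k)
      then show ?case
        using endo_smooth[OF N_endo t, of "\<lambda>p. (N p ^^ k) (?v p)"] endo_pow_fibre v by simp
    qed (use s in simp)
    from smooth_map_on_bounded_linear[OF U bounded_linear_of_finite_dim[OF finite_dim_fibre w] this]
    show ?thesis
    proof (rule smooth_map_on_cong[OF _ U])
      fix p assume p: "p \<in> U"
      have "H_pow A H N k p (const_cosec A \<phi> u p) (const_cosec A \<phi> w p) = const_cosec A \<phi> w p ((N p ^^ k) (?v p))"
        by (simp add: H_pow_def cc p u w)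
      then show "w (\<phi> p ((N p ^^ k) (?v p))) = H_pow A H N k p (const_cosec A \<phi> u p) (const_cosec A \<phi> w p)"
        by (simp add: const_cosec_def[of A \<phi> w] endo_pow_fibre v p)
    qed
  qed
  then show ?case by (simp add: \<tau>)
qed

lemma sharp_H_pow:
  assumes "\<alpha> \<in> dual_fibre A p"
  shows "sharp A (H_pow A H N k) p \<alpha> = (N p ^^ k) (sharp A H p \<alpha>)"
  by (rule sharp_eqI) (simp_all add: H_pow_def assms endo_pow_fibre sharp_in_fibre[OF H_Sym2])

lemma app_sharp_H_pow:
  assumes \<alpha>: "\<alpha> \<in> dual_sections A"
  shows "app (sharp A (H_pow A H N k)) \<alpha> = (\<nu> ^^ k) (\<pi> \<alpha>)"
proof -
  have "(\<nu> ^^ k) x p = (N p ^^ k) (x p)" for x p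
    by (induction k arbitrary: x) (simp_all add: app_def)
  then show ?thesis
    using sharp_H_pow[OF dual_sections_fibre[OF \<alpha>]] by (auto simp: app_def)
qed

lemma KV_bracket_H_pow: "KV_bracket_zero A (H_pow A H N k) (H_pow A H N l)"
  unfolding KV_bracket_zero_def
proof (intro ballI ext)
  fix \<alpha> \<gamma> \<beta> p
  assume \<alpha>: "\<alpha> \<in> dual_sections A" and \<gamma>: "\<gamma> \<in> dual_sections A" and \<beta>: "\<beta> \<in> dual_sections A"
  note [simp] = \<pi>_\<nu>'_pow pair_\<nu>'_pow sec \<nu>_pow_sec \<alpha> \<beta> \<gamma>
  \<comment> \<open>The Koszul-Vinberg identity for \<open>H\<close> at
    \<open>(\<nu>' ^^ k) \<alpha>\<close>, \<beta> and \<open>(\<nu>' ^^ l) \<gamma>\<close>. With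
    \<beta> unchanged, the powers acting on its products come out in front, where \<alpha> and
    \<gamma> are paired.\<close>
  have K: "rho A ((\<nu> ^^ k) (\<pi> \<alpha>)) (pair \<beta> ((\<nu> ^^ l) (\<pi> \<gamma>))) p
    - pair \<beta> (bracket A ((\<nu> ^^ k) (\<pi> \<alpha>)) ((\<nu> ^^ l) (\<pi> \<gamma>))) p
    + pair \<alpha> ((\<nu> ^^ k) (mul A ((\<nu> ^^ l) (\<pi> \<gamma>)) (\<pi> \<beta>))) p
    - rho A ((\<nu> ^^ l) (\<pi> \<gamma>)) (pair \<beta> ((\<nu> ^^ k) (\<pi> \<alpha>))) p
    - pair \<gamma> ((\<nu> ^^ l) (mul A ((\<nu> ^^ k) (\<pi> \<alpha>)) (\<pi> \<beta>))) p = 0" for k l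
    using KV_identity[OF \<nu>'_pow_sec[OF \<alpha>] \<beta> \<nu>'_pow_sec[OF \<gamma>], of k l p] by simp
  have D: "pair \<gamma> (mul A ((\<nu> ^^ k) (\<pi> \<alpha>)) ((\<nu> ^^ l) (\<pi> \<beta>))) p
      - pair \<gamma> ((\<nu> ^^ l) (mul A ((\<nu> ^^ k) (\<pi> \<alpha>)) (\<pi> \<beta>))) p =
    pair \<alpha> (mul A ((\<nu> ^^ k) (\<pi> \<gamma>)) ((\<nu> ^^ l) (\<pi> \<beta>))) p
      - pair \<alpha> ((\<nu> ^^ l) (mul A ((\<nu> ^^ k) (\<pi> \<gamma>)) (\<pi> \<beta>))) p" for k l
    using fun_cong[OF defect_symmetric_pow[OF \<alpha> \<beta> \<gamma>, of l k], of p] by (simp add: defect_def pair_diff)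
  \<comment> \<open>The anchor terms of one summand are shared between \<open>K k l\<close> and
    \<open>K l k\<close>, so only the sum over both orders can match. The product terms then differ
    by whether a power acts on \<open>\<pi> \<beta>\<close> inside the product or in front of it,
    and the two instances of \<open>D\<close> cancel this difference.\<close>
  show "KV_bracket A (H_pow A H N k) (H_pow A H N l) \<alpha> \<gamma> \<beta> p = 0"
    unfolding KV_bracket_def KV_summand_def app_sharp_H_pow[OF \<alpha>] app_sharp_H_pow[OF \<beta>] app_sharp_H_pow[OF \<gamma>]
    using K[of k l] K[of l k] D[of k l] D[of l k] by argo
qed

end

theorem theorem4p3:
  fixes A :: "('m::{t2_space,second_countable_topology}, 'e::real_normed_vector,
      'v::real_vector, 'f::real_normed_vector) lsa"
    and H :: "'m \<Rightarrow> ('v \<Rightarrow> real) \<Rightarrow> ('v \<Rightarrow> real) \<Rightarrow> real"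
    and N :: "'m \<Rightarrow> 'v \<Rightarrow> 'v"
  assumes "left_symmetric_algebroid A"
    and "KVN_structure A H N"
  shows "(\<forall>k. H_pow A H N k \<in> Sym2 A \<and>
            (\<forall>p. \<forall>\<alpha>\<in>dual_fibre A p. sharp A (H_pow A H N k) p \<alpha> = (N p ^^ k) (sharp A H p \<alpha>))) \<and>
         (\<forall>k. koszul_vinberg A (H_pow A H N k)) \<and>
         (\<forall>k l. KV_compatible A (H_pow A H N k) (H_pow A H N l))"
proof -
  interpret anchored_bundle A by (rule left_symmetric_algebroid_anchored_bundle[OF assms(1)])
  interpret kvn A H N by unfold_locales (rule assms(2))
  show ?thesis
    \<comment> \<open>The Koszul-Vinberg property is the diagonal case of
      \<open>KV_bracket_H_pow\<close>.\<close>
    by (simp add: KV_compatible_def koszul_vinberg_def H_pow_Sym2 KV_bracket_H_pow sharp_H_pow)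
qed

end
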